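(* In the setting described in the context, let $\vartheta\in(0,\infty)$, $p\in[\max\{2,1/\varphi\},\infty)$, $\varrho\in[0,1-\rho)$, and assume that $$\sup_{t\in[0,T]}\sup_{I\in\mathcal{D}}\mathbb{E}\Big[\|X_t\|_V^{p(1+\varphi/2)\max\{2,\varphi\}}+\|P_IO_t\|_V^{p\varphi}\Big]+\sup_{M\in\mathbb{N}}\sup_{I\in\mathcal{D}}\sup_{t\in[0,T]}\mathbb{E}\Big[\big|\|\mathcal{O}^{M,I}_t\|_{H_\gamma}^2+\Phi(\mathcal{O}^{M,I})+\phi(\mathcal{O}^{M,I})\big|^{p\max\{2\vartheta,\,2+\varphi,\,(1+\varphi/2)\varphi/2\}}\Big]<\infty.$$ Then (i) $\sup_{M\in\mathbb{N}}\sup_{I\in\mathcal{D}}\sup_{t\in[0,T]}\mathbb{E}\big[\|\mathcal{X}^{M,I}_t\|_{H_\gamma}^{p\max\{4\vartheta,\,4+2\varphi,\,\varphi(1+\varphi/2)\}}\big]<\infty$, and (ii) there exists a real number $C\in(0,\infty)$ such that for all $M\in\mathbb{N}$, $I\in\mathcal{D}$ it holds that $$\sup_{t\in[0,T]}\big(\mathbb{E}[\|X_t-\mathcal{X}^{M,I}_t\|_H^p]\big)^{1/p}\le C\bigg[M^{-\min\{\vartheta\chi,\varrho\}}+\|(-A)^{-\varrho}(\mathrm{Id}_H-P_I)\|_{L(H)}+\sup_{t\in[0,T]}\Big(\mathbb{E}\big[\|(\mathrm{Id}_H-P_I)O_t\|_V^{2p}+\|P_IO_t-\mathcal{O}^{M,I}_t\|_V^{2p}+\|P_I(O_t-O_{\lfloor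 t\rfloor_{T/M}})\|_V^{2p}\big]\Big)^{1/(2p)}\bigg].$$
   Context: Notation: for $h\in(0,\infty)$, $t\in\mathbb{R}$, $\lfloor t\rfloor_h=\max(\{0,h,-h,2h,-2h,\ldots\}\cap(-\infty,t])$. For a set $S$, $\mathcal{P}_0(S)$ is the set of finite subsets of $S$. $\mathcal{C}(X,Y)$ denotes continuous functions from $X$ to $Y$, $\mathcal{B}(X)$ the Borel sigma-algebra. Setting: Let $(H,\langle\cdot,\cdot\rangle_H,\|\cdot\|_H)$ be a separable $\mathbb{R}$-Hilbert space, let $\mathbb{H}\subseteq H$ be a non-empty orthonormal basis of $H$, let $T,c,\varphi\in(0,\infty)$, $\epsilon\in[0,1)$, $\rho\in[0,\tfrac12)$, $\gamma\in(\rho,\tfrac12]$, $\chi\in\big(0,\tfrac{\gamma-\rho}{1+\varphi/2}\big]\cap\big(0,\tfrac{1-\rho}{1+\varphi}\big]$, $\mathcal{D}\subseteq\mathcal{P}_0(\mathbb{H})\setminus\{\emptyset\}$, and let $\mu\colon\mathbb{H}\to\mathbb{R}$ satisfy $\sup_{h\in\mathbb{H}}\mu_h<0$. Let $A\colon D(A)\subseteq H\to H$ be the linear operator with $D(A)=\{v\in H\colon\sum_{h\in\mathbb{H}}|\mu_h\langle h,v\rangle_H|^2<\infty\}$ and $Av=\sum_{h\in\mathbb{H}}\mu_h\langle h,v\rangle_Hh$ for $v\in D(A)$. Let $(H_r,\langle\cdot,\cdot\rangle_{H_r},\|\cdot\|_{H_r})$, $r\in\mathbb{R}$, be the family of interpolation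 spaces associated to $-A$ (for $r\ge0$: $H_r=D((-A)^r)$ with $\langle v,w\rangle_{H_r}=\langle(-A)^rv,(-A)^rw\rangle_H$; for $r<0$: the completion of $H$ with respect to $\|(-A)^r\cdot\|_H$). Let $(V,\|\cdot\|_V)$ be an $\mathbb{R}$-Banach space with $H_\rho\subseteq V\subseteq H$ continuously and densely. Let $\phi,\Phi\colon\mathcal{C}([0,T],H_1)\to[0,\infty)$ be $\mathcal{B}(\mathcal{C}([0,T],H_1))/\mathcal{B}([0,\infty))$-measurable functions, and let $F\in\mathcal{C}(V,H)$, $(P_I)_{I\in\mathcal{P}_0(\mathbb{H})}\subseteq L(H)$ satisfy for all $I\in\mathcal{P}_0(\mathbb{H})$, $u\in H$, $v,w\in P_I(H)$, $x\in\mathcal{C}([0,T],H_1)$ that $P_I(u)=\sum_{h\in I}\langle h,u\rangle_Hh$, $$\langle v-w,Av+F(v)-Aw-F(w)\rangle_H\le c\|v-w\|_H^2,$$ $$\sup_{t\in[0,T]}\big(\langle v,P_IF(v+x_t)\rangle_{H_{1/2}}+\phi(x)\langle v,F(v+x_t)\rangle_H\big)\le\epsilon\|v\|_{H_1}^2+(c+\phi(x))\|v\|_{H_{1/2}}^2+c\,\phi(x)\|v\|_H^2+\Phi(x),$$ $$\|F(v)-F(w)\|_H^2\le c\|v-w\|_V^2(1+\|v\|_V^\varphi+\|w\|_V^\varphi).$$ Let $(\Omega,\mathcal{F},\mathbb{P})$ be a probability space, let $X,O\colon[0,T]\times\Omega\to V$ and $\mathcal{O}^{M,I}\colon[0,T]\times\Omega\to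 H_1$, $M\in\mathbb{N}$, $I\in\mathcal{D}$, be stochastic processes with continuous sample paths, let $\mathcal{X}^{M,I}\colon[0,T]\times\Omega\to H_\gamma$, $M\in\mathbb{N}$, $I\in\mathcal{D}$, be stochastic processes, and assume for all $t\in[0,T]$, $M\in\mathbb{N}$, $I\in\mathcal{D}$ that $\mathcal{O}^{M,I}([0,T]\times\Omega)\subseteq P_I(H)$, that $\mathbb{P}$-a.s. $X_t=\int_0^te^{(t-s)A}F(X_s)\,ds+O_t$, and that $\mathbb{P}$-a.s. $$\mathcal{X}^{M,I}_t=\int_0^tP_Ie^{(t-s)A}\,\mathbb{1}_{\{\|\mathcal{X}^{M,I}_{\lfloor s\rfloor_{T/M}}\|_{H_\gamma}+\|\mathcal{O}^{M,I}_{\lfloor s\rfloor_{T/M}}\|_{H_\gamma}\le(M/T)^\chi\}}F(\mathcal{X}^{M,I}_{\lfloor s\rfloor_{T/M}})\,ds+\mathcal{O}^{M,I}_t.$$ *)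

theory Defs
  imports "HOL-Probability.Probability"
begin

text \<open>The largest point of the grid \<open>h \<int>\<close> that does not exceed \<open>t\<close>; see \<open>grid_floor_eq\<close>.\<close>

definition grid_floor :: "real \<Rightarrow> real \<Rightarrow> real" where
  "grid_floor h t = (GREATEST s. s \<in> {of_int k * h |k. True} \<inter> {..t})"

lemma grid_floor_eq:
  assumes "h > 0"
  shows "grid_floor h t = of_int \<lfloor>t / h\<rfloor> * h"
  unfolding grid_floor_def
proof (rule Greatest_equality)
  show "of_int \<lfloor>t / h\<rfloor> * h \<in> {of_int k * h |k. True} \<inter> {..t}"
    using assms pos_le_divide_eq[of h "of_int \<lfloor>t / h\<rfloor>" t] by auto
next
  fix s assume "s \<in> {of_int k * h |k. True} \<inter> {..t}"
  then obtain k where "s = of_int k * h" "of_int k * h \<le> t" by auto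
  then show "s \<le> of_int \<lfloor>t / h\<rfloor> * h"
    using assms by (simp add: le_floor_iff pos_le_divide_eq)
qed

text \<open>Real powers of extended nonnegative reals, for positive exponents only.\<close>

definition ennreal_powr :: "ennreal \<Rightarrow> real \<Rightarrow> ennreal" where
  "ennreal_powr x a = (if x = \<infinity> then \<infinity> else ennreal (enn2real x powr a))"

definition orthonormal_basis :: "'h::real_inner set \<Rightarrow> bool" where
  "orthonormal_basis B \<longleftrightarrow>
     (\<forall>h\<in>B. norm h = 1) \<and> pairwise orthogonal B \<and> closure (span B) = UNIV"

definition span_proj :: "'h::real_inner set \<Rightarrow> 'h \<Rightarrow> 'h" where
  "span_proj I u = (\<Sum>h\<in>I. (h \<bullet> u) *\<^sub>R h)"

text \<open>
  The possibly unbounded operator \<open>v \<mapsto> \<Sum>h\<in>B. a h \<langle>h, v\<rangle> h\<close>, diagonal in the orthonormal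
  basis \<open>B\<close>, and its domain. On its domain the series converges unconditionally; the
  value of \<open>diag_op\<close> is meaningful only there.
\<close>

definition diag_domain :: "'h::real_inner set \<Rightarrow> ('h \<Rightarrow> real) \<Rightarrow> 'h set" where
  "diag_domain B a = {v. (\<lambda>h. \<bar>a h * (h \<bullet> v)\<bar>\<^sup>2) summable_on B}"

definition diag_op :: "'h::real_inner set \<Rightarrow> ('h \<Rightarrow> real) \<Rightarrow> 'h \<Rightarrow> 'h" where
  "diag_op B a v = (\<Sum>\<^sub>\<infinity>h\<in>B. (a h * (h \<bullet> v)) *\<^sub>R h)"

text \<open>
  With \<open>A = diag_op B \<mu>\<close>: the semigroup \<open>exp (t A)\<close> for \<open>t \<ge> 0\<close>, the powers \<open>(-A)\<^sup>r\<close> for real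
  \<open>r\<close>, and the interpolation spaces \<open>H\<^sub>r\<close>. The description of \<open>H\<^sub>r\<close> as the domain of
  \<open>(-A)\<^sup>r\<close> is the right one for \<open>r \<ge> 0\<close> only; for \<open>r < 0\<close> one would have to take a completion.
\<close>

definition diag_semigroup :: "'h::real_inner set \<Rightarrow> ('h \<Rightarrow> real) \<Rightarrow> real \<Rightarrow> 'h \<Rightarrow> 'h" where
  "diag_semigroup B \<mu> t = diag_op B (\<lambda>h. exp (t * \<mu> h))"

definition neg_power :: "'h::real_inner set \<Rightarrow> ('h \<Rightarrow> real) \<Rightarrow> real \<Rightarrow> 'h \<Rightarrow> 'h" where
  "neg_power B \<mu> r = diag_op B (\<lambda>h. (- \<mu> h) powr r)"

definition interp_space :: "'h::real_inner set \<Rightarrow> ('h \<Rightarrow> real) \<Rightarrow> real \<Rightarrow> 'h set" where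
  "interp_space B \<mu> r = diag_domain B (\<lambda>h. (- \<mu> h) powr r)"

definition interp_inner :: "'h::real_inner set \<Rightarrow> ('h \<Rightarrow> real) \<Rightarrow> real \<Rightarrow> 'h \<Rightarrow> 'h \<Rightarrow> real" where
  "interp_inner B \<mu> r v w = neg_power B \<mu> r v \<bullet> neg_power B \<mu> r w"

definition interp_norm :: "'h::real_inner set \<Rightarrow> ('h \<Rightarrow> real) \<Rightarrow> real \<Rightarrow> 'h \<Rightarrow> real" where
  "interp_norm B \<mu> r v = norm (neg_power B \<mu> r v)"

text \<open>
  A linear subspace \<open>V\<close> of a vector space with a norm \<open>N\<close> of its own, and the metric space it
  forms. \<open>N\<close> is unconstrained off \<open>V\<close>, whereas \<^locale>\<open>Metric_space\<close> requires the distance to be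
  symmetric and nonnegative everywhere; hence the value \<open>0\<close> off \<open>V\<close>.
\<close>

definition norm_on :: "'a::real_vector set \<Rightarrow> ('a \<Rightarrow> real) \<Rightarrow> bool" where
  "norm_on V N \<longleftrightarrow> subspace V \<and>
     (\<forall>v\<in>V. 0 \<le> N v \<and> (N v = 0 \<longleftrightarrow> v = 0)) \<and>
     (\<forall>v\<in>V. \<forall>a. N (a *\<^sub>R v) = \<bar>a\<bar> * N v) \<and>
     (\<forall>v\<in>V. \<forall>w\<in>V. N (v + w) \<le> N v + N w)"

definition norm_metric :: "'a::real_vector set \<Rightarrow> ('a \<Rightarrow> real) \<Rightarrow> 'a metric" where
  "norm_metric V N = metric (V, \<lambda>v w. if v \<in> V \<and> w \<in> V then N (v - w) else 0)"

lemma Metric_space_norm_on: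
  assumes "norm_on V N"
  shows "Metric_space V (\<lambda>v w. if v \<in> V \<and> w \<in> V then N (v - w) else 0)"
proof -
  have V: "subspace V" and N0: "\<And>v. v \<in> V \<Longrightarrow> 0 \<le> N v" "\<And>v. v \<in> V \<Longrightarrow> N v = 0 \<longleftrightarrow> v = 0"
    and sc: "\<And>v a. v \<in> V \<Longrightarrow> N (a *\<^sub>R v) = \<bar>a\<bar> * N v"
    and tri: "\<And>v w. v \<in> V \<Longrightarrow> w \<in> V \<Longrightarrow> N (v + w) \<le> N v + N w"
    using assms by (auto simp: norm_on_def)
  have diff: "v - w \<in> V" if "v \<in> V" "w \<in> V" for v w
    using V that by (rule subspace_diff)
  show ?thesis
  proof
    fix v w show "0 \<le> (if v \<in> V \<and> w \<in> V then N (v - w) else 0)"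
      using N0(1) diff by auto
    show "(if v \<in> V \<and> w \<in> V then N (v - w) else 0) = (if w \<in> V \<and> v \<in> V then N (w - v) else 0)"
      using sc[of "v - w" "-1"] diff by auto
  next
    fix v w assume "v \<in> V" "w \<in> V"
    then show "((if v \<in> V \<and> w \<in> V then N (v - w) else 0) = 0) = (v = w)"
      using N0(2) diff by auto
  next
    fix u v w assume "u \<in> V" "v \<in> V" "w \<in> V"
    then show "(if u \<in> V \<and> w \<in> V then N (u - w) else 0)
      \<le> (if u \<in> V \<and> v \<in> V then N (u - v) else 0) + (if v \<in> V \<and> w \<in> V then N (v - w) else 0)"
      using tri[of "u - v" "v - w"] diff by simp
  qed
qed

definition interp_metric :: "'h::real_inner set \<Rightarrow> ('h \<Rightarrow> real) \<Rightarrow> real \<Rightarrow> 'h metric" where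
  "interp_metric B \<mu> r = norm_metric (interp_space B \<mu> r) (interp_norm B \<mu> r)"

definition dense_continuous_embedding :: "'a metric \<Rightarrow> 'a metric \<Rightarrow> bool" where
  "dense_continuous_embedding m1 m2 \<longleftrightarrow> mspace m1 \<subseteq> mspace m2 \<and>
     continuous_map (mtopology_of m1) (mtopology_of m2) (\<lambda>v. v) \<and>
     mtopology_of m2 closure_of mspace m1 = mspace m2"

definition metric_borel :: "'a metric \<Rightarrow> 'a measure" where
  "metric_borel m = sigma (mspace m) {U. openin (mtopology_of m) U}"

text \<open>
  \<open>C([0,T], m)\<close> with the supremum metric. Its elements are functions on \<open>\<real>\<close> that are
  \<^term>\<open>undefined\<close> off \<open>{0..T}\<close>; hence the use of \<^term>\<open>restrict\<close> in \<open>sample_path\<close>.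
\<close>

definition path_metric :: "real \<Rightarrow> 'a metric \<Rightarrow> (real \<Rightarrow> 'a) metric" where
  "path_metric T m = cfunspace (top_of_set {0..T}) m"

definition sample_path :: "real \<Rightarrow> (real \<Rightarrow> 'w \<Rightarrow> 'a) \<Rightarrow> 'w \<Rightarrow> (real \<Rightarrow> 'a)" where
  "sample_path T X \<omega> = restrict (\<lambda>t. X t \<omega>) {0..T}"

definition process :: "'w measure \<Rightarrow> real \<Rightarrow> 'a metric \<Rightarrow> (real \<Rightarrow> 'w \<Rightarrow> 'a) \<Rightarrow> bool" where
  "process P T m X \<longleftrightarrow> (\<forall>t\<in>{0..T}. X t \<in> P \<rightarrow>\<^sub>M metric_borel m)"

definition continuous_process :: "'w measure \<Rightarrow> real \<Rightarrow> 'a metric \<Rightarrow> (real \<Rightarrow> 'w \<Rightarrow> 'a) \<Rightarrow> bool" where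
  "continuous_process P T m X \<longleftrightarrow> process P T m X \<and>
     (\<forall>\<omega>\<in>space P. continuous_map (top_of_set {0..T}) (mtopology_of m) (\<lambda>t. X t \<omega>))"

end

theory Submission
  imports Defs
begin

text \<open>
  The solution is \<open>X = (drift of X) + O\<close> and the scheme is \<open>\<X> = N + \<O>\<close>, where the drift \<open>N\<close> is the
  convolution of the semigroup with the truncated force \<open>f\<close>, a step function in time with values
  \<open>F (\<X>)\<close> at the grid points. Both drifts satisfy evolution equations in which the unbounded
  operator is diagonal, so in the coordinates of the basis they are scalar Duhamel integrals with
  \<open>u' = \<mu> u + f\<close>. All analysis of the evolution takes place in finitely many such coordinates;
  infinite sections are reached by taking suprema over finite ones (\<open>interp_norm_integral_le\<close>).

  The first assertion is a Lyapunov estimate. Along a path, the derivative of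
  \<open>\<parallel>N\<parallel>\<^sub>1\<^sub>/\<^sub>2\<^sup>2 + \<phi>(\<O>) \<parallel>N\<parallel>\<^sup>2\<close> is controlled by the coercivity condition, provided that the force \<open>F (\<X>)\<close> at the
  last grid point may be replaced by \<open>F (N + \<O>)\<close> with \<open>N\<close> at the current time and \<open>\<O>\<close> at the last grid
  point. The error of this replacement is bounded by a constant: it involves no increment of the
  noise, the increment of \<open>N\<close> over a grid cell is a positive power of the step size \<open>h\<close>, and the
  truncation limits the local Lipschitz constant of \<open>F\<close> to a negative power of \<open>h\<close>. The two upper
  bounds on \<open>chi\<close> are what makes these powers cancel (\<open>truncated_increment\<close>,
  \<open>truncated_consistency\<close>). The outcome \<open>\<parallel>N\<parallel>\<^sub>1\<^sub>/\<^sub>2\<^sup>2 \<le> C (1 + \<Phi>(\<O>) + \<phi>(\<O>))\<close> is \<open>a_priori_bound\<close>, and the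
  moments of \<open>\<X>\<close> follow from those assumed of the noise (\<open>scheme_moments\<close>).

  For the second assertion, with \<open>P\<close> the projection onto the section, write
  \<open>X - \<X> = (1 - P) X + (P (X - O) - N) + (P O - \<O>)\<close>. The last summand is part of the right-hand side.
  In the first one the noise is, too, and the drift gains \<open>\<parallel>(-A)\<^bsup>-varrho\<^esup> (1 - P)\<parallel>\<close> from the smoothing
  of the semigroup, since \<open>\<rho> + varrho < 1\<close> (\<open>complement_morder\<close>). The middle summand is treated by
  Gronwall's lemma: the one-sided Lipschitz condition, applied to \<open>P X\<close> and \<open>N + P O\<close>, leaves only
  the two defects \<open>F (X) - F (P X)\<close> and \<open>F (N + P O) - f\<close> as sources (\<open>pathwise_error\<close>). The second one
  splits into \<open>F (N + P O) - F (\<X>)\<close>, with \<open>\<X>\<close> at the last grid point, and the part of \<open>F (\<X>)\<close> that is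
  cut off. The two differences of values of \<open>F\<close> are of the order of the right-hand side in \<open>L\<^sup>p\<close>: the
  arguments differ by that order in \<open>L\<^bsup>2p\<^esup>\<close> of \<open>V\<close>, and the local Lipschitz constant is bounded in \<open>L\<^bsup>2p\<^esup>\<close>
  (\<open>lipschitz_morder\<close>). The cut-off part is small because it lives where a random variable with many
  moments exceeds \<open>h\<^bsup>-chi\<^esup>\<close> (\<open>defect_truncation\<close>). Finally \<open>p \<ge> 2\<close> permits Jensen's inequality to pass
  from the time integral of the squared defect to \<open>p\<close>-th moments (\<open>drift_error_morder\<close>).

  All constants have to be uniform over the discretisations. For this a discretisation is paired
  with an upper bound \<open>e\<close> for its right-hand side, and processes are compared with powers of \<open>e\<close> by a
  calculus of moment orders (\<open>morder\<close>).
\<close>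

section \<open>Expansions in an orthonormal basis\<close>

locale hilbert_basis =
  fixes B :: "'h::{real_inner, banach, second_countable_topology} set"
  assumes orthonormal_basis: "orthonormal_basis B"
begin

lemma inner_basis: "h \<in> B \<Longrightarrow> k \<in> B \<Longrightarrow> h \<bullet> k = of_bool (h = k)"
  using orthonormal_basis
  by (auto simp: orthonormal_basis_def pairwise_def orthogonal_def norm_eq_1)

lemma inner_basis_sum:
  assumes "finite I" "I \<subseteq> B" "k \<in> B"
  shows "k \<bullet> (\<Sum>h\<in>I. a h *\<^sub>R h) = (if k \<in> I then a k else 0)"
proof -
  have "k \<bullet> (\<Sum>h\<in>I. a h *\<^sub>R h) = (\<Sum>h\<in>I. if k = h then a h else 0)"
    unfolding inner_sum_right by (rule sum.cong) (use assms in \<open>auto simp: inner_basis subset_iff\<close>)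
  then show ?thesis using assms by (simp add: sum.delta')
qed

lemma inner_span_proj:
  "finite I \<Longrightarrow> I \<subseteq> B \<Longrightarrow> k \<in> B \<Longrightarrow> k \<bullet> span_proj I v = (if k \<in> I then k \<bullet> v else 0)"
  unfolding span_proj_def by (subst inner_basis_sum) auto

lemma norm_basis_sum_sq:
  assumes "finite I" "I \<subseteq> B"
  shows "(norm (\<Sum>h\<in>I. a h *\<^sub>R h))\<^sup>2 = (\<Sum>h\<in>I. (a h)\<^sup>2)"
proof -
  have "(norm (\<Sum>h\<in>I. a h *\<^sub>R h))\<^sup>2 = (\<Sum>h\<in>I. a h *\<^sub>R h) \<bullet> (\<Sum>h\<in>I. a h *\<^sub>R h)"
    by (simp add: power2_norm_eq_inner)
  also have "\<dots> = (\<Sum>h\<in>I. a h * (h \<bullet> (\<Sum>h\<in>I. a h *\<^sub>R h)))"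
    by (subst inner_sum_left) simp
  also have "\<dots> = (\<Sum>h\<in>I. (a h)\<^sup>2)"
    by (rule sum.cong) (use assms in \<open>auto simp: inner_basis_sum power2_eq_square subset_iff\<close>)
  finally show ?thesis .
qed

lemma norm_span_proj_sq: "finite I \<Longrightarrow> I \<subseteq> B \<Longrightarrow> (norm (span_proj I v))\<^sup>2 = (\<Sum>h\<in>I. (h \<bullet> v)\<^sup>2)"
  unfolding span_proj_def by (rule norm_basis_sum_sq)

lemma span_proj_span_proj [simp]:
  "finite I \<Longrightarrow> I \<subseteq> B \<Longrightarrow> span_proj I (span_proj I v) = span_proj I v"
  by (simp add: span_proj_def[of I "span_proj I v"] inner_span_proj subset_iff)
    (simp add: span_proj_def)

lemma range_span_proj_iff:
  "finite I \<Longrightarrow> I \<subseteq> B \<Longrightarrow> v \<in> range (span_proj I) \<longleftrightarrow> span_proj I v = v"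
  by (metis rangeE rangeI span_proj_span_proj)

lemma bounded_linear_span_proj: "bounded_linear (span_proj I)"
  unfolding span_proj_def
  by (intro bounded_linear_sum bounded_linear_scaleR_const bounded_linear_inner_right)

lemma span_proj_add: "span_proj I (v + w) = span_proj I v + span_proj I w"
  and span_proj_diff: "span_proj I (v - w) = span_proj I v - span_proj I w"
  using bounded_linear.linear[OF bounded_linear_span_proj[of I]] by (simp_all add: linear_add linear_diff)

lemma inner_span_proj_left: "span_proj I v \<bullet> w = (\<Sum>h\<in>I. (h \<bullet> v) * (h \<bullet> w))"
  by (simp add: span_proj_def inner_sum_left)

lemma Bessel_inequality:
  assumes "finite I" "I \<subseteq> B"
  shows "(\<Sum>h\<in>I. (h \<bullet> v)\<^sup>2) \<le> (norm v)\<^sup>2"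
proof -
  have "v \<bullet> span_proj I v = (norm (span_proj I v))\<^sup>2"
    unfolding norm_span_proj_sq[OF assms] inner_commute[of v] inner_span_proj_left
    by (simp add: power2_eq_square)
  moreover have "0 \<le> (norm (v - span_proj I v))\<^sup>2" by simp
  then have "0 \<le> (norm v)\<^sup>2 - 2 * (v \<bullet> span_proj I v) + (norm (span_proj I v))\<^sup>2"
    by (simp add: power2_norm_eq_inner inner_diff_left inner_diff_right inner_commute)
  ultimately have "(norm (span_proj I v))\<^sup>2 \<le> (norm v)\<^sup>2" by simp
  then show ?thesis using assms by (simp add: norm_span_proj_sq)
qed

lemma norm_span_proj_le: "finite I \<Longrightarrow> I \<subseteq> B \<Longrightarrow> norm (span_proj I v) \<le> norm v"
  by (metis Bessel_inequality norm_span_proj_sq norm_ge_zero power2_le_imp_le)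

lemma eq_if_inner_basis_eq:
  assumes "\<And>h. h \<in> B \<Longrightarrow> h \<bullet> v = h \<bullet> w"
  shows "v = w"
proof -
  have "closure (span B) \<subseteq> {u. u \<bullet> (v - w) = 0}"
  proof (rule closure_minimal)
    show "span B \<subseteq> {u. u \<bullet> (v - w) = 0}"
      by (rule span_minimal)
        (use assms in \<open>auto simp: inner_diff_right subspace_def inner_add_left\<close>)
    show "closed {u. u \<bullet> (v - w) = 0}"
      by (intro closed_Collect_eq continuous_intros)
  qed
  then have "v - w \<in> {u. u \<bullet> (v - w) = 0}"
    using orthonormal_basis by (simp add: orthonormal_basis_def subset_iff)
  then show ?thesis by simp
qed

text \<open>Riesz--Fischer: square summability makes the partial sums of \<open>\<Sum>h. a h h\<close> Cauchy, because
  the squared distance of two of them is a partial sum of \<open>\<Sum>h. (a h)\<^sup>2\<close>.\<close>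

lemma basis_expansion_summable:
  assumes sq: "(\<lambda>h. (a h)\<^sup>2) summable_on B"
  shows "(\<lambda>h. a h *\<^sub>R h) summable_on B"
proof -
  let ?f = "\<lambda>h. a h *\<^sub>R h"
  define L where "L = infsum (\<lambda>h. (a h)\<^sup>2) B"
  have "\<exists>P. eventually P (finite_subsets_at_top B) \<and>
              (\<forall>F F'. P F \<and> P F' \<longrightarrow> dist (sum ?f F) (sum ?f F') < e)" if "e > 0" for e
  proof -
    have "((\<lambda>h. (a h)\<^sup>2) has_sum L) B" using sq by (simp add: L_def)
    from has_sum_finite_approximation[OF this, of "(e/3)\<^sup>2"] \<open>e > 0\<close>
    obtain F0 where F0: "finite F0" "F0 \<subseteq> B" "dist (\<Sum>h\<in>F0. (a h)\<^sup>2) L \<le> (e/3)\<^sup>2" by auto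
    have near: "norm (sum ?f F - sum ?f F0) \<le> e/3" if "finite F" "F0 \<subseteq> F" "F \<subseteq> B" for F
    proof -
      have "(norm (sum ?f F - sum ?f F0))\<^sup>2 = (norm (sum ?f (F - F0)))\<^sup>2"
        using that F0 by (simp add: sum_diff)
      also have "\<dots> = (\<Sum>h\<in>F-F0. (a h)\<^sup>2)"
        using that by (intro norm_basis_sum_sq) auto
      also have "\<dots> = (\<Sum>h\<in>F. (a h)\<^sup>2) - (\<Sum>h\<in>F0. (a h)\<^sup>2)"
        using that F0 by (simp add: sum_diff)
      also have "(\<Sum>h\<in>F. (a h)\<^sup>2) \<le> L"
        unfolding L_def using that sq by (intro finite_sum_le_infsum) auto
      also have "L - (\<Sum>h\<in>F0. (a h)\<^sup>2) \<le> (e/3)\<^sup>2" using F0(3) by (simp add: dist_real_def)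
      finally show ?thesis using \<open>e > 0\<close> by (simp add: power2_le_iff_abs_le)
    qed
    have "eventually (\<lambda>F. finite F \<and> F0 \<subseteq> F \<and> F \<subseteq> B) (finite_subsets_at_top B)"
      using F0 unfolding eventually_finite_subsets_at_top by blast
    moreover have "\<forall>F F'. (finite F \<and> F0 \<subseteq> F \<and> F \<subseteq> B) \<and> (finite F' \<and> F0 \<subseteq> F' \<and> F' \<subseteq> B)
      \<longrightarrow> dist (sum ?f F) (sum ?f F') < e"
    proof (intro allI impI)
      fix F F' assume that: "(finite F \<and> F0 \<subseteq> F \<and> F \<subseteq> B) \<and> (finite F' \<and> F0 \<subseteq> F' \<and> F' \<subseteq> B)"
      have "dist (sum ?f F) (sum ?f F0) \<le> e/3" "dist (sum ?f F') (sum ?f F0) \<le> e/3"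
        unfolding dist_norm using that by (blast intro: near)+
      with dist_triangle2[of "sum ?f F" "sum ?f F'" "sum ?f F0"] \<open>e > 0\<close> show "dist (sum ?f F) (sum ?f F') < e" by linarith
    qed
    ultimately show ?thesis by (intro exI conjI)
  qed
  then have "cauchy_filter (filtermap (sum ?f) (finite_subsets_at_top B))"
    by (simp add: cauchy_filter_metric_filtermap)
  then obtain L' where "(sum ?f \<longlongrightarrow> L') (finite_subsets_at_top B)"
    using complete_UNIV[where 'a='h, unfolded complete_uniform] by (force simp add: filterlim_def)
  then show ?thesis using summable_on_def has_sum_def by blast
qed

lemma inner_basis_expansion:
  assumes "(\<lambda>h. (a h)\<^sup>2) summable_on B" "k \<in> B"
  shows "k \<bullet> (\<Sum>\<^sub>\<infinity>h\<in>B. a h *\<^sub>R h) = a k"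
proof -
  have "((\<lambda>h. k \<bullet> (a h *\<^sub>R h)) has_sum k \<bullet> (\<Sum>\<^sub>\<infinity>h\<in>B. a h *\<^sub>R h)) B"
    by (rule has_sum_bounded_linear[OF bounded_linear_inner_right])
      (use basis_expansion_summable[OF assms(1)] in simp)
  moreover have "((\<lambda>h. k \<bullet> (a h *\<^sub>R h)) has_sum a k) B"
    by (rule has_sum_finite_neutralI[of "{k}"]) (use assms in \<open>auto simp: inner_basis\<close>)
  ultimately show ?thesis by (rule has_sum_unique)
qed

lemma norm_basis_expansion_sq:
  assumes "(\<lambda>h. (a h)\<^sup>2) summable_on B"
  shows "((\<lambda>h. (a h)\<^sup>2) has_sum (norm (\<Sum>\<^sub>\<infinity>h\<in>B. a h *\<^sub>R h))\<^sup>2) B"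
proof -
  let ?v = "\<Sum>\<^sub>\<infinity>h\<in>B. a h *\<^sub>R h"
  have "((\<lambda>h. ?v \<bullet> (a h *\<^sub>R h)) has_sum ?v \<bullet> ?v) B"
    by (rule has_sum_bounded_linear[OF bounded_linear_inner_right])
      (use basis_expansion_summable[OF assms] in simp)
  then have "((\<lambda>h. (a h)\<^sup>2) has_sum ?v \<bullet> ?v) B"
    by (rule has_sum_cong[THEN iffD1, rotated])
      (simp add: inner_commute[of ?v] inner_basis_expansion[OF assms] power2_eq_square)
  then show ?thesis by (simp add: power2_norm_eq_inner)
qed

lemma coordinates_square_summable: "(\<lambda>h. (h \<bullet> v)\<^sup>2) summable_on B"
  by (rule nonneg_bdd_above_summable_on)
    (auto intro!: bdd_aboveI[of _ "(norm v)\<^sup>2"] Bessel_inequality)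

lemma basis_expansion: "(\<Sum>\<^sub>\<infinity>h\<in>B. (h \<bullet> v) *\<^sub>R h) = v"
  by (rule eq_if_inner_basis_eq) (simp add: inner_basis_expansion coordinates_square_summable)

lemma Parseval: "((\<lambda>h. (h \<bullet> v)\<^sup>2) has_sum (norm v)\<^sup>2) B"
  using norm_basis_expansion_sq[OF coordinates_square_summable, of v] by (simp add: basis_expansion)

lemma inner_diag_op: "v \<in> diag_domain B a \<Longrightarrow> k \<in> B \<Longrightarrow> k \<bullet> diag_op B a v = a k * (k \<bullet> v)"
  unfolding diag_op_def diag_domain_def by (subst inner_basis_expansion) auto

lemma norm_diag_op_sq:
  "v \<in> diag_domain B a \<Longrightarrow> ((\<lambda>h. (a h * (h \<bullet> v))\<^sup>2) has_sum (norm (diag_op B a v))\<^sup>2) B"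
  unfolding diag_op_def diag_domain_def by (intro norm_basis_expansion_sq) auto

lemma diag_domain_bounded:
  assumes "\<And>h. h \<in> B \<Longrightarrow> \<bar>a h\<bar> \<le> K"
  shows "v \<in> diag_domain B a" "norm (diag_op B a v) \<le> \<bar>K\<bar> * norm v"
proof -
  have *: "(a h * (h \<bullet> v))\<^sup>2 \<le> K\<^sup>2 * (h \<bullet> v)\<^sup>2" if "h \<in> B" for h
    unfolding power_mult_distrib using assms[OF that]
    by (intro mult_right_mono) (auto simp: abs_le_square_iff[symmetric])
  have sum2: "((\<lambda>h. K\<^sup>2 * (h \<bullet> v)\<^sup>2) has_sum K\<^sup>2 * (norm v)\<^sup>2) B"
    by (intro has_sum_cmult_right Parseval)
  have "(\<lambda>h. (a h * (h \<bullet> v))\<^sup>2) summable_on B"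
    by (rule summable_on_comparison_test[where f="\<lambda>h. K\<^sup>2 * (h \<bullet> v)\<^sup>2"])
      (use sum2 * in \<open>auto simp: summable_on_def\<close>)
  then show dom: "v \<in> diag_domain B a" by (simp add: diag_domain_def)
  have "(norm (diag_op B a v))\<^sup>2 \<le> K\<^sup>2 * (norm v)\<^sup>2"
    by (rule has_sum_mono[OF norm_diag_op_sq[OF dom] sum2]) (rule *)
  then show "norm (diag_op B a v) \<le> \<bar>K\<bar> * norm v"
    by (intro power2_le_imp_le[of "norm (diag_op B a v)"]) (auto simp: power_mult_distrib)
qed

lemma diag_domain_span_proj:
  assumes "finite I" "I \<subseteq> B"
  shows "span_proj I v \<in> diag_domain B a"
    "diag_op B a (span_proj I v) = (\<Sum>h\<in>I. (a h * (h \<bullet> v)) *\<^sub>R h)"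
proof -
  show dom: "span_proj I v \<in> diag_domain B a"
    unfolding diag_domain_def using assms
    by (auto intro!: finite_nonzero_values_imp_summable_on intro: finite_subset[of _ I]
        simp: inner_span_proj split: if_split_asm)
  show "diag_op B a (span_proj I v) = (\<Sum>h\<in>I. (a h * (h \<bullet> v)) *\<^sub>R h)"
    by (rule eq_if_inner_basis_eq) (use assms in \<open>simp add: inner_diag_op[OF dom] inner_basis_sum inner_span_proj\<close>)
qed

lemma diag_domain_subspace: "subspace (diag_domain B a)"
proof -
  have iff: "v \<in> diag_domain B a \<longleftrightarrow> (\<lambda>h. (a h * (h \<bullet> v))\<^sup>2) summable_on B" for v
    by (simp add: diag_domain_def)
  have "v + w \<in> diag_domain B a" if "v \<in> diag_domain B a" "w \<in> diag_domain B a" for v w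
    unfolding iff
  proof (rule summable_on_comparison_test)
    show "(\<lambda>h. 2 * (a h * (h \<bullet> v))\<^sup>2 + 2 * (a h * (h \<bullet> w))\<^sup>2) summable_on B"
      using that by (intro summable_on_add summable_on_cmult_right) (auto simp: iff)
    show "(a h * (h \<bullet> (v + w)))\<^sup>2 \<le> 2 * (a h * (h \<bullet> v))\<^sup>2 + 2 * (a h * (h \<bullet> w))\<^sup>2" for h
      using zero_le_power2[of "a h * (h \<bullet> v) - a h * (h \<bullet> w)"]
      by (simp add: inner_add_right algebra_simps power2_eq_square)
  qed auto
  moreover have "c *\<^sub>R v \<in> diag_domain B a" if "v \<in> diag_domain B a" for v c
    using summable_on_cmult_right[OF that[unfolded iff], of "c\<^sup>2"] unfolding iff
    by (simp add: power_mult_distrib mult.left_commute)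
  ultimately show ?thesis by (auto simp: subspace_def iff)
qed

lemma diag_op_linear:
  assumes "v \<in> diag_domain B a" "w \<in> diag_domain B a"
  shows "diag_op B a (v + w) = diag_op B a v + diag_op B a w"
    and "diag_op B a (c *\<^sub>R v) = c *\<^sub>R diag_op B a v"
proof -
  note dom = subspace_add[OF diag_domain_subspace assms] subspace_scale[OF diag_domain_subspace assms(1)]
  show "diag_op B a (v + w) = diag_op B a v + diag_op B a w"
    by (rule eq_if_inner_basis_eq)
      (simp add: inner_diag_op dom assms inner_add_right distrib_left)
  show "diag_op B a (c *\<^sub>R v) = c *\<^sub>R diag_op B a v"
    by (rule eq_if_inner_basis_eq) (simp add: inner_diag_op dom assms)
qed

end

section \<open>The interpolation spaces\<close>

locale negative_diagonal = hilbert_basis B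
  for B :: "'h::{real_inner, banach, second_countable_topology} set" +
  fixes \<mu> :: "'h \<Rightarrow> real" and \<delta> :: real
  assumes gap_pos: "0 < \<delta>" and gap: "\<And>h. h \<in> B \<Longrightarrow> \<delta> \<le> - \<mu> h"
begin

lemma eigenvalue_pos: "h \<in> B \<Longrightarrow> 0 < - \<mu> h"
  using gap gap_pos by (meson less_le_trans)

lemma interp_space_iff: "v \<in> interp_space B \<mu> r \<longleftrightarrow> (\<lambda>h. ((- \<mu> h) powr r * (h \<bullet> v))\<^sup>2) summable_on B"
  by (simp add: interp_space_def diag_domain_def)

lemma interp_norm_has_sum:
  "v \<in> interp_space B \<mu> r \<Longrightarrow>
    ((\<lambda>h. ((- \<mu> h) powr r * (h \<bullet> v))\<^sup>2) has_sum (interp_norm B \<mu> r v)\<^sup>2) B"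
  unfolding interp_norm_def neg_power_def interp_space_def by (rule norm_diag_op_sq)

lemma interp_norm_nonneg [simp]: "0 \<le> interp_norm B \<mu> r v"
  by (simp add: interp_norm_def)

lemma interp_space_span_proj [simp]:
  "finite I \<Longrightarrow> I \<subseteq> B \<Longrightarrow> span_proj I v \<in> interp_space B \<mu> r"
  unfolding interp_space_def by (rule diag_domain_span_proj)

lemma interp_inner_span_proj:
  assumes "finite I" "I \<subseteq> B"
  shows "interp_inner B \<mu> r (span_proj I v) (span_proj I w)
    = (\<Sum>h\<in>I. ((- \<mu> h) powr r)\<^sup>2 * ((h \<bullet> v) * (h \<bullet> w)))"
proof -
  have "interp_inner B \<mu> r (span_proj I v) (span_proj I w)
    = (\<Sum>h\<in>I. ((- \<mu> h) powr r * (h \<bullet> v)) * (h \<bullet> (\<Sum>h\<in>I. ((- \<mu> h) powr r * (h \<bullet> w)) *\<^sub>R h)))"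
    using assms by (simp add: interp_inner_def neg_power_def diag_domain_span_proj inner_sum_left)
  also have "\<dots> = (\<Sum>h\<in>I. ((- \<mu> h) powr r)\<^sup>2 * ((h \<bullet> v) * (h \<bullet> w)))"
    by (rule sum.cong) (use assms in \<open>auto simp: inner_basis_sum power2_eq_square subset_iff\<close>)
  finally show ?thesis .
qed

lemma interp_norm_span_proj:
  assumes "finite I" "I \<subseteq> B"
  shows "(interp_norm B \<mu> r (span_proj I v))\<^sup>2 = (\<Sum>h\<in>I. ((- \<mu> h) powr r * (h \<bullet> v))\<^sup>2)"
proof -
  have "(interp_norm B \<mu> r (span_proj I v))\<^sup>2 = interp_inner B \<mu> r (span_proj I v) (span_proj I v)"
    by (simp add: interp_inner_def interp_norm_def power2_norm_eq_inner)
  then show ?thesis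
    by (simp add: interp_inner_span_proj assms power2_eq_square mult_ac)
qed

text \<open>Functions of \<open>A\<close> are estimated between the interpolation spaces by comparing coordinates.\<close>

lemma interp_space_comparison:
  assumes v: "v \<in> interp_space B \<mu> s" and K: "0 \<le> K"
    and le: "\<And>h. h \<in> B \<Longrightarrow> \<bar>(- \<mu> h) powr r * (h \<bullet> w)\<bar> \<le> K * \<bar>(- \<mu> h) powr s * (h \<bullet> v)\<bar>"
  shows "w \<in> interp_space B \<mu> r" and "interp_norm B \<mu> r w \<le> K * interp_norm B \<mu> s v"
proof -
  have *: "((- \<mu> h) powr r * (h \<bullet> w))\<^sup>2 \<le> K\<^sup>2 * ((- \<mu> h) powr s * (h \<bullet> v))\<^sup>2" if "h \<in> B" for h
    using power_mono[OF le[OF that], of 2] K by (simp add: power_mult_distrib)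
  have sum2: "((\<lambda>h. K\<^sup>2 * ((- \<mu> h) powr s * (h \<bullet> v))\<^sup>2) has_sum K\<^sup>2 * (interp_norm B \<mu> s v)\<^sup>2) B"
    by (intro has_sum_cmult_right interp_norm_has_sum v)
  show w: "w \<in> interp_space B \<mu> r"
    unfolding interp_space_iff
    by (rule summable_on_comparison_test[where f="\<lambda>h. K\<^sup>2 * ((- \<mu> h) powr s * (h \<bullet> v))\<^sup>2"])
      (use sum2 * in \<open>auto simp: summable_on_def\<close>)
  have "(interp_norm B \<mu> r w)\<^sup>2 \<le> K\<^sup>2 * (interp_norm B \<mu> s v)\<^sup>2"
    by (rule has_sum_mono[OF interp_norm_has_sum[OF w] sum2]) (rule *)
  then show "interp_norm B \<mu> r w \<le> K * interp_norm B \<mu> s v"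
    using K by (intro power2_le_imp_le[of "interp_norm B \<mu> r w"]) (auto simp: power_mult_distrib)
qed

lemma interp_norm_0: "interp_space B \<mu> 0 = UNIV" "interp_norm B \<mu> 0 v = norm v"
proof -
  have *: "((- \<mu> h) powr 0 * (h \<bullet> v))\<^sup>2 = (h \<bullet> v)\<^sup>2" if "h \<in> B" for h v
    using eigenvalue_pos[OF that] by simp
  have "v \<in> interp_space B \<mu> 0" for v
    unfolding interp_space_iff
    using coordinates_square_summable[of v] by (subst summable_on_cong[OF *]) auto
  then show "interp_space B \<mu> 0 = UNIV" by auto
  then have "((\<lambda>h. (h \<bullet> v)\<^sup>2) has_sum (interp_norm B \<mu> 0 v)\<^sup>2) B"
    using interp_norm_has_sum[of v 0] has_sum_cong[of B "\<lambda>h. ((- \<mu> h) powr 0 * (h \<bullet> v))\<^sup>2", OF *] by simp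
  from has_sum_unique[OF this Parseval] show "interp_norm B \<mu> 0 v = norm v"
    by (simp add: power2_eq_iff_nonneg)
qed

lemma interp_space_mono:
  assumes "v \<in> interp_space B \<mu> s" "r \<le> s"
  shows "v \<in> interp_space B \<mu> r" "interp_norm B \<mu> r v \<le> \<delta> powr (r - s) * interp_norm B \<mu> s v"
proof -
  have *: "\<bar>(- \<mu> h) powr r * (h \<bullet> v)\<bar> \<le> \<delta> powr (r - s) * \<bar>(- \<mu> h) powr s * (h \<bullet> v)\<bar>" if "h \<in> B" for h
  proof -
    have "(- \<mu> h) powr r = (- \<mu> h) powr (r - s) * (- \<mu> h) powr s"
      by (simp add: powr_add[symmetric])
    also have "\<dots> \<le> \<delta> powr (r - s) * (- \<mu> h) powr s"
      using gap[OF that] gap_pos assms(2) by (intro mult_right_mono powr_mono2') auto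
    finally show ?thesis
      by (simp add: abs_mult mult_right_mono mult.assoc[symmetric])
  qed
  show "v \<in> interp_space B \<mu> r" "interp_norm B \<mu> r v \<le> \<delta> powr (r - s) * interp_norm B \<mu> s v"
    using interp_space_comparison[OF assms(1) _ *] by auto
qed

lemma norm_le_interp_norm:
  "v \<in> interp_space B \<mu> s \<Longrightarrow> 0 \<le> s \<Longrightarrow> norm v \<le> \<delta> powr (- s) * interp_norm B \<mu> s v"
  using interp_space_mono(2)[of v s 0] by (simp add: interp_norm_0)

lemma interp_space_subspace: "subspace (interp_space B \<mu> r)"
  unfolding interp_space_def by (rule diag_domain_subspace)

lemma norm_on_interp_space: "norm_on (interp_space B \<mu> r) (interp_norm B \<mu> r)"
  unfolding norm_on_def
proof (intro conjI ballI allI)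
  note neg_power_linear = diag_op_linear[where a="\<lambda>h. (- \<mu> h) powr r", folded neg_power_def interp_space_def]
  show "subspace (interp_space B \<mu> r)" by (rule interp_space_subspace)
  fix v assume v: "v \<in> interp_space B \<mu> r"
  show "interp_norm B \<mu> r v = 0 \<longleftrightarrow> v = 0"
  proof
    assume "interp_norm B \<mu> r v = 0"
    then have "neg_power B \<mu> r v = 0" by (simp add: interp_norm_def)
    then have "(- \<mu> h) powr r * (h \<bullet> v) = 0" if "h \<in> B" for h
      using inner_diag_op[OF v[unfolded interp_space_def] that] by (simp add: neg_power_def)
    moreover have "(- \<mu> h) powr r \<noteq> 0" if "h \<in> B" for h
      using eigenvalue_pos[OF that] by auto
    ultimately have "h \<bullet> v = h \<bullet> 0" if "h \<in> B" for h
      using that by (metis mult_eq_0_iff inner_zero_right)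
    then show "v = 0" by (rule eq_if_inner_basis_eq)
  qed (simp add: interp_norm_def neg_power_def diag_op_def)
  show "interp_norm B \<mu> r (a *\<^sub>R v) = \<bar>a\<bar> * interp_norm B \<mu> r v" for a
    using v by (simp add: interp_norm_def neg_power_linear)
  show "interp_norm B \<mu> r (v + w) \<le> interp_norm B \<mu> r v + interp_norm B \<mu> r w"
    if "w \<in> interp_space B \<mu> r" for w
    using v that by (simp add: interp_norm_def neg_power_linear norm_triangle_ineq)
qed simp

text \<open>The squared norm is the supremum of its finite partial sums, so that a uniform bound yields
  membership in \<open>H\<^sub>r\<close> as well. Estimates of integrals can thus be made on finitely many coordinates.\<close>

lemma interp_space_if_sections_bounded:
  assumes "0 \<le> K"
    and "\<And>J. finite J \<Longrightarrow> J \<subseteq> B \<Longrightarrow> (\<Sum>h\<in>J. ((- \<mu> h) powr r * (h \<bullet> v))\<^sup>2) \<le> K\<^sup>2"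
  shows "v \<in> interp_space B \<mu> r" "interp_norm B \<mu> r v \<le> K"
proof -
  show v: "v \<in> interp_space B \<mu> r"
    unfolding interp_space_iff
    by (rule nonneg_bdd_above_summable_on) (auto intro!: bdd_aboveI[of _ "K\<^sup>2"] assms)
  have "(interp_norm B \<mu> r v)\<^sup>2 \<le> K\<^sup>2"
    by (rule has_sum_le_finite_sums[OF interp_norm_has_sum[OF v]]) (rule assms)
  then show "interp_norm B \<mu> r v \<le> K" using assms(1) by (simp add: power2_le_iff_abs_le)
qed

lemma span_proj_dense:
  assumes v: "v \<in> interp_space B \<mu> r" and "0 < e"
  obtains J where "finite J" "J \<subseteq> B" "interp_norm B \<mu> r (v - span_proj J v) < e"
proof -
  let ?a = "\<lambda>h. ((- \<mu> h) powr r * (h \<bullet> v))\<^sup>2"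
  from has_sum_finite_approximation[OF interp_norm_has_sum[OF v], of "(e/2)\<^sup>2"] \<open>0 < e\<close>
  obtain J where J: "finite J" "J \<subseteq> B" "dist (sum ?a J) ((interp_norm B \<mu> r v)\<^sup>2) \<le> (e/2)\<^sup>2" by auto
  have "interp_norm B \<mu> r (v - span_proj J v) \<le> e/2"
  proof (rule interp_space_if_sections_bounded)
    fix F assume F: "finite F" "F \<subseteq> B"
    have "(\<Sum>h\<in>F. ((- \<mu> h) powr r * (h \<bullet> (v - span_proj J v)))\<^sup>2) = (\<Sum>h\<in>F. if h \<in> J then 0 else ?a h)"
      by (rule sum.cong) (use F J in \<open>auto simp: inner_diff_right inner_span_proj subset_iff\<close>)
    also have "\<dots> = (\<Sum>h\<in>F-J. ?a h)"
      using F by (simp add: sum.If_cases Diff_eq)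
    also have "\<dots> = (\<Sum>h\<in>F\<union>J. ?a h) - (\<Sum>h\<in>J. ?a h)"
      using F J by (subst sum_diff[symmetric]) (auto intro: sum.cong)
    also have "(\<Sum>h\<in>F\<union>J. ?a h) \<le> (interp_norm B \<mu> r v)\<^sup>2"
      using F J by (intro finite_sum_le_has_sum[OF interp_norm_has_sum[OF v]]) auto
    also have "(interp_norm B \<mu> r v)\<^sup>2 - (\<Sum>h\<in>J. ?a h) \<le> (e/2)\<^sup>2" using J(3) by (simp add: dist_real_def)
    finally show "(\<Sum>h\<in>F. ((- \<mu> h) powr r * (h \<bullet> (v - span_proj J v)))\<^sup>2) \<le> (e/2)\<^sup>2" by simp
  qed (use \<open>0 < e\<close> in auto)
  with \<open>0 < e\<close> have "interp_norm B \<mu> r (v - span_proj J v) < e" by simp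
  with J that show thesis by blast
qed

text \<open>The operator is diagonal, and the basis vector \<open>i\<close> is an eigenvector with value
  \<open>(- \<mu> i) powr (- r)\<close>. The bound by \<open>\<delta> powr (- r)\<close> ensures that the supremum that defines \<^const>\<open>onorm\<close>
  is one of a bounded set.\<close>

lemma onorm_complement:
  assumes I: "finite I" "I \<subseteq> B" and r: "0 \<le> r"
  shows "0 \<le> onorm (\<lambda>v. neg_power B \<mu> (- r) (v - span_proj I v))"
    and "i \<in> B \<Longrightarrow> i \<notin> I \<Longrightarrow> (- \<mu> i) powr (- r) \<le> onorm (\<lambda>v. neg_power B \<mu> (- r) (v - span_proj I v))"
proof -
  let ?f = "\<lambda>v. neg_power B \<mu> (- r) (v - span_proj I v)"
  have le: "\<bar>(- \<mu> h) powr (- r)\<bar> \<le> \<delta> powr (- r)" if "h \<in> B" for h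
    using gap[OF that] gap_pos r by (simp add: powr_mono2')
  have "norm (?f v) / norm v \<le> \<delta> powr (- r) * 2" for v
  proof -
    have "norm (?f v) \<le> \<bar>\<delta> powr (- r)\<bar> * norm (v - span_proj I v)"
      unfolding neg_power_def by (rule diag_domain_bounded(2)[OF le])
    also have "\<dots> \<le> \<bar>\<delta> powr (- r)\<bar> * (2 * norm v)"
      using norm_triangle_ineq4[of v "span_proj I v"] norm_span_proj_le[OF I, of v] by (intro mult_left_mono) auto
    finally show ?thesis by (cases "v = 0") (simp_all add: field_simps)
  qed
  then have bdd: "bdd_above (range (\<lambda>v. norm (?f v) / norm v))" by (intro bdd_aboveI) auto
  show "0 \<le> onorm ?f"
    unfolding onorm_def using cSUP_upper[OF UNIV_I[of 0] bdd] by simp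
  assume i: "i \<in> B" "i \<notin> I"
  have "span_proj I i = 0"
    unfolding span_proj_def by (rule sum.neutral) (use I i inner_basis in auto)
  moreover have "span_proj {i} i = i" using inner_basis[OF i(1) i(1)] by (simp add: span_proj_def)
  ultimately have "?f i = (- \<mu> i) powr (- r) *\<^sub>R i"
    using diag_domain_span_proj(2)[of "{i}" "\<lambda>h. (- \<mu> h) powr (- r)" i] i(1) inner_basis[OF i(1) i(1)]
    by (simp add: neg_power_def)
  moreover have "norm i = 1" using inner_basis[OF i(1) i(1)] by (simp add: norm_eq_sqrt_inner)
  ultimately have "(- \<mu> i) powr (- r) = norm (?f i) / norm i" by simp
  also have "\<dots> \<le> onorm ?f" unfolding onorm_def by (rule cSUP_upper[OF UNIV_I bdd])
  finally show "(- \<mu> i) powr (- r) \<le> onorm ?f" .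
qed

end

section \<open>Subspaces with a norm of their own\<close>

lemma norm_on_UNIV_norm: "norm_on UNIV (norm :: 'a::real_normed_vector \<Rightarrow> real)"
  by (auto simp: norm_on_def norm_triangle_ineq)

lemma
  assumes "norm_on V N"
  shows mspace_norm_metric: "mspace (norm_metric V N) = V"
    and mdist_norm_metric: "v \<in> V \<Longrightarrow> w \<in> V \<Longrightarrow> mdist (norm_metric V N) v w = N (v - w)"
  using Metric_space.mspace_metric[OF Metric_space_norm_on[OF assms]]
    Metric_space.mdist_metric[OF Metric_space_norm_on[OF assms]]
  by (simp_all add: norm_metric_def)

lemma norm_on_subspace: "norm_on V N \<Longrightarrow> subspace V"
  and norm_on_nonneg: "norm_on V N \<Longrightarrow> v \<in> V \<Longrightarrow> 0 \<le> N v"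
  and norm_on_scale: "norm_on V N \<Longrightarrow> v \<in> V \<Longrightarrow> N (a *\<^sub>R v) = \<bar>a\<bar> * N v"
  and norm_on_triangle: "norm_on V N \<Longrightarrow> v \<in> V \<Longrightarrow> w \<in> V \<Longrightarrow> N (v + w) \<le> N v + N w"
  by (auto simp: norm_on_def)

lemma norm_on_minus_commute:
  assumes "norm_on V N" "v \<in> V" "w \<in> V"
  shows "N (v - w) = N (w - v)"
  using norm_on_scale[OF assms(1) subspace_diff[OF norm_on_subspace[OF assms(1)] assms(2,3)], of "-1"]
  by simp

lemma norm_on_triangle_diff:
  assumes "norm_on V N" "v \<in> V" "w \<in> V"
  shows "N v \<le> N w + N (v - w)"
  using norm_on_triangle[OF assms(1,3) subspace_diff[OF norm_on_subspace[OF assms(1)] assms(2,3)]]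
  by simp

lemma continuous_map_norm_metric_iff:
  assumes "norm_on V N" "norm_on W N'"
  shows "continuous_map (mtopology_of (norm_metric V N)) (mtopology_of (norm_metric W N')) f \<longleftrightarrow>
    f ` V \<subseteq> W \<and> (\<forall>v\<in>V. \<forall>e>0. \<exists>d>0. \<forall>w\<in>V. N (v - w) < d \<longrightarrow> N' (f v - f w) < e)"
  unfolding mtopology_of_def
  by (subst Metric_space.metric_continuous_map[OF Metric_space_mspace_mdist Metric_space_mspace_mdist])
    (auto simp: mspace_norm_metric[OF assms(1)] mspace_norm_metric[OF assms(2)] image_subset_iff
      mdist_norm_metric[OF assms(2)], (metis mdist_norm_metric[OF assms(1)])+)

lemma mtopology_of_norm: "mtopology_of (norm_metric UNIV (norm :: 'a::real_normed_vector \<Rightarrow> real)) = euclidean"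
proof -
  have "norm_metric UNIV (norm :: 'a \<Rightarrow> real) = euclidean_metric"
    by (simp add: norm_metric_def euclidean_metric_def dist_norm[abs_def])
  then show ?thesis by simp
qed

lemma continuous_map_norm_metric_euclidean_iff:
  fixes f :: "'a::real_vector \<Rightarrow> 'b::real_normed_vector"
  assumes "norm_on V N"
  shows "continuous_map (mtopology_of (norm_metric V N)) euclidean f \<longleftrightarrow>
    (\<forall>v\<in>V. \<forall>e>0. \<exists>d>0. \<forall>w\<in>V. N (v - w) < d \<longrightarrow> norm (f v - f w) < e)"
  using continuous_map_norm_metric_iff[OF assms norm_on_UNIV_norm, of f]
  by (simp add: mtopology_of_norm)

text \<open>Continuity of the linear inclusion at \<open>0\<close> gives the norm bound by rescaling.\<close>

lemma dense_continuous_embedding_norm_metricD: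
  assumes V: "norm_on V N" and W: "norm_on W N'"
    and emb: "dense_continuous_embedding (norm_metric V N) (norm_metric W N')"
  shows "V \<subseteq> W" and "\<exists>C>0. \<forall>v\<in>V. N' v \<le> C * N v"
    and "\<And>w e. w \<in> W \<Longrightarrow> 0 < e \<Longrightarrow> \<exists>v\<in>V. N' (w - v) < e"
proof -
  show sub: "V \<subseteq> W"
    using emb by (simp add: dense_continuous_embedding_def mspace_norm_metric[OF V] mspace_norm_metric[OF W])
  have "0 \<in> V" using norm_on_subspace[OF V] by (rule subspace_0)
  have "N 0 = 0" using norm_on_scale[OF V \<open>0 \<in> V\<close>, of 0] by simp
  have "continuous_map (mtopology_of (norm_metric V N)) (mtopology_of (norm_metric W N')) (\<lambda>v. v)"
    using emb by (simp add: dense_continuous_embedding_def)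
  from this[unfolded continuous_map_norm_metric_iff[OF V W]] \<open>0 \<in> V\<close>
  obtain d where d: "d > 0" "\<And>w. w \<in> V \<Longrightarrow> N (0 - w) < d \<Longrightarrow> N' (0 - w) < 1"
    by (meson zero_less_one)
  have bound: "N' v \<le> 2 / d * N v" if v: "v \<in> V" for v
  proof (cases "N v = 0")
    case True
    then have "v = 0" using V v by (auto simp: norm_on_def)
    moreover have "N' 0 = 0" using norm_on_scale[OF W, of 0 0] \<open>0 \<in> V\<close> sub by auto
    ultimately show ?thesis using \<open>N 0 = 0\<close> by simp
  next
    case False
    then have pos: "N v > 0" using norm_on_nonneg[OF V v] by simp
    define a where "a = d / (2 * N v)"
    have a: "a > 0" using pos d by (simp add: a_def)
    have av: "- (a *\<^sub>R v) \<in> V"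
      using norm_on_subspace[OF V] v by (simp add: subspace_neg subspace_scale)
    have "N (a *\<^sub>R v) = d / 2" using norm_on_scale[OF V v, of a] a pos d(1) by (simp add: a_def)
    then have "N (0 - - (a *\<^sub>R v)) < d" using d by simp
    from d(2)[OF av this] have "N' (a *\<^sub>R v) < 1" by simp
    then have "a * N' v < 1" using norm_on_scale[OF W, of v a] v sub a by auto
    then show ?thesis using a pos d(1) by (simp add: a_def field_simps)
  qed
  then show "\<exists>C>0. \<forall>v\<in>V. N' v \<le> C * N v"
    using d(1) by (intro exI[of _ "2 / d"]) auto
  fix w and e :: real assume w: "w \<in> W" "0 < e"
  interpret MW: Metric_space W "mdist (norm_metric W N')"
    using Metric_space_mspace_mdist[of "norm_metric W N'"] by (simp add: mspace_norm_metric[OF W])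
  have "mtopology_of (norm_metric W N') closure_of V = W"
    using emb by (simp add: dense_continuous_embedding_def mspace_norm_metric[OF V] mspace_norm_metric[OF W])
  then have "w \<in> MW.mtopology closure_of V"
    using w(1) by (simp add: mtopology_of_def mspace_norm_metric[OF W])
  then obtain v where "v \<in> V" "v \<in> MW.mball w e"
    using w(2) unfolding MW.metric_closure_of by blast
  then show "\<exists>v\<in>V. N' (w - v) < e"
    using w(1) sub by (auto simp: mdist_norm_metric[OF W])
qed

lemma borel_measurable_metric_borel:
  fixes f :: "'a \<Rightarrow> 'b::topological_space"
  assumes "X \<in> M \<rightarrow>\<^sub>M metric_borel m" and f: "continuous_map (mtopology_of m) euclidean f"
  shows "(\<lambda>\<omega>. f (X \<omega>)) \<in> borel_measurable M"
proof (rule measurable_compose[OF assms(1)])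
  have "{U. openin (mtopology_of m) U} \<subseteq> Pow (mspace m)"
    using openin_subset by fastforce
  then have sets: "sets (metric_borel m) = sigma_sets (mspace m) {U. openin (mtopology_of m) U}"
    and sp: "space (metric_borel m) = mspace m"
    unfolding metric_borel_def by (simp_all add: sets_measure_of space_measure_of)
  show "f \<in> borel_measurable (metric_borel m)"
  proof (rule borel_measurableI)
    fix S :: "'b set" assume "open S"
    then have "openin (mtopology_of m) {v \<in> topspace (mtopology_of m). f v \<in> S}"
      by (intro openin_continuous_map_preimage[OF f]) auto
    moreover have "{v \<in> topspace (mtopology_of m). f v \<in> S} = f -` S \<inter> space (metric_borel m)"
      by (auto simp: sp)
    ultimately show "f -` S \<inter> space (metric_borel m) \<in> sets (metric_borel m)"
      unfolding sets by (simp add: sigma_sets.Basic)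
  qed
qed

lemma process_mspace:
  assumes "process P T m X" "t \<in> {0..T}" "\<omega> \<in> space P"
  shows "X t \<omega> \<in> mspace m"
proof -
  have "{U. openin (mtopology_of m) U} \<subseteq> Pow (mspace m)"
    using openin_subset by fastforce
  then have "space (metric_borel m) = mspace m"
    unfolding metric_borel_def by (simp add: space_measure_of)
  then show ?thesis
    using measurable_space[of "X t" P "metric_borel m" \<omega>] assms by (simp add: process_def)
qed

section \<open>Scalar estimates\<close>

text \<open>For an eigenvalue \<open>l\<close> of \<open>-A\<close> this is the smoothing of the semigroup,
  \<open>\<parallel>(-A)\<^sup>a exp (r A)\<parallel> \<le> r\<^bsup>-a\<^esup>\<close>, and the next lemma its counterpart \<open>\<parallel>(-A)\<^bsup>-a\<^esup> (1 - exp (r A))\<parallel> \<le> r\<^sup>a\<close>.\<close>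

lemma powr_mult_exp_le:
  fixes a l r :: real
  assumes "0 \<le> a" "a \<le> 1" "0 < l" "0 < r"
  shows "l powr a * exp (- (l * r)) \<le> r powr (- a)"
proof -
  have "(l * r) powr a \<le> exp (l * r)"
  proof (cases "l * r \<le> 1")
    case True
    then have "(l * r) powr a \<le> 1" using assms by (intro powr_le1) auto
    also have "1 \<le> exp (l * r)" using assms by simp
    finally show ?thesis .
  next
    case False
    then have "(l * r) powr a \<le> (l * r) powr 1" using assms by (intro powr_mono) auto
    also have "\<dots> \<le> exp (l * r)" using assms exp_ge_add_one_self[of "l * r"] by (simp add: order_trans[OF _ exp_ge_add_one_self])
    finally show ?thesis .
  qed
  then show ?thesis using assms by (simp add: powr_mult powr_minus exp_minus field_simps)
qed

lemma one_minus_exp_le_powr: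
  fixes a x :: real
  assumes "0 \<le> a" "a \<le> 1" "0 \<le> x"
  shows "1 - exp (- x) \<le> x powr a"
proof (cases "x = 0")
  case False
  then have x: "0 < x" using assms by simp
  show ?thesis
  proof (cases "x \<le> 1")
    case True
    have "1 - exp (- x) \<le> x powr 1" using exp_ge_add_one_self[of "- x"] x by simp
    also have "\<dots> \<le> x powr a" using True assms x by (intro powr_mono') auto
    finally show ?thesis .
  next
    case False
    then have "1 \<le> x powr a" using assms by (intro ge_one_powr_ge_zero) auto
    then show ?thesis using exp_gt_zero[of "- x"] by linarith
  qed
qed simp

lemma powr_add_le:
  fixes a b q :: real
  assumes "0 \<le> a" "0 \<le> b" "0 \<le> q"
  shows "(a + b) powr q \<le> 2 powr q * (a powr q + b powr q)"
proof -
  have "(a + b) powr q \<le> (2 * max a b) powr q" using assms by (intro powr_mono2) auto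
  also have "\<dots> = 2 powr q * max a b powr q" using assms by (simp add: powr_mult)
  also have "max a b powr q \<le> a powr q + b powr q" by (simp add: max_def)
  finally show ?thesis by (simp add: mult_left_mono)
qed

section \<open>Grids\<close>

lemma grid_floor_bounds:
  assumes "0 < h"
  shows "grid_floor h s \<le> s" "s < grid_floor h s + h" "0 \<le> s \<Longrightarrow> 0 \<le> grid_floor h s"
proof -
  show "grid_floor h s \<le> s"
    unfolding grid_floor_eq[OF assms] using assms by (metis floor_divide_lower)
  show "s < grid_floor h s + h"
    unfolding grid_floor_eq[OF assms] using assms floor_divide_upper[of h s] by (simp add: distrib_right)
  show "0 \<le> grid_floor h s" if "0 \<le> s"
    unfolding grid_floor_eq[OF assms] using assms that by simp
qed

lemma grid_floor_idem:
  assumes "0 < h" shows "grid_floor h (grid_floor h s) = grid_floor h s"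
  using assms by (simp add: grid_floor_eq)

lemma finite_grid:
  assumes "0 < h" shows "finite (grid_floor h ` {0..t})"
proof -
  have "grid_floor h ` {0..t} \<subseteq> (\<lambda>k. of_int k * h) ` {0..\<lfloor>t / h\<rfloor>}"
    using assms by (auto simp: grid_floor_eq intro!: imageI floor_mono divide_right_mono)
  then show ?thesis by (rule finite_subset) simp
qed

lemma grid_floor_locally_constant:
  assumes h: "0 < h" and "grid_floor h s \<noteq> s"
  shows "eventually (\<lambda>u. grid_floor h u = grid_floor h s) (nhds s)"
proof -
  have "grid_floor h u = grid_floor h s" if "u \<in> {grid_floor h s <..< grid_floor h s + h}" for u
  proof -
    have "\<lfloor>u / h\<rfloor> = \<lfloor>s / h\<rfloor>"
      using that h unfolding grid_floor_eq[OF h]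
      by (intro floor_unique) (auto simp: field_simps)
    then show ?thesis by (simp add: grid_floor_eq[OF h])
  qed
  moreover have "s \<in> {grid_floor h s <..< grid_floor h s + h}"
    using grid_floor_bounds[OF h, of s] assms by auto
  ultimately show ?thesis
    by (intro eventually_nhds[THEN iffD2]) (meson open_greaterThanLessThan)
qed

lemma measurable_grid_floor_compose:
  fixes G :: "real \<Rightarrow> 'w \<Rightarrow> 'a::topological_space"
  assumes h: "0 < h" and "\<And>s. (\<lambda>\<omega>. G (grid_floor h s) \<omega>) \<in> borel_measurable N"
  shows "(\<lambda>(s, \<omega>). G (grid_floor h s) \<omega>) \<in> borel_measurable (lborel \<Otimes>\<^sub>M N)"
proof -
  have "(\<lambda>z. G (of_int \<lfloor>fst z / h\<rfloor> * h) (snd z)) \<in> borel_measurable (lborel \<Otimes>\<^sub>M N)"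
  proof (rule measurable_compose_countable[where g="\<lambda>z. \<lfloor>fst z / h\<rfloor>"])
    fix k :: int
    have "(\<lambda>\<omega>. G (of_int k * h) \<omega>) \<in> borel_measurable N"
      using assms(2)[of "of_int k * h"] h by (simp add: grid_floor_eq)
    then show "(\<lambda>z. G (of_int k * h) (snd z)) \<in> borel_measurable (lborel \<Otimes>\<^sub>M N)"
      by (rule measurable_compose[OF measurable_snd])
  qed measurable
  then show ?thesis by (simp add: grid_floor_eq[OF h] split_beta')
qed

lemma measurable_step_function:
  fixes G :: "real \<Rightarrow> 'a::topological_space"
  assumes h: "0 < h"
  shows "(\<lambda>s. G (grid_floor h s)) \<in> borel_measurable lborel"
proof -
  have "(\<lambda>s. \<lfloor>s / h\<rfloor>) \<in> lborel \<rightarrow>\<^sub>M count_space UNIV" by measurable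
  then have "(\<lambda>s. G (of_int \<lfloor>s / h\<rfloor> * h)) \<in> borel_measurable lborel"
    by (rule measurable_compose[where g="\<lambda>k. G (of_int k * h)"]) simp
  then show ?thesis by (simp add: grid_floor_eq[OF h])
qed

lemma step_function_set_integrable:
  fixes G :: "real \<Rightarrow> real"
  assumes h: "0 < h"
  shows "set_integrable lborel {0..T} (\<lambda>s. G (grid_floor h s))"
proof -
  have "finite ((\<lambda>s. G (grid_floor h s)) ` {0..T})"
    using finite_imageI[OF finite_grid[OF h], of G T] by (simp add: image_image)
  then have "bounded ((\<lambda>s. G (grid_floor h s)) ` {0..T})" by (rule finite_imp_bounded)
  then obtain K where "\<forall>x\<in>(\<lambda>s. G (grid_floor h s)) ` {0..T}. norm x \<le> K"
    unfolding bounded_iff by (elim exE)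
  then have K: "\<And>s. s \<in> {0..T} \<Longrightarrow> norm (G (grid_floor h s)) \<le> K" by simp
  have "(\<lambda>s. G (grid_floor h s)) \<in> borel_measurable lborel" by (rule measurable_step_function[OF h])
  moreover have "emeasure lborel {0..T} < \<infinity>" by (cases "0 \<le> T") simp_all
  ultimately show ?thesis
    unfolding set_integrable_def
    by (intro integrableI_bounded_set_indicator[where B=K]) (use K in auto)
qed

lemma isCont_step_function:
  assumes "0 < h" "grid_floor h s \<noteq> s"
  shows "isCont (\<lambda>u. G (grid_floor h u)) s"
proof -
  have "eventually (\<lambda>u. G (grid_floor h u) = G (grid_floor h s)) (nhds s)"
    using grid_floor_locally_constant[OF assms] by eventually_elim simp
  from isCont_cong[OF this] show ?thesis by simp
qed

text \<open>The step interpolations on ever finer grids are jointly measurable, and they converge by the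
  continuity of the paths. The map \<open>r\<close>, for instance the projection onto an interval, extends a
  process with time set \<open>A\<close> to all real times.\<close>

lemma measurable_continuous_process:
  fixes f :: "real \<Rightarrow> 'w \<Rightarrow> 'a::metric_space" and r :: "real \<Rightarrow> real"
  assumes r: "continuous_on UNIV r" "range r \<subseteq> A" and meas: "\<And>s. s \<in> A \<Longrightarrow> f s \<in> borel_measurable N"
    and cont: "\<And>\<omega>. \<omega> \<in> space N \<Longrightarrow> continuous_on A (\<lambda>s. f s \<omega>)"
  shows "(\<lambda>(s, \<omega>). f (r s) \<omega>) \<in> borel_measurable (lborel \<Otimes>\<^sub>M N)"
proof (rule borel_measurable_LIMSEQ_metric)
  have rA: "r s \<in> A" for s using r(2) by auto
  show "(\<lambda>(s, \<omega>). f (r (grid_floor (1 / real (Suc n)) s)) \<omega>) \<in> borel_measurable (lborel \<Otimes>\<^sub>M N)" for n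
    by (rule measurable_grid_floor_compose[where G="\<lambda>u. f (r u)"]) (use meas rA in auto)
  fix z :: "real \<times> 'w" assume "z \<in> space (lborel \<Otimes>\<^sub>M N)"
  then obtain s :: real and \<omega> :: 'w where z: "z = (s, \<omega>)" "\<omega> \<in> space N" by (auto simp: space_pair_measure)
  have "(\<lambda>n. grid_floor (1 / real (Suc n)) s) \<longlonglongrightarrow> s"
  proof (rule tendsto_sandwich[where f="\<lambda>n. s - 1 / real (Suc n)" and h="\<lambda>n. s"])
    show "(\<lambda>n. s - 1 / real (Suc n)) \<longlonglongrightarrow> s"
      using tendsto_diff[OF tendsto_const LIMSEQ_inverse_real_of_nat, of s] by (simp add: inverse_eq_divide)
  qed (use grid_floor_bounds in \<open>auto intro!: always_eventually less_imp_le simp: algebra_simps\<close>)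
  then have "(\<lambda>n. r (grid_floor (1 / real (Suc n)) s)) \<longlonglongrightarrow> r s"
    by (rule continuous_on_tendsto_compose[OF r(1)]) auto
  then have "(\<lambda>n. f (r (grid_floor (1 / real (Suc n)) s)) \<omega>) \<longlonglongrightarrow> f (r s) \<omega>"
    by (rule continuous_on_tendsto_compose[OF cont[OF z(2)]]) (use rA in auto)
  then show "(\<lambda>n. case z of (s, \<omega>) \<Rightarrow> f (r (grid_floor (1 / real (Suc n)) s)) \<omega>) \<longlonglongrightarrow> (case z of (s, \<omega>) \<Rightarrow> f (r s) \<omega>)"
    by (simp add: z)
qed

section \<open>Duhamel integrals and a comparison principle\<close>

text \<open>The solution of \<open>u' = - l u + f\<close> with \<open>u 0 = 0\<close>: one coordinate of a mild solution.\<close>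

definition duhamel :: "real \<Rightarrow> (real \<Rightarrow> real) \<Rightarrow> real \<Rightarrow> real" where
  "duhamel l f t = (LINT s:{0..t}|lborel. exp (- (l * (t - s))) * f s)"

lemma duhamel_0 [simp]: "duhamel l f 0 = 0"
proof -
  have "duhamel l f 0 = (LINT s:{0}|lborel. exp (- (l * (0 - s))) * f s)" by (simp add: duhamel_def)
  also have "\<dots> = 0"
    unfolding set_lebesgue_integral_def
    by (rule integral_eq_zero_AE) (use AE_lborel_singleton[of 0] in eventually_elim, simp)
  finally show ?thesis .
qed

lemma set_integrable_exp_mult:
  fixes f :: "real \<Rightarrow> real"
  assumes f: "set_integrable lborel {a..b} f"
  shows "set_integrable lborel {a..b} (\<lambda>s. exp (l * s + m) * f s)"
proof -
  have "set_integrable lborel {a..b} (\<lambda>s. exp (\<bar>l\<bar> * max \<bar>a\<bar> \<bar>b\<bar> + m) * f s)"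
    using f by simp
  then show ?thesis
  proof (rule set_integrable_bound)
    show "set_borel_measurable lborel {a..b} (\<lambda>s. exp (l * s + m) * f s)"
    proof -
      have "(\<lambda>s. exp (l * s + m) * (indicator {a..b} s *\<^sub>R f s)) \<in> borel_measurable lborel"
        using f unfolding set_integrable_def by (intro borel_measurable_times) auto
      then show ?thesis unfolding set_borel_measurable_def by (simp add: mult.left_commute)
    qed
    have "l * s \<le> \<bar>l\<bar> * max \<bar>a\<bar> \<bar>b\<bar>" if "s \<in> {a..b}" for s
    proof -
      have "l * s \<le> \<bar>l\<bar> * \<bar>s\<bar>" by (metis abs_ge_self abs_mult)
      also have "\<dots> \<le> \<bar>l\<bar> * max \<bar>a\<bar> \<bar>b\<bar>" using that by (intro mult_left_mono) auto
      finally show ?thesis .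
    qed
    then show "AE s in lborel. s \<in> {a..b} \<longrightarrow>
        norm (exp (l * s + m) * f s) \<le> norm (exp (\<bar>l\<bar> * max \<bar>a\<bar> \<bar>b\<bar> + m) * f s)"
      by (intro always_eventually) (auto simp: abs_mult intro!: mult_right_mono)
  qed
qed

lemma interval_integral_exp:
  fixes l :: real
  assumes "0 < l" "a \<le> b"
  shows "(LINT s:{a..b}|lborel. exp (- (l * (b - s))) * w) = (1 - exp (- (l * (b - a)))) / l * w"
proof -
  have "((\<lambda>s. exp (- (l * (b - s))) * w) has_integral
      (exp (- (l * (b - b))) / l * w - exp (- (l * (b - a))) / l * w)) {a..b}"
    using assms by (intro fundamental_theorem_of_calculus)
      (auto intro!: derivative_eq_intros simp: has_real_derivative_iff_has_vector_derivative[symmetric])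
  moreover have "set_integrable lborel {a..b} (\<lambda>s. exp (- (l * (b - s))) * w)"
    unfolding set_integrable_def
    by (rule borel_integrable_atLeastAtMost'[unfolded set_integrable_def]) (intro continuous_intros)
  ultimately have "(LINT s:{a..b}|lborel. exp (- (l * (b - s))) * w)
      = exp (- (l * (b - b))) / l * w - exp (- (l * (b - a))) / l * w"
    by (simp only: set_borel_integral_eq_integral(2) integral_unique)
  then show ?thesis by (simp add: diff_divide_distrib left_diff_distrib)
qed

context
  fixes f :: "real \<Rightarrow> real" and T :: real
  assumes f: "set_integrable lborel {0..T} f"
begin

lemma set_integrable_duhamel:
  assumes "0 \<le> a" "b \<le> T"
  shows "set_integrable lborel {a..b} (\<lambda>s. exp (- (l * (t - s))) * f s)"
proof -
  have "set_integrable lborel {a..b} (\<lambda>s. exp (l * s + (- (l * t))) * f s)"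
    by (intro set_integrable_exp_mult set_integrable_subset[OF f]) (use assms in auto)
  then show ?thesis by (simp add: algebra_simps)
qed

lemma duhamel_split:
  assumes "0 \<le> t0" "t0 \<le> t" "t \<le> T"
  shows "duhamel l f t = exp (- (l * (t - t0))) * duhamel l f t0
    + (LINT s:{t0..t}|lborel. exp (- (l * (t - s))) * f s)"
proof -
  have "duhamel l f t = (LINT s:{0..t0}\<union>{t0..t}|lborel. exp (- (l * (t - s))) * f s)"
    using assms by (simp add: duhamel_def ivl_disj_un_two_touch)
  also have "\<dots> = (LINT s:{0..t0}|lborel. exp (- (l * (t - s))) * f s)
      + (LINT s:{t0..t}|lborel. exp (- (l * (t - s))) * f s)"
  proof (rule set_integral_Un_AE)
    show "AE s in lborel. \<not> (s \<in> {0..t0} \<and> s \<in> {t0..t})"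
      using AE_lborel_singleton[of t0] by eventually_elim auto
  qed (use assms in \<open>auto intro!: set_integrable_duhamel\<close>)
  also have "(LINT s:{0..t0}|lborel. exp (- (l * (t - s))) * f s)
      = (LINT s:{0..t0}|lborel. exp (- (l * (t - t0))) * (exp (- (l * (t0 - s))) * f s))"
    unfolding mult.assoc[symmetric] exp_add[symmetric] by (simp add: right_diff_distrib)
  also have "\<dots> = exp (- (l * (t - t0))) * duhamel l f t0"
    by (simp add: duhamel_def)
  finally show ?thesis .
qed

lemma duhamel_eq_integral:
  assumes "0 \<le> t" "t \<le> T"
  shows "(\<lambda>s. exp (l * s) * f s) integrable_on {0..T}"
    and "duhamel l f t = exp (- (l * t)) * integral {0..t} (\<lambda>s. exp (l * s) * f s)"
proof -
  have si: "set_integrable lborel {0..u} (\<lambda>s. exp (l * s) * f s)" if "u \<le> T" for u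
    using set_integrable_exp_mult[of 0 u f l 0] set_integrable_subset[OF f, of "{0..u}"] that by auto
  show "(\<lambda>s. exp (l * s) * f s) integrable_on {0..T}"
    using set_borel_integral_eq_integral(1)[OF si[of T]] by simp
  have "duhamel l f t = (LINT s:{0..t}|lborel. exp (- (l * t)) * (exp (l * s) * f s))"
    unfolding duhamel_def mult.assoc[symmetric] exp_add[symmetric] by (simp add: right_diff_distrib)
  also have "\<dots> = exp (- (l * t)) * integral {0..t} (\<lambda>s. exp (l * s) * f s)"
    using set_borel_integral_eq_integral(2)[OF si[OF assms(2)]] by simp
  finally show "duhamel l f t = exp (- (l * t)) * integral {0..t} (\<lambda>s. exp (l * s) * f s)" .
qed

lemma continuous_on_duhamel: "continuous_on {0..T} (duhamel l f)"
proof (cases "0 \<le> T")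
  case True
  have "continuous_on {0..T} (\<lambda>t. exp (- (l * t)) * integral {0..t} (\<lambda>s. exp (l * s) * f s))"
    using indefinite_integral_continuous_1[OF duhamel_eq_integral(1)[of 0 l]] True
    by (intro continuous_intros) auto
  then show ?thesis
    by (rule continuous_on_cong[THEN iffD1, rotated 2]) (simp_all add: duhamel_eq_integral)
qed simp

lemma duhamel_has_derivative:
  assumes t: "t \<in> {0<..<T}" and cont: "isCont f t"
  shows "(duhamel l f has_real_derivative (- l * duhamel l f t + f t)) (at t)"
proof -
  let ?g = "\<lambda>s. exp (l * s) * f s"
  have "((\<lambda>u. integral {0..u} ?g) has_vector_derivative ?g t) (at t within ({0..T} - {}))"
  proof (rule integral_has_vector_derivative_continuous_at)
    show "?g integrable_on {0..T}" using duhamel_eq_integral(1)[of 0 l] t by auto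
    show "continuous (at t within {0..T} - {}) ?g"
      by (rule continuous_at_imp_continuous_at_within) (intro continuous_intros cont)
  qed (use t in auto)
  then have "((\<lambda>u. integral {0..u} ?g) has_real_derivative ?g t) (at t)"
    using t at_within_Icc_at[of 0 t T] by (simp add: has_real_derivative_iff_has_vector_derivative)
  then have "((\<lambda>u. exp (- (l * u)) * integral {0..u} ?g) has_real_derivative
      (- l * (exp (- (l * t)) * integral {0..t} ?g) + f t)) (at t)"
    by (rule DERIV_cong[OF DERIV_mult', rotated])
      (auto intro!: derivative_eq_intros simp: exp_minus field_simps)
  then show ?thesis
    using t duhamel_eq_integral(2)[of t l]
    by (auto elim!: has_field_derivative_transform_within_open[where S="{0<..<T}"]
        simp: duhamel_eq_integral(2))
qed

end

text \<open>Gronwall's lemma for a function that is differentiable off a finite set: \<open>exp (- K t) * W t\<close>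
  grows at most as fast as the integral of \<open>b\<close>. The exceptional points are the grid points, where the
  force of the scheme jumps.\<close>

lemma differential_inequality:
  fixes W b :: "real \<Rightarrow> real"
  assumes cont: "continuous_on {0..T} W" and S: "finite S" and K: "0 \<le> K"
    and deriv: "\<And>t. t \<in> {0<..<T} - S \<Longrightarrow> (W has_real_derivative W' t) (at t)"
    and le: "\<And>t. t \<in> {0<..<T} - S \<Longrightarrow> W' t \<le> K * W t + b t"
    and b: "\<And>t. t \<in> {0..T} \<Longrightarrow> 0 \<le> b t" "set_integrable lborel {0..T} b"
    and t: "t \<in> {0..T}"
  shows "W t \<le> exp (K * T) * (\<bar>W 0\<bar> + (LINT s:{0..T}|lborel. b s))"
proof -
  let ?E = "\<lambda>s. exp (- K * s) * W s" and ?E' = "\<lambda>s. exp (- K * s) * (W' s - K * W s)"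
  have *: "(?E' has_integral (?E t - ?E 0)) {0..t}"
  proof (rule fundamental_theorem_of_calculus_interior_strong[OF S])
    fix s assume "s \<in> {0<..<t} - S"
    then have "(W has_real_derivative W' s) (at s)" using t by (intro deriv) auto
    then have "(?E has_real_derivative ?E' s) (at s)"
      by (auto intro!: derivative_eq_intros simp: algebra_simps)
    then show "(?E has_vector_derivative ?E' s) (at s)"
      by (simp add: has_real_derivative_iff_has_vector_derivative)
  qed (use t in \<open>auto intro!: continuous_intros continuous_on_subset[OF cont]\<close>)
  have bt: "set_integrable lborel {0..t} b" by (rule set_integrable_subset[OF b(2)]) (use t in auto)
  have b_int: "b integrable_on {0..t}" "(LINT s:{0..t}|lborel. b s) = integral {0..t} b"
    using set_borel_integral_eq_integral[OF bt] by auto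
  let ?E'' = "\<lambda>s. if s \<in> S \<union> {0,t} then 0 else ?E' s"
  have "(?E'' has_integral (?E t - ?E 0)) {0..t}"
    by (rule has_integral_spike_finite[of "S \<union> {0,t}", OF _ _ *]) (use S in auto)
  then have "?E t - ?E 0 \<le> integral {0..t} b"
  proof (rule has_integral_le[OF _ integrable_integral[OF b_int(1)]])
    fix s assume s: "s \<in> {0..t}"
    show "?E'' s \<le> b s"
    proof (cases "s \<in> S \<union> {0,t}")
      case False
      then have "s \<in> {0<..<T} - S" using s t by auto
      then have "W' s - K * W s \<le> b s" using le by force
      moreover have "0 \<le> b s" using b(1) s t by auto
      ultimately have "exp (- K * s) * (W' s - K * W s) \<le> exp (- K * s) * b s"
        by (intro mult_left_mono) auto
      also have "\<dots> \<le> 1 * b s" using \<open>0 \<le> b s\<close> K s by (intro mult_right_mono) auto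
      finally show ?thesis using False by simp
    qed (use b s t in auto)
  qed
  also have "integral {0..t} b \<le> (LINT s:{0..T}|lborel. b s)"
    unfolding b_int(2)[symmetric]
    unfolding set_lebesgue_integral_def
    by (rule integral_mono) (use t b bt in \<open>auto simp: set_integrable_def indicator_def\<close>)
  finally have "?E t \<le> \<bar>W 0\<bar> + (LINT s:{0..T}|lborel. b s)" by simp
  then have "exp (K * t) * ?E t \<le> exp (K * t) * (\<bar>W 0\<bar> + (LINT s:{0..T}|lborel. b s))"
    by (intro mult_left_mono) auto
  then have "W t \<le> exp (K * t) * (\<bar>W 0\<bar> + (LINT s:{0..T}|lborel. b s))"
    by (simp add: mult.assoc[symmetric] exp_add[symmetric])
  also have "\<dots> \<le> exp (K * T) * (\<bar>W 0\<bar> + (LINT s:{0..T}|lborel. b s))"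
  proof (rule mult_right_mono)
    show "exp (K * t) \<le> exp (K * T)" using t K by (simp add: mult_left_mono)
    have "0 \<le> (LINT s:{0..T}|lborel. b s)"
      unfolding set_lebesgue_integral_def using b by (intro Bochner_Integration.integral_nonneg) (auto simp: indicator_def)
    then show "0 \<le> \<bar>W 0\<bar> + (LINT s:{0..T}|lborel. b s)" by simp
  qed
  finally show ?thesis .
qed

section \<open>Weakly singular kernels\<close>

text \<open>The bound for \<open>\<parallel>(-A)\<^sup>a exp ((t - s) A)\<parallel>\<close> under a time integral over \<open>[0, t]\<close>.\<close>

definition singular_kernel :: "real \<Rightarrow> real \<Rightarrow> real \<Rightarrow> real" where
  "singular_kernel a t s = indicator {0..t} s * (t - s) powr (- a)"

lemma singular_kernel_nonneg [simp]: "0 \<le> singular_kernel a t s"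
  by (simp add: singular_kernel_def)

lemma singular_kernel_measurable [measurable]: "singular_kernel a t \<in> borel_measurable borel"
  unfolding singular_kernel_def by measurable

lemma singular_kernel_integral:
  assumes a: "0 \<le> a" "a < 1" and t: "0 \<le> t"
  shows "has_bochner_integral lborel (singular_kernel a t) (t powr (1 - a) / (1 - a))"
proof -
  let ?f = "\<lambda>x. if x \<in> {0..t} then x powr (- a) else 0" and ?I = "t powr (1 - a) / (1 - a)"
  have "(?f has_integral ?I) UNIV"
    using has_integral_powr_from_0[of "- a" t] a t unfolding has_integral_restrict_UNIV by simp
  then have "(\<integral>\<^sup>+x. ?f x \<partial>lborel) = ?I"
    by (intro nn_integral_has_integral_lborel) auto
  then have "has_bochner_integral lborel ?f ?I"
    using a by (intro has_bochner_integral_nn_integral) auto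
  then have "has_bochner_integral lborel (\<lambda>s. ?f (t + (- 1) * s)) (?I /\<^sub>R \<bar>- 1\<bar>)"
    by (subst lborel_has_bochner_integral_real_affine_iff[symmetric]) auto
  moreover have "(\<lambda>s. ?f (t + (- 1) * s)) = singular_kernel a t"
    using t by (auto simp: singular_kernel_def fun_eq_iff)
  ultimately show ?thesis by simp
qed

lemma singular_kernel_integral_le:
  assumes "0 \<le> a" "a < 1" "t \<in> {0..T}"
  shows "integrable lborel (singular_kernel a t)"
    "(LINT s|lborel. singular_kernel a t s) \<le> T powr (1 - a) / (1 - a)"
proof -
  have t: "0 \<le> t" "t \<le> T" using assms by auto
  from singular_kernel_integral[OF assms(1,2) t(1)]
  show "integrable lborel (singular_kernel a t)"
    "(LINT s|lborel. singular_kernel a t s) \<le> T powr (1 - a) / (1 - a)"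
    using assms t by (auto simp: has_bochner_integral_iff intro!: divide_right_mono powr_mono2)
qed

lemma kernel_mult_integrable:
  fixes g :: "real \<Rightarrow> real"
  assumes "0 \<le> a" "a < 1" "t \<in> {0..T}" and g: "g \<in> borel_measurable lborel" "\<And>u. u \<in> {0..T} \<Longrightarrow> \<bar>g u\<bar> \<le> K"
  shows "integrable lborel (\<lambda>u. singular_kernel a t u * g u)"
proof (rule Bochner_Integration.integrable_bound)
  show "integrable lborel (\<lambda>u. singular_kernel a t u * K)"
    using singular_kernel_integral_le(1)[OF assms(1-3)] by simp
  show "(\<lambda>u. singular_kernel a t u * g u) \<in> borel_measurable lborel"
    using g(1) by measurable
  show "AE u in lborel. norm (singular_kernel a t u * g u) \<le> norm (singular_kernel a t u * K)"
  proof (rule AE_I2)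
    fix u :: real
    show "norm (singular_kernel a t u * g u) \<le> norm (singular_kernel a t u * K)"
    proof (cases "u \<in> {0..T}")
      case True
      then have "\<bar>g u\<bar> \<le> \<bar>K\<bar>" using g(2)[of u] by simp
      then show ?thesis by (simp add: abs_mult mult_left_mono)
    next
      case False
      then have "singular_kernel a t u = 0" using assms(3) by (auto simp: singular_kernel_def indicator_def)
      then show ?thesis by simp
    qed
  qed
qed

context negative_diagonal
begin

text \<open>Minkowski's integral inequality in \<open>H\<^sub>r\<close> for an integral known through its coordinates.
  Pairing a finite section \<open>w\<close> of \<open>(-A)\<^sup>r y\<close> with itself and applying Cauchy--Schwarz under the
  integral gives \<open>(norm w)\<^sup>2 \<le> norm w * \<integral> k * norm q\<close>.\<close>

lemma interp_norm_integral_le: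
  fixes q :: "'a \<Rightarrow> 'h"
  assumes y: "\<And>i. i \<in> B \<Longrightarrow> i \<bullet> y = (LINT s|M. m i s * (i \<bullet> q s))"
    and meas: "\<And>i. i \<in> B \<Longrightarrow> m i \<in> borel_measurable M" "q \<in> borel_measurable M"
    and k: "\<And>s. 0 \<le> k s"
    and le: "\<And>i. i \<in> B \<Longrightarrow> AE s in M. (- \<mu> i) powr r * \<bar>m i s\<bar> \<le> k s"
    and int: "integrable M (\<lambda>s. k s * norm (q s))"
  shows "y \<in> interp_space B \<mu> r" "interp_norm B \<mu> r y \<le> (LINT s|M. k s * norm (q s))"
proof -
  define K where "K = (LINT s|M. k s * norm (q s))"
  have K: "0 \<le> K" unfolding K_def using k by (intro Bochner_Integration.integral_nonneg) auto
  have "(\<Sum>h\<in>J. ((- \<mu> h) powr r * (h \<bullet> y))\<^sup>2) \<le> K\<^sup>2" if J: "finite J" "J \<subseteq> B" for J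
  proof -
    define a where "a h = (- \<mu> h) powr r * (h \<bullet> y)" for h
    define b where "b h s = (- \<mu> h) powr r * (m h s * (h \<bullet> q s))" for h s
    have b_le: "AE s in M. \<bar>b h s\<bar> \<le> k s * \<bar>h \<bullet> q s\<bar>" if "h \<in> B" for h
      using le[OF that] by eventually_elim (auto simp: b_def abs_mult mult.assoc[symmetric] mult_right_mono)
    have int_b: "integrable M (b h)" if "h \<in> B" for h
    proof (rule Bochner_Integration.integrable_bound[OF int])
      show "b h \<in> borel_measurable M"
        unfolding b_def using meas(1)[OF that] meas(2) by measurable
      have h_le: "k s * \<bar>h \<bullet> q s\<bar> \<le> \<bar>k s * norm (q s)\<bar>" for s
        using Cauchy_Schwarz_ineq2[of h "q s"] inner_basis[OF that that] k[of s]
        by (simp add: norm_eq_sqrt_inner mult_left_mono)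
      show "AE s in M. norm (b h s) \<le> norm (k s * norm (q s))"
        using b_le[OF that]
      proof eventually_elim
        case (elim s)
        then show ?case using h_le[of s] unfolding real_norm_def by (rule order_trans)
      qed
    qed
    have "(\<Sum>h\<in>J. (a h)\<^sup>2) = (\<Sum>h\<in>J. a h * (LINT s|M. b h s))"
      using J by (intro sum.cong) (auto simp: a_def b_def y power2_eq_square)
    also have "\<dots> = (\<Sum>h\<in>J. (LINT s|M. a h * b h s))" by simp
    also have "\<dots> = (LINT s|M. (\<Sum>h\<in>J. a h * b h s))"
      by (rule Bochner_Integration.integral_sum[symmetric]) (use J int_b in auto)
    also have "\<dots> \<le> (LINT s|M. L2_set a J * (k s * norm (q s)))"
    proof (rule integral_mono_AE)
      have "AE s in M. \<forall>h\<in>J. \<bar>b h s\<bar> \<le> k s * \<bar>h \<bullet> q s\<bar>"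
        by (rule AE_finite_allI[OF J(1)]) (use J b_le in auto)
      then show "AE s in M. (\<Sum>h\<in>J. a h * b h s) \<le> L2_set a J * (k s * norm (q s))"
      proof eventually_elim
        case (elim s)
        have "(\<Sum>h\<in>J. a h * b h s) \<le> (\<Sum>h\<in>J. \<bar>a h\<bar> * \<bar>b h s\<bar>)"
          by (intro sum_mono) (metis abs_ge_self abs_mult)
        also have "\<dots> \<le> L2_set a J * L2_set (\<lambda>h. b h s) J" by (rule L2_set_mult_ineq)
        also have "L2_set (\<lambda>h. b h s) J \<le> L2_set (\<lambda>h. k s * (h \<bullet> q s)) J"
          unfolding L2_set_def using elim k[of s]
          by (intro real_sqrt_le_mono sum_mono) (auto simp: abs_le_square_iff[symmetric] abs_mult)
        also have "\<dots> = k s * L2_set (\<lambda>h. h \<bullet> q s) J"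
          by (rule L2_set_right_distrib[symmetric, OF k])
        also have "L2_set (\<lambda>h. h \<bullet> q s) J \<le> norm (q s)"
          unfolding L2_set_def by (rule real_le_lsqrt) (use Bessel_inequality[OF J] in \<open>auto intro: sum_nonneg\<close>)
        finally show ?case by (simp add: L2_set_nonneg mult_left_mono k)
      qed
    next
      show "integrable M (\<lambda>s. \<Sum>h\<in>J. a h * b h s)"
        by (intro Bochner_Integration.integrable_sum integrable_mult_right int_b) (use J in auto)
    qed (use int in auto)
    also have "\<dots> = L2_set a J * K" by (simp add: K_def)
    finally have *: "(L2_set a J)\<^sup>2 \<le> L2_set a J * K"
      by (simp add: L2_set_def sum_nonneg)
    have "L2_set a J \<le> K"
    proof (cases "L2_set a J = 0")
      case False
      then have "0 < L2_set a J" using L2_set_nonneg[of a J] by linarith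
      then show ?thesis using * by (simp add: power2_eq_square)
    qed (use K in simp)
    then have "(L2_set a J)\<^sup>2 \<le> K\<^sup>2" by (intro power_mono L2_set_nonneg)
    then show ?thesis by (simp add: L2_set_def sum_nonneg a_def)
  qed
  from interp_space_if_sections_bounded[OF K this]
  show "y \<in> interp_space B \<mu> r" "interp_norm B \<mu> r y \<le> (LINT s|M. k s * norm (q s))"
    by (auto simp: K_def)
qed

end

section \<open>The semigroup\<close>

context negative_diagonal
begin

lemma semigroup_domain: "0 \<le> r \<Longrightarrow> v \<in> diag_domain B (\<lambda>h. exp (r * \<mu> h))"
  and norm_semigroup_le: "0 \<le> r \<Longrightarrow> norm (diag_semigroup B \<mu> r v) \<le> norm v"
proof -
  assume r: "0 \<le> r"
  have "\<bar>exp (r * \<mu> h)\<bar> \<le> 1" if "h \<in> B" for h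
    using r eigenvalue_pos[OF that] by (simp add: mult_nonneg_nonpos)
  from diag_domain_bounded[OF this]
  show "v \<in> diag_domain B (\<lambda>h. exp (r * \<mu> h))" "norm (diag_semigroup B \<mu> r v) \<le> norm v"
    by (auto simp: diag_semigroup_def)
qed

lemma inner_semigroup: "0 \<le> r \<Longrightarrow> i \<in> B \<Longrightarrow> i \<bullet> diag_semigroup B \<mu> r v = exp (r * \<mu> i) * (i \<bullet> v)"
  unfolding diag_semigroup_def by (rule inner_diag_op[OF semigroup_domain])

lemma semigroup_diff: "0 \<le> r \<Longrightarrow> diag_semigroup B \<mu> r (v - w) = diag_semigroup B \<mu> r v - diag_semigroup B \<mu> r w"
  by (rule eq_if_inner_basis_eq) (simp add: inner_semigroup inner_diff_right right_diff_distrib)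

lemma span_proj_semigroup:
  "0 \<le> r \<Longrightarrow> I \<subseteq> B \<Longrightarrow> span_proj I (diag_semigroup B \<mu> r v) = (\<Sum>i\<in>I. (exp (r * \<mu> i) * (i \<bullet> v)) *\<^sub>R i)"
  unfolding span_proj_def by (rule sum.cong) (auto simp: inner_semigroup)

text \<open>On a finite section the semigroup is a finite sum of exponentials, and the
  remainder is small uniformly in time since the semigroup is contractive.\<close>

lemma semigroup_continuous: "continuous_on {0..} (\<lambda>r. diag_semigroup B \<mu> r v)"
proof -
  have "\<exists>J. finite J \<and> J \<subseteq> B \<and> norm (v - span_proj J v) < 1 / real (Suc n)" for n
  proof -
    have "v \<in> interp_space B \<mu> 0" "0 < 1 / real (Suc n)" by (simp_all add: interp_norm_0)
    from span_proj_dense[OF this] show ?thesis by (metis interp_norm_0(2))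
  qed
  then have "\<exists>J. \<forall>n. finite (J n) \<and> J n \<subseteq> B \<and> norm (v - span_proj (J n) v) < 1 / real (Suc n)" by (rule choice[OF allI])
  then obtain J where J: "\<And>n::nat. finite (J n)" "\<And>n::nat. J n \<subseteq> B" "\<And>n. norm (v - span_proj (J n) v) < 1 / real (Suc n)"
    by blast
  have lim0: "(\<lambda>n. 1 / real (Suc n)) \<longlonglongrightarrow> 0"
    using LIMSEQ_inverse_real_of_nat by (simp add: inverse_eq_divide)
  have "uniform_limit {0..} (\<lambda>n r. diag_semigroup B \<mu> r (span_proj (J n) v)) (\<lambda>r. diag_semigroup B \<mu> r v) sequentially"
  proof (rule uniform_limitI)
    fix e :: real assume "0 < e"
    from order_tendstoD(2)[OF lim0 this]
    show "\<forall>\<^sub>F n in sequentially. \<forall>r\<in>{0..}. dist (diag_semigroup B \<mu> r (span_proj (J n) v)) (diag_semigroup B \<mu> r v) < e"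
    proof eventually_elim
      case (elim n)
      show ?case
      proof
        fix r :: real assume "r \<in> {0..}"
        then have r: "0 \<le> r" by simp
        have "dist (diag_semigroup B \<mu> r (span_proj (J n) v)) (diag_semigroup B \<mu> r v)
            = norm (diag_semigroup B \<mu> r (v - span_proj (J n) v))"
          by (simp add: semigroup_diff[OF r] dist_norm norm_minus_commute)
        also have "\<dots> \<le> norm (v - span_proj (J n) v)" by (rule norm_semigroup_le[OF r])
        also have "\<dots> < e" using J(3)[of n] elim by linarith
        finally show "dist (diag_semigroup B \<mu> r (span_proj (J n) v)) (diag_semigroup B \<mu> r v) < e" .
      qed
    qed
  qed
  then show ?thesis
  proof (rule uniform_limit_theorem[rotated])
    have "diag_semigroup B \<mu> r (span_proj (J n) v) = (\<Sum>i\<in>J n. (exp (r * \<mu> i) * (i \<bullet> v)) *\<^sub>R i)" for n r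
      unfolding diag_semigroup_def by (rule diag_domain_span_proj(2)[OF J(1,2)])
    then show "\<forall>\<^sub>F n in sequentially. continuous_on {0..} (\<lambda>r. diag_semigroup B \<mu> r (span_proj (J n) v))"
      by (intro always_eventually allI) (simp, intro continuous_intros)
  qed simp
qed

lemma semigroup_convolution_continuous:
  assumes G: "continuous_on {0..t} G"
  shows "continuous_on {0..t} (\<lambda>s. diag_semigroup B \<mu> (t - s) (G s))"
  unfolding continuous_on_def
proof
  fix s assume s: "s \<in> {0..t}"
  have "continuous_on {0..t} (\<lambda>u. diag_semigroup B \<mu> (t - u) (G s))"
    by (rule continuous_on_compose2[OF semigroup_continuous]) (auto intro!: continuous_intros)
  then have 1: "((\<lambda>u. diag_semigroup B \<mu> (t - u) (G s)) \<longlongrightarrow> diag_semigroup B \<mu> (t - s) (G s)) (at s within {0..t})"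
    using s by (simp add: continuous_on_def)
  have "((\<lambda>u. G u - G s) \<longlongrightarrow> 0) (at s within {0..t})"
    using G s by (simp add: continuous_on_def LIM_zero)
  then have 2: "((\<lambda>u. diag_semigroup B \<mu> (t - u) (G u - G s)) \<longlongrightarrow> 0) (at s within {0..t})"
  proof (rule Lim_null_comparison[OF _ tendsto_norm_zero, rotated])
    show "\<forall>\<^sub>F u in at s within {0..t}. norm (diag_semigroup B \<mu> (t - u) (G u - G s)) \<le> norm (G u - G s)"
      unfolding eventually_at_filter by (intro always_eventually) (auto intro: norm_semigroup_le)
  qed
  have "((\<lambda>u. diag_semigroup B \<mu> (t - u) (G u - G s) + diag_semigroup B \<mu> (t - u) (G s)) \<longlongrightarrow>
      0 + diag_semigroup B \<mu> (t - s) (G s)) (at s within {0..t})"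
    by (rule tendsto_add[OF 2 1])
  then show "((\<lambda>u. diag_semigroup B \<mu> (t - u) (G u)) \<longlongrightarrow> diag_semigroup B \<mu> (t - s) (G s)) (at s within {0..t})"
  proof (rule Lim_transform_eventually[THEN tendsto_eq_rhs])
    show "\<forall>\<^sub>F u in at s within {0..t}. diag_semigroup B \<mu> (t - u) (G u - G s) + diag_semigroup B \<mu> (t - u) (G s)
        = diag_semigroup B \<mu> (t - u) (G u)"
      unfolding eventually_at_filter by (intro always_eventually) (auto simp: semigroup_diff)
  qed simp
qed

text \<open>The passage from the Hilbert space valued integral of the mild formulation to scalar integrals.
  The continuity of \<open>G\<close> provides the Bochner integrability that exchanging \<open>i \<bullet> _\<close> with the integral
  requires.\<close>

lemma inner_semigroup_convolution:
  assumes G: "continuous_on {0..t} G" and i: "i \<in> B"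
  shows "i \<bullet> (LINT s:{0..t}|lborel. diag_semigroup B \<mu> (t - s) (G s)) = duhamel (- \<mu> i) (\<lambda>s. i \<bullet> G s) t"
proof -
  have "integrable lborel (\<lambda>s. indicator {0..t} s *\<^sub>R diag_semigroup B \<mu> (t - s) (G s))"
    using borel_integrable_atLeastAtMost'[OF semigroup_convolution_continuous[OF G]] by (simp add: set_integrable_def)
  then have "i \<bullet> (LINT s:{0..t}|lborel. diag_semigroup B \<mu> (t - s) (G s))
      = (LINT s|lborel. i \<bullet> (indicator {0..t} s *\<^sub>R diag_semigroup B \<mu> (t - s) (G s)))"
    unfolding set_lebesgue_integral_def by (simp only: integral_inner_right)
  also have "\<dots> = duhamel (- \<mu> i) (\<lambda>s. i \<bullet> G s) t"
    unfolding duhamel_def set_lebesgue_integral_def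
    by (rule Bochner_Integration.integral_cong)
      (auto simp: indicator_def inner_semigroup[OF _ i] algebra_simps)
  finally show ?thesis .
qed

end

section \<open>The coefficients of the equation\<close>

text \<open>The embeddings \<open>H\<^sub>\<rho> \<subseteq> V \<subseteq> H\<close> enter through the constants \<open>cV\<close> and \<open>cH\<close> and the density of \<open>H\<^sub>\<rho>\<close> in \<open>V\<close>.\<close>

locale spde_coefficients = negative_diagonal B \<mu> \<delta>
  for B :: "'h::{real_inner, banach, second_countable_topology} set" and \<mu> :: "'h \<Rightarrow> real" and \<delta> :: real +
  fixes T c varphi \<epsilon> \<rho> \<gamma> chi :: real
    and V :: "'h set" and normV :: "'h \<Rightarrow> real" and cV cH :: real
    and \<phi> \<Phi> :: "(real \<Rightarrow> 'h) \<Rightarrow> real" and F :: "'h \<Rightarrow> 'h"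
  assumes T_pos: "0 < T" and c_pos: "0 < c" and varphi_pos: "0 < varphi"
    and eps: "0 \<le> \<epsilon>" "\<epsilon> < 1" and rho: "0 \<le> \<rho>" "\<rho> < 1/2" and gamma: "\<rho> < \<gamma>" "\<gamma> \<le> 1/2"
    and chi: "0 < chi" "chi \<le> (\<gamma> - \<rho>) / (1 + varphi/2)" "chi \<le> (1 - \<rho>) / (1 + varphi)"
    and V: "norm_on V normV"
    and interp_space_subset_V: "interp_space B \<mu> \<rho> \<subseteq> V"
    and cV_pos: "0 < cV" and normV_le: "\<And>v. v \<in> interp_space B \<mu> \<rho> \<Longrightarrow> normV v \<le> cV * interp_norm B \<mu> \<rho> v"
    and interp_space_dense_V: "\<And>v e. v \<in> V \<Longrightarrow> 0 < e \<Longrightarrow> \<exists>w\<in>interp_space B \<mu> \<rho>. normV (v - w) < e"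
    and cH_pos: "0 < cH" and norm_le_normV: "\<And>v. v \<in> V \<Longrightarrow> norm v \<le> cH * normV v"
    and phi_nonneg: "\<And>x. x \<in> mspace (path_metric T (interp_metric B \<mu> 1)) \<Longrightarrow> 0 \<le> \<phi> x"
    and Phi_nonneg: "\<And>x. x \<in> mspace (path_metric T (interp_metric B \<mu> 1)) \<Longrightarrow> 0 \<le> \<Phi> x"
    and F_continuous: "continuous_map (mtopology_of (norm_metric V normV)) euclidean F"
    and monotone: "\<And>I v w. I \<in> Fpow B \<Longrightarrow> v \<in> range (span_proj I) \<Longrightarrow> w \<in> range (span_proj I) \<Longrightarrow>
      (v - w) \<bullet> (diag_op B \<mu> v + F v - diag_op B \<mu> w - F w) \<le> c * (norm (v - w))\<^sup>2"
    and coercive: "\<And>I v x. I \<in> Fpow B \<Longrightarrow> v \<in> range (span_proj I) \<Longrightarrow>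
      x \<in> mspace (path_metric T (interp_metric B \<mu> 1)) \<Longrightarrow>
      (SUP t\<in>{0..T}. ereal (interp_inner B \<mu> (1/2) v (span_proj I (F (v + x t)))
                           + \<phi> x * (v \<bullet> F (v + x t))))
      \<le> ereal (\<epsilon> * (interp_norm B \<mu> 1 v)\<^sup>2 + (c + \<phi> x) * (interp_norm B \<mu> (1/2) v)\<^sup>2
               + c * \<phi> x * (norm v)\<^sup>2 + \<Phi> x)"
    and local_lipschitz: "\<And>I v w. I \<in> Fpow B \<Longrightarrow> v \<in> range (span_proj I) \<Longrightarrow> w \<in> range (span_proj I) \<Longrightarrow>
      (norm (F v - F w))\<^sup>2
      \<le> c * (normV (v - w))\<^sup>2 * (1 + normV v powr varphi + normV w powr varphi)"
begin

lemmas subspace_V = norm_on_subspace[OF V]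
lemmas V_diff = subspace_diff[OF subspace_V] and V_add = subspace_add[OF subspace_V]
lemmas normV_nonneg = norm_on_nonneg[OF V]
lemmas normV_triangle = norm_on_triangle[OF V] and normV_triangle_diff = norm_on_triangle_diff[OF V]
lemmas normV_minus_commute = norm_on_minus_commute[OF V]

lemma V_span_proj [simp]: "finite I \<Longrightarrow> I \<subseteq> B \<Longrightarrow> span_proj I v \<in> V"
  using interp_space_subset_V interp_space_span_proj by blast

lemma normV_diff_ineq: "v \<in> V \<Longrightarrow> w \<in> V \<Longrightarrow> \<bar>normV v - normV w\<bar> \<le> normV (v - w)"
  using normV_triangle_diff[of v w] normV_triangle_diff[of w v] normV_minus_commute[of v w] by simp

lemma interp_space_gamma:
  assumes "v \<in> interp_space B \<mu> \<gamma>"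
  shows "v \<in> V" "normV v \<le> cV * \<delta> powr (\<rho> - \<gamma>) * interp_norm B \<mu> \<gamma> v"
proof -
  have v: "v \<in> interp_space B \<mu> \<rho>" "interp_norm B \<mu> \<rho> v \<le> \<delta> powr (\<rho> - \<gamma>) * interp_norm B \<mu> \<gamma> v"
    using interp_space_mono[OF assms, of \<rho>] gamma by auto
  then show "v \<in> V" using interp_space_subset_V by blast
  have "normV v \<le> cV * interp_norm B \<mu> \<rho> v" using normV_le v by blast
  also have "\<dots> \<le> cV * (\<delta> powr (\<rho> - \<gamma>) * interp_norm B \<mu> \<gamma> v)"
    using v(2) cV_pos by (intro mult_left_mono) auto
  finally show "normV v \<le> cV * \<delta> powr (\<rho> - \<gamma>) * interp_norm B \<mu> \<gamma> v" by (simp add: mult.assoc)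
qed

text \<open>The constant of the embedding \<open>H\<^sub>\<gamma> \<subseteq> V\<close>.\<close>

definition cG :: real where "cG = cV * \<delta> powr (\<rho> - \<gamma>)"

lemma cG_pos: "0 < cG" using cV_pos gap_pos by (simp add: cG_def)

lemma F_continuous_at:
  "v \<in> V \<Longrightarrow> 0 < e \<Longrightarrow> \<exists>d>0. \<forall>w\<in>V. normV (v - w) < d \<longrightarrow> norm (F v - F w) < e"
  using F_continuous unfolding continuous_map_norm_metric_euclidean_iff[OF V] by blast

lemma finite_sections_dense_V:
  assumes v: "v \<in> V" and e: "0 < e"
  shows "\<exists>I u. finite I \<and> I \<subseteq> B \<and> normV (v - span_proj I u) < e"
proof -
  obtain w where w: "w \<in> interp_space B \<mu> \<rho>" "normV (v - w) < e / 2"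
    using interp_space_dense_V[OF v, of "e / 2"] e by auto
  obtain I where I: "finite I" "I \<subseteq> B" "interp_norm B \<mu> \<rho> (w - span_proj I w) < e / 2 / cV"
    using span_proj_dense[OF w(1), of "e / 2 / cV"] e cV_pos by auto
  have wV: "w \<in> V" using w interp_space_subset_V by auto
  have "normV (w - span_proj I w) \<le> cV * interp_norm B \<mu> \<rho> (w - span_proj I w)"
    using I w by (intro normV_le subspace_diff[OF interp_space_subspace]) auto
  also have "\<dots> < e / 2" using I(3) cV_pos by (simp add: field_simps)
  finally have "normV ((v - w) + (w - span_proj I w)) < e"
    using normV_triangle[of "v - w" "w - span_proj I w"] w v wV I by (simp add: V_diff)
  then show ?thesis using I(1,2) by (intro exI[of _ I] exI[of _ w]) simp
qed

text \<open>The local Lipschitz estimate extends from the finite sections to all of \<open>V\<close> because these are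
  dense in \<open>H\<^sub>\<rho>\<close>, hence in \<open>V\<close>, and both sides are continuous on \<open>V\<close>.\<close>

lemma local_lipschitz_V:
  assumes v: "v \<in> V" and w: "w \<in> V"
  shows "norm (F v - F w) \<le> sqrt c * normV (v - w) * (1 + normV v powr (varphi/2) + normV w powr (varphi/2))"
proof -
  have approx: "\<exists>a. \<forall>n. (\<exists>I. finite I \<and> I \<subseteq> B \<and> span_proj I (a n) = a n) \<and> normV (z - a n) < 1 / real (Suc n)"
    if z: "z \<in> V" for z
  proof (rule choice, rule allI)
    fix n
    have "0 < 1 / real (Suc n)" by simp
    then obtain I u where I: "finite I" "I \<subseteq> B" "normV (z - span_proj I u) < 1 / real (Suc n)"
      using finite_sections_dense_V[OF z] by meson
    then show "\<exists>a. (\<exists>I. finite I \<and> I \<subseteq> B \<and> span_proj I a = a) \<and> normV (z - a) < 1 / real (Suc n)"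
      by (intro exI[of _ "span_proj I u"] conjI exI[of _ I]) auto
  qed
  obtain a where a: "\<And>n. \<exists>I. finite I \<and> I \<subseteq> B \<and> span_proj I (a n) = a n"
    "\<And>n. normV (v - a n) < 1 / real (Suc n)"
    using approx[OF v] by blast
  obtain b where b: "\<And>n. \<exists>I. finite I \<and> I \<subseteq> B \<and> span_proj I (b n) = b n"
    "\<And>n. normV (w - b n) < 1 / real (Suc n)"
    using approx[OF w] by blast
  have aV: "a n \<in> V" and bV: "b n \<in> V" for n
    using a(1)[of n] b(1)[of n] V_span_proj by metis+
  have lim0: "(\<lambda>n. 1 / real (Suc n)) \<longlonglongrightarrow> 0"
    using LIMSEQ_inverse_real_of_nat by (simp add: inverse_eq_divide)
  have a0: "(\<lambda>n. normV (v - a n)) \<longlonglongrightarrow> 0"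
    by (rule tendsto_sandwich[OF _ _ tendsto_const lim0])
      (use a(2) aV v in \<open>auto intro!: always_eventually normV_nonneg V_diff intro: less_imp_le simp del: of_nat_Suc\<close>)
  have b0: "(\<lambda>n. normV (w - b n)) \<longlonglongrightarrow> 0"
    by (rule tendsto_sandwich[OF _ _ tendsto_const lim0])
      (use b(2) bV w in \<open>auto intro!: always_eventually normV_nonneg V_diff intro: less_imp_le simp del: of_nat_Suc\<close>)
  have norm_lim: "(\<lambda>n. normV (z n)) \<longlonglongrightarrow> normV y" if "(\<lambda>n. normV (y - z n)) \<longlonglongrightarrow> 0" "y \<in> V" "\<And>n. z n \<in> V" for y z
  proof (rule LIM_zero_cancel, rule Lim_null_comparison[OF _ that(1)])
    show "\<forall>\<^sub>F n in sequentially. norm (normV (z n) - normV y) \<le> normV (y - z n)"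
      using normV_diff_ineq[OF that(2,3)] by (auto intro!: always_eventually simp: abs_minus_commute)
  qed
  have F_lim: "(\<lambda>n. F (z n)) \<longlonglongrightarrow> F y" if conv: "(\<lambda>n. normV (y - z n)) \<longlonglongrightarrow> 0" and y: "y \<in> V" and z: "\<And>n. z n \<in> V" for y z
  proof (rule tendstoI)
    fix e :: real assume "0 < e"
    then obtain d where d: "0 < d" "\<And>w. w \<in> V \<Longrightarrow> normV (y - w) < d \<Longrightarrow> norm (F y - F w) < e"
      using F_continuous_at[OF y] by blast
    from order_tendstoD(2)[OF conv d(1)] show "\<forall>\<^sub>F n in sequentially. dist (F (z n)) (F y) < e"
      by eventually_elim (simp add: dist_norm norm_minus_commute[of _ "F y"] d(2) z)
  qed
  have ab0: "(\<lambda>n. normV ((v - w) - (a n - b n))) \<longlonglongrightarrow> 0"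
  proof (rule tendsto_sandwich[OF _ _ tendsto_const])
    show "(\<lambda>n. normV (v - a n) + normV (w - b n)) \<longlonglongrightarrow> 0" using tendsto_add[OF a0 b0] by simp
    have "normV ((v - w) - (a n - b n)) \<le> normV (v - a n) + normV (w - b n)" for n
      using normV_triangle[of "v - a n" "b n - w"] normV_minus_commute[of w "b n"] v w aV bV
      by (simp add: V_diff algebra_simps)
    then show "\<forall>\<^sub>F n in sequentially. normV ((v - w) - (a n - b n)) \<le> normV (v - a n) + normV (w - b n)" by simp
  qed (use v w aV bV in \<open>auto intro!: always_eventually normV_nonneg V_diff\<close>)
  have le: "(norm (F (a n) - F (b n)))\<^sup>2 \<le> c * (normV (a n - b n))\<^sup>2 * (1 + normV (a n) powr varphi + normV (b n) powr varphi)" for n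
  proof -
    obtain I J where I: "finite I" "I \<subseteq> B" "span_proj I (a n) = a n"
      and J: "finite J" "J \<subseteq> B" "span_proj J (b n) = b n"
      using a(1)[of n] b(1)[of n] by blast
    have IJ: "finite (I \<union> J)" "I \<union> J \<subseteq> B" using I J by auto
    have "span_proj (I \<union> J) (a n) = a n"
      by (rule eq_if_inner_basis_eq) (metis I IJ UnCI inner_span_proj)
    moreover have "span_proj (I \<union> J) (b n) = b n"
      by (rule eq_if_inner_basis_eq) (metis J IJ UnCI inner_span_proj)
    ultimately show ?thesis
      using IJ by (intro local_lipschitz[of "I \<union> J"]) (auto simp: Fpow_def range_span_proj_iff)
  qed
  have powr_lim: "(\<lambda>n. normV (z n) powr varphi) \<longlonglongrightarrow> normV y powr varphi"
    if "(\<lambda>n. normV (y - z n)) \<longlonglongrightarrow> 0" "y \<in> V" "\<And>n. z n \<in> V" for y z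
    by (rule tendsto_powr'[OF norm_lim[OF that] tendsto_const])
      (use varphi_pos normV_nonneg[OF that(3)] in auto)
  have sq: "(norm (F v - F w))\<^sup>2 \<le> c * (normV (v - w))\<^sup>2 * (1 + normV v powr varphi + normV w powr varphi)"
  proof (rule LIMSEQ_le)
    show "(\<lambda>n. (norm (F (a n) - F (b n)))\<^sup>2) \<longlonglongrightarrow> (norm (F v - F w))\<^sup>2"
      by (intro tendsto_intros F_lim a0 b0 v w aV bV)
    show "(\<lambda>n. c * (normV (a n - b n))\<^sup>2 * (1 + normV (a n) powr varphi + normV (b n) powr varphi))
      \<longlonglongrightarrow> c * (normV (v - w))\<^sup>2 * (1 + normV v powr varphi + normV w powr varphi)"
      by (intro tendsto_mult tendsto_add tendsto_const tendsto_power norm_lim[OF ab0] powr_lim a0 b0 v w aV bV V_diff)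
  qed (use le in auto)
  define x where "x = normV v powr (varphi/2)"
  define y where "y = normV w powr (varphi/2)"
  have xy: "normV v powr varphi = x\<^sup>2" "normV w powr varphi = y\<^sup>2" "0 \<le> x" "0 \<le> y"
    by (auto simp: x_def y_def power2_eq_square powr_add[symmetric])
  have "(norm (F v - F w))\<^sup>2 \<le> c * (normV (v - w))\<^sup>2 * (1 + x + y)\<^sup>2"
  proof (rule order_trans[OF sq])
    have "1 + x\<^sup>2 + y\<^sup>2 \<le> (1 + x + y)\<^sup>2" using xy by (simp add: power2_eq_square algebra_simps)
    then show "c * (normV (v - w))\<^sup>2 * (1 + normV v powr varphi + normV w powr varphi) \<le> c * (normV (v - w))\<^sup>2 * (1 + x + y)\<^sup>2"
      using c_pos by (intro mult_left_mono) (auto simp: xy)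
  qed
  also have "\<dots> = (sqrt c * normV (v - w) * (1 + x + y))\<^sup>2"
    using c_pos by (simp add: power_mult_distrib)
  finally have "norm (F v - F w) \<le> sqrt c * normV (v - w) * (1 + x + y)"
  proof (rule power2_le_imp_le)
    show "0 \<le> sqrt c * normV (v - w) * (1 + x + y)"
      using c_pos xy normV_nonneg[OF V_diff[OF v w]] by (intro mult_nonneg_nonneg) auto
  qed
  then show ?thesis by (simp add: x_def y_def)
qed

definition growth_const :: real where "growth_const = norm (F 0) + 2 * sqrt c"

lemma growth_const_pos: "0 < growth_const"
  using c_pos by (simp add: growth_const_def add_nonneg_pos)

lemma F_growth:
  assumes v: "v \<in> V"
  shows "norm (F v) \<le> growth_const * (1 + normV v) powr (1 + varphi/2)"
proof -
  let ?n = "normV v"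
  have n: "0 \<le> ?n" using v by (rule normV_nonneg)
  have "0 \<in> V" using subspace_V by (rule subspace_0)
  have N0: "normV 0 = 0" using norm_on_scale[OF V \<open>0 \<in> V\<close>, of 0] by simp
  have one: "1 \<le> (1 + ?n) powr (varphi/2)" using n varphi_pos by (intro ge_one_powr_ge_zero) auto
  have "norm (F v) \<le> norm (F 0) + norm (F v - F 0)" using norm_triangle_sub by blast
  also have "norm (F v - F 0) \<le> sqrt c * ?n * (1 + ?n powr (varphi/2))"
    using local_lipschitz_V[OF v \<open>0 \<in> V\<close>] by (simp add: N0)
  also have "\<dots> \<le> sqrt c * (1 + ?n) * ((1 + ?n) powr (varphi/2) + (1 + ?n) powr (varphi/2))"
    using n c_pos one varphi_pos by (intro mult_mono add_mono powr_mono2) auto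
  also have "\<dots> = 2 * sqrt c * (1 + ?n) powr (1 + varphi/2)"
    using n by (simp add: powr_add)
  also have "norm (F 0) \<le> norm (F 0) * (1 + ?n) powr (1 + varphi/2)"
    using n varphi_pos ge_one_powr_ge_zero[of "1 + ?n" "1 + varphi/2"] by (simp add: mult_le_cancel_left1)
  finally show ?thesis by (simp add: growth_const_def distrib_right)
qed

text \<open>On the finite-dimensional range of the projection all norms are comparable. The constant
  depends on the section, so that this serves continuity and measurability but no estimate.\<close>

lemma normV_span_proj_bound:
  assumes I: "finite I" "I \<subseteq> B"
  obtains K where "0 \<le> K" "\<And>v. normV (span_proj I v) \<le> K * norm v"
proof -
  define K where "K = (\<Sum>h\<in>I. normV h)"
  have hV: "h \<in> V" if "h \<in> I" for h
  proof -
    have "span_proj {h} h = h" using that I inner_basis[of h h] by (auto simp: span_proj_def)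
    then show ?thesis using V_span_proj[of "{h}" h] that I by auto
  qed
  have "normV (span_proj I v) \<le> K * norm v" for v
  proof -
    have "normV (span_proj J v) \<le> (\<Sum>h\<in>J. \<bar>h \<bullet> v\<bar> * normV h)" if "J \<subseteq> I" for J
      using finite_subset[OF that I(1)] that
    proof (induction J rule: finite_induct)
      case empty
      show ?case using norm_on_scale[OF V subspace_0[OF subspace_V], of 0] by (simp add: span_proj_def)
    next
      case (insert h J)
      have "span_proj J v \<in> V" using insert I by (intro V_span_proj) auto
      then show ?case
        using insert normV_triangle[of "(h \<bullet> v) *\<^sub>R h" "span_proj J v"] norm_on_scale[OF V hV, of h "h \<bullet> v"] hV
        by (simp add: span_proj_def subspace_scale[OF subspace_V])
    qed
    from this[of I] have "normV (span_proj I v) \<le> (\<Sum>h\<in>I. \<bar>h \<bullet> v\<bar> * normV h)" by simp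
    also have "\<dots> \<le> (\<Sum>h\<in>I. norm v * normV h)"
    proof (intro sum_mono mult_right_mono normV_nonneg hV)
      fix h assume "h \<in> I"
      then have "norm h = 1" using inner_basis[of h h] I by (auto simp: norm_eq_sqrt_inner)
      then show "\<bar>h \<bullet> v\<bar> \<le> norm v" using Cauchy_Schwarz_ineq2[of h v] by simp
    qed
    finally show ?thesis by (simp add: K_def sum_distrib_left mult.commute)
  qed
  moreover have "0 \<le> K" unfolding K_def using hV by (intro sum_nonneg normV_nonneg)
  ultimately show thesis using that by blast
qed

lemma continuous_on_normV_span_proj:
  assumes I: "finite I" "I \<subseteq> B"
  shows "continuous_on UNIV (\<lambda>v. normV (span_proj I v))"
proof -
  obtain K where K: "0 \<le> K" "\<And>v. normV (span_proj I v) \<le> K * norm v" using normV_span_proj_bound[OF I] by blast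
  show ?thesis
    unfolding continuous_on_iff
  proof (intro ballI allI impI)
    fix v :: 'h and e :: real assume e: "0 < e"
    have "dist (normV (span_proj I w)) (normV (span_proj I v)) < e" if "dist w v < e / (K + 1)" for w
    proof -
      have "dist (normV (span_proj I w)) (normV (span_proj I v)) \<le> normV (span_proj I w - span_proj I v)"
        using normV_diff_ineq I by (simp add: dist_real_def)
      also have "\<dots> \<le> K * norm (w - v)"
        using K(2)[of "w - v"] by (simp add: bounded_linear.linear linear_diff bounded_linear_span_proj)
      also have "\<dots> \<le> K * (e / (K + 1))" using that K by (intro mult_left_mono) (auto simp: dist_norm)
      also have "\<dots> < e" using e K by (simp add: field_simps)
      finally show ?thesis .
    qed
    then show "\<exists>d>0. \<forall>w\<in>UNIV. dist w v < d \<longrightarrow> dist (normV (span_proj I w)) (normV (span_proj I v)) < e"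
      using e K by (intro exI[of _ "e / (K + 1)"]) auto
  qed
qed

lemma continuous_on_F_span_proj:
  assumes I: "finite I" "I \<subseteq> B"
  shows "continuous_on UNIV (\<lambda>v. F (span_proj I v))"
proof -
  obtain K where K: "0 \<le> K" "\<And>v. normV (span_proj I v) \<le> K * norm v" using normV_span_proj_bound[OF I] by blast
  show ?thesis
    unfolding continuous_on_iff
  proof (intro ballI allI impI)
    fix v :: 'h and e :: real assume e: "0 < e"
    obtain d where d: "0 < d" "\<And>w. w \<in> V \<Longrightarrow> normV (span_proj I v - w) < d \<Longrightarrow> norm (F (span_proj I v) - F w) < e"
      using F_continuous_at[OF V_span_proj[OF I] e] by blast
    have "dist (F (span_proj I w)) (F (span_proj I v)) < e" if "dist w v < d / (K + 1)" for w
    proof -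
      have "normV (span_proj I v - span_proj I w) \<le> K * norm (v - w)"
        using K(2)[of "v - w"] by (simp add: bounded_linear.linear linear_diff bounded_linear_span_proj)
      also have "\<dots> \<le> K * (d / (K + 1))" using that K by (intro mult_left_mono) (auto simp: dist_norm norm_minus_commute)
      also have "\<dots> < d" using d(1) K by (simp add: field_simps)
      finally have "norm (F (span_proj I v) - F (span_proj I w)) < e" using d(2) I by simp
      then show ?thesis by (simp add: dist_norm norm_minus_commute)
    qed
    then show "\<exists>d>0. \<forall>w\<in>UNIV. dist w v < d \<longrightarrow> dist (F (span_proj I w)) (F (span_proj I v)) < e"
      using d(1) K by (intro exI[of _ "d / (K + 1)"]) auto
  qed
qed

lemma continuous_on_interp_norm_span_proj:
  assumes I: "finite I" "I \<subseteq> B"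
  shows "continuous_on UNIV (\<lambda>v. interp_norm B \<mu> r (span_proj I v))"
proof -
  have "interp_norm B \<mu> r (span_proj I v) = sqrt (\<Sum>h\<in>I. ((- \<mu> h) powr r * (h \<bullet> v))\<^sup>2)" for v
    using interp_norm_span_proj[OF I, of r v] by (metis interp_norm_nonneg real_sqrt_unique)
  then show ?thesis by (simp only:) (intro continuous_intros)
qed

text \<open>The processes take their values in the metric spaces \<open>V\<close>, \<open>H\<^sub>\<gamma>\<close> and \<open>H\<^sub>1\<close>. Continuity of a function on
  these spaces makes its composition with the processes measurable.\<close>

lemma continuous_map_V_lipschitz:
  fixes f :: "'h \<Rightarrow> 'b::real_normed_vector"
  assumes "\<And>v w. v \<in> V \<Longrightarrow> w \<in> V \<Longrightarrow> norm (f v - f w) \<le> K * normV (v - w)"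
  shows "continuous_map (mtopology_of (norm_metric V normV)) euclidean f"
  unfolding continuous_map_norm_metric_euclidean_iff[OF V]
proof (intro ballI allI impI)
  fix v and e :: real assume v: "v \<in> V" and e: "0 < e"
  have "norm (f v - f w) < e" if w: "w \<in> V" "normV (v - w) < e / (\<bar>K\<bar> + 1)" for w
  proof -
    have n: "0 \<le> normV (v - w)" using v w by (simp add: normV_nonneg V_diff)
    have "norm (f v - f w) \<le> K * normV (v - w)" using assms v w by simp
    also have "\<dots> \<le> (\<bar>K\<bar> + 1) * normV (v - w)" using n by (intro mult_right_mono) auto
    also have "\<dots> < e" using w(2) by (simp add: field_simps)
    finally show ?thesis .
  qed
  then show "\<exists>d>0. \<forall>w\<in>V. normV (v - w) < d \<longrightarrow> norm (f v - f w) < e"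
    using e by (intro exI[of _ "e / (\<bar>K\<bar> + 1)"]) auto
qed

lemma continuous_map_V_norm: "continuous_map (mtopology_of (norm_metric V normV)) euclidean normV"
  by (rule continuous_map_V_lipschitz[of _ 1]) (simp add: normV_diff_ineq)

lemma continuous_map_V_inclusion: "continuous_map (mtopology_of (norm_metric V normV)) euclidean (\<lambda>v. v)"
  by (rule continuous_map_V_lipschitz[of _ cH]) (simp add: norm_le_normV V_diff)

lemma continuous_map_V_complement:
  assumes I: "finite I" "I \<subseteq> B"
  shows "continuous_map (mtopology_of (norm_metric V normV)) euclidean (\<lambda>v. normV (v - span_proj I v))"
proof -
  obtain K where K: "0 \<le> K" "\<And>v. normV (span_proj I v) \<le> K * norm v" using normV_span_proj_bound[OF I] by blast
  show ?thesis
  proof (rule continuous_map_V_lipschitz[of _ "1 + K * cH"])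
    fix v w assume v: "v \<in> V" and w: "w \<in> V"
    have vw: "v - w \<in> V" using v w by (rule V_diff)
    have "norm (normV (v - span_proj I v) - normV (w - span_proj I w)) \<le> normV ((v - span_proj I v) - (w - span_proj I w))"
      using v w I by (simp add: normV_diff_ineq V_diff)
    also have "(v - span_proj I v) - (w - span_proj I w) = (v - w) + (- 1) *\<^sub>R span_proj I (v - w)"
      by (simp add: span_proj_diff)
    also have "normV \<dots> \<le> normV (v - w) + normV ((- 1) *\<^sub>R span_proj I (v - w))"
      using vw I by (intro normV_triangle subspace_scale[OF subspace_V]) auto
    also have "normV ((- 1) *\<^sub>R span_proj I (v - w)) = normV (span_proj I (v - w))"
      using norm_on_scale[OF V V_span_proj[OF I], of "-1" "v - w"] by simp
    also have "\<dots> \<le> K * (cH * normV (v - w))"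
      using K(2)[of "v - w"] mult_left_mono[OF norm_le_normV[OF vw] K(1)] by linarith
    finally show "norm (normV (v - span_proj I v) - normV (w - span_proj I w)) \<le> (1 + K * cH) * normV (v - w)"
      by (simp add: algebra_simps)
  qed
qed

lemma continuous_map_gamma:
  fixes f :: "'h \<Rightarrow> 'b::real_normed_vector"
  assumes "continuous_map (mtopology_of (norm_metric V normV)) euclidean f"
  shows "continuous_map (mtopology_of (interp_metric B \<mu> \<gamma>)) euclidean f"
  unfolding interp_metric_def continuous_map_norm_metric_euclidean_iff[OF norm_on_interp_space]
proof (intro ballI allI impI)
  fix v and e :: real assume v: "v \<in> interp_space B \<mu> \<gamma>" and e: "0 < e"
  obtain d where d: "0 < d" "\<And>w. w \<in> V \<Longrightarrow> normV (v - w) < d \<Longrightarrow> norm (f v - f w) < e"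
    using assms[unfolded continuous_map_norm_metric_euclidean_iff[OF V]] interp_space_gamma(1)[OF v] e by meson
  have "norm (f v - f w) < e" if w: "w \<in> interp_space B \<mu> \<gamma>" "interp_norm B \<mu> \<gamma> (v - w) < d / cG" for w
  proof (rule d(2))
    show "w \<in> V" by (rule interp_space_gamma(1)[OF w(1)])
    have "normV (v - w) \<le> cG * interp_norm B \<mu> \<gamma> (v - w)"
      using interp_space_gamma(2)[OF subspace_diff[OF interp_space_subspace v w(1)]] by (simp add: cG_def)
    also have "\<dots> < d" using w(2) cG_pos by (simp add: field_simps)
    finally show "normV (v - w) < d" .
  qed
  then show "\<exists>d>0. \<forall>w\<in>interp_space B \<mu> \<gamma>. interp_norm B \<mu> \<gamma> (v - w) < d \<longrightarrow> norm (f v - f w) < e"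
    using d(1) cG_pos by (intro exI[of _ "d / cG"]) auto
qed

lemma continuous_map_gamma_norm: "continuous_map (mtopology_of (interp_metric B \<mu> \<gamma>)) euclidean (interp_norm B \<mu> \<gamma>)"
  unfolding interp_metric_def continuous_map_norm_metric_euclidean_iff[OF norm_on_interp_space]
proof (intro ballI allI impI)
  fix v and e :: real assume v: "v \<in> interp_space B \<mu> \<gamma>" and e: "0 < e"
  have "norm (interp_norm B \<mu> \<gamma> v - interp_norm B \<mu> \<gamma> w) \<le> interp_norm B \<mu> \<gamma> (v - w)"
    if w: "w \<in> interp_space B \<mu> \<gamma>" for w
    using norm_on_triangle_diff[OF norm_on_interp_space v w] norm_on_triangle_diff[OF norm_on_interp_space w v]
      norm_on_minus_commute[OF norm_on_interp_space v w] by simp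
  then show "\<exists>d>0. \<forall>w\<in>interp_space B \<mu> \<gamma>. interp_norm B \<mu> \<gamma> (v - w) < d \<longrightarrow>
      norm (interp_norm B \<mu> \<gamma> v - interp_norm B \<mu> \<gamma> w) < e"
    using e by (intro exI[of _ e]) (meson le_less_trans)
qed

lemma continuous_map_H1_inclusion: "continuous_map (mtopology_of (interp_metric B \<mu> 1)) euclidean (\<lambda>v. v)"
  unfolding interp_metric_def continuous_map_norm_metric_euclidean_iff[OF norm_on_interp_space]
proof (intro ballI allI impI)
  fix v and e :: real assume v: "v \<in> interp_space B \<mu> 1" and e: "0 < e"
  have "norm (v - w) < e" if w: "w \<in> interp_space B \<mu> 1" "interp_norm B \<mu> 1 (v - w) < e * \<delta>" for w
  proof -
    have "norm (v - w) \<le> \<delta> powr (- 1) * interp_norm B \<mu> 1 (v - w)"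
      by (rule norm_le_interp_norm[OF subspace_diff[OF interp_space_subspace v w(1)]]) simp
    also have "\<dots> < e" using w(2) gap_pos by (simp add: powr_minus field_simps)
    finally show ?thesis .
  qed
  then show "\<exists>d>0. \<forall>w\<in>interp_space B \<mu> 1. interp_norm B \<mu> 1 (v - w) < d \<longrightarrow> norm (v - w) < e"
    using e gap_pos by (intro exI[of _ "e * \<delta>"]) auto
qed

section \<open>Paths of the scheme\<close>

definition convolution :: "'h set \<Rightarrow> (real \<Rightarrow> 'h) \<Rightarrow> real \<Rightarrow> 'h" where
  "convolution I f t = (\<Sum>i\<in>I. duhamel (- \<mu> i) (\<lambda>s. i \<bullet> f s) t *\<^sub>R i)"

definition truncated_force :: "real \<Rightarrow> (real \<Rightarrow> 'h) \<Rightarrow> (real \<Rightarrow> 'h) \<Rightarrow> real \<Rightarrow> 'h" where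
  "truncated_force h Y n s =
    of_bool (interp_norm B \<mu> \<gamma> (Y (grid_floor h s)) + interp_norm B \<mu> \<gamma> (n (grid_floor h s)) \<le> h powr (- chi))
     *\<^sub>R F (Y (grid_floor h s))"

text \<open>A path \<open>Y\<close> of the scheme with step size \<open>h\<close>, driven by the noise path \<open>n\<close>. The force depends
  on \<open>Y\<close> through its values on the grid, so the equation is imposed there.\<close>

definition scheme_path :: "real \<Rightarrow> 'h set \<Rightarrow> (real \<Rightarrow> 'h) \<Rightarrow> (real \<Rightarrow> 'h) \<Rightarrow> bool" where
  "scheme_path h I n Y \<longleftrightarrow> 0 < h \<and> h \<le> T \<and> finite I \<and> I \<subseteq> B \<and> (\<forall>t\<in>{0..T}. span_proj I (n t) = n t) \<and>
    (\<forall>t\<in>{0..T}. Y (grid_floor h t) = convolution I (truncated_force h Y n) (grid_floor h t) + n (grid_floor h t))"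

lemma inner_convolution:
  "finite I \<Longrightarrow> I \<subseteq> B \<Longrightarrow> i \<in> B \<Longrightarrow>
    i \<bullet> convolution I f t = (if i \<in> I then duhamel (- \<mu> i) (\<lambda>s. i \<bullet> f s) t else 0)"
  unfolding convolution_def by (rule inner_basis_sum)

lemma span_proj_convolution [simp]:
  "finite I \<Longrightarrow> I \<subseteq> B \<Longrightarrow> span_proj I (convolution I f t) = convolution I f t"
  by (rule eq_if_inner_basis_eq) (simp add: inner_span_proj inner_convolution)

lemma truncated_force_inner:
  "i \<bullet> truncated_force h Y n s = (\<lambda>u. i \<bullet> (of_bool (interp_norm B \<mu> \<gamma> (Y u) + interp_norm B \<mu> \<gamma> (n u) \<le> h powr (- chi))
     *\<^sub>R F (Y u))) (grid_floor h s)"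
  by (simp add: truncated_force_def)

lemma truncated_force_set_integrable: "0 < h \<Longrightarrow> set_integrable lborel {0..T} (\<lambda>s. i \<bullet> truncated_force h Y n s)"
  unfolding truncated_force_inner by (rule step_function_set_integrable)

lemma isCont_truncated_force:
  "0 < h \<Longrightarrow> grid_floor h s \<noteq> s \<Longrightarrow> isCont (\<lambda>s. i \<bullet> truncated_force h Y n s) s"
  unfolding truncated_force_inner by (rule isCont_step_function)

lemma continuous_on_convolution:
  assumes "\<And>i. i \<in> I \<Longrightarrow> set_integrable lborel {0..T} (\<lambda>s. i \<bullet> f s)"
  shows "continuous_on {0..T} (convolution I f)"
proof -
  have "continuous_on {0..T} (\<lambda>t. \<Sum>i\<in>I. duhamel (- \<mu> i) (\<lambda>s. i \<bullet> f s) t *\<^sub>R i)"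
    by (intro continuous_on_sum continuous_on_scaleR continuous_on_duhamel assms continuous_on_const)
  then show ?thesis by (simp add: convolution_def[abs_def])
qed

lemma truncated_force_const:
  "grid_floor h u = grid_floor h s \<Longrightarrow> truncated_force h Y n u = truncated_force h Y n s"
  by (simp add: truncated_force_def)

text \<open>Over a part of a grid cell the force is constant, so the increment of the convolution is
  \<open>(exp (r A) - 1)\<close> applied to the value at the grid point plus \<open>A\<^sup>-\<^sup>1 (exp (r A) - 1)\<close> applied to the
  force. Trading spatial for temporal regularity gives the two powers of \<open>r\<close>.\<close>

lemma convolution_increment:
  fixes n Y :: "real \<Rightarrow> 'h"
  assumes h: "0 < h" and I: "finite I" "I \<subseteq> B" and s: "s \<in> {0..T}"
  defines "f \<equiv> truncated_force h Y n" and "t0 \<equiv> grid_floor h s"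
  shows "convolution I f s - convolution I f t0 \<in> interp_space B \<mu> \<rho>"
    and "interp_norm B \<mu> \<rho> (convolution I f s - convolution I f t0)
      \<le> (s - t0) powr (\<gamma> - \<rho>) * interp_norm B \<mu> \<gamma> (convolution I f t0) + (s - t0) powr (1 - \<rho>) * norm (f s)"
proof -
  define r where "r = s - t0"
  have t0: "0 \<le> t0" "t0 \<le> s" "s < t0 + h" using grid_floor_bounds[OF h, of s] s by (auto simp: t0_def)
  have r: "0 \<le> r" using t0 by (simp add: r_def)
  have const: "i \<bullet> f u = i \<bullet> f s" if "u \<in> {t0..s}" for i u
  proof -
    have "\<lfloor>u / h\<rfloor> = \<lfloor>s / h\<rfloor>"
      using that t0 h unfolding t0_def grid_floor_eq[OF h] by (intro floor_unique) (auto simp: field_simps)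
    then have "f u = f s" unfolding f_def by (intro truncated_force_const) (simp add: grid_floor_eq[OF h])
    then show ?thesis by simp
  qed
  define w1 where "w1 = (\<Sum>i\<in>I. ((exp (\<mu> i * r) - 1) * (i \<bullet> convolution I f t0)) *\<^sub>R i)"
  define w2 where "w2 = (\<Sum>i\<in>I. ((1 - exp (\<mu> i * r)) / (- \<mu> i) * (i \<bullet> f s)) *\<^sub>R i)"
  have split: "convolution I f s - convolution I f t0 = w1 + w2"
  proof (rule eq_if_inner_basis_eq)
    fix i assume i: "i \<in> B"
    have "duhamel (- \<mu> i) (\<lambda>u. i \<bullet> f u) s = exp (\<mu> i * r) * duhamel (- \<mu> i) (\<lambda>u. i \<bullet> f u) t0
        + (LINT u:{t0..s}|lborel. exp (- (- \<mu> i * (s - u))) * (i \<bullet> f u))"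
      using duhamel_split[OF truncated_force_set_integrable[OF h], of t0 s "- \<mu> i" i Y n] t0 s
      by (simp add: f_def r_def)
    also have "(LINT u:{t0..s}|lborel. exp (- (- \<mu> i * (s - u))) * (i \<bullet> f u))
        = (LINT u:{t0..s}|lborel. exp (- (- \<mu> i * (s - u))) * (i \<bullet> f s))"
    proof (rule set_lebesgue_integral_cong)
      show "\<forall>u. u \<in> {t0..s} \<longrightarrow> exp (- (- \<mu> i * (s - u))) * (i \<bullet> f u) = exp (- (- \<mu> i * (s - u))) * (i \<bullet> f s)"
        using const by metis
    qed simp
    also have "\<dots> = (1 - exp (\<mu> i * r)) / (- \<mu> i) * (i \<bullet> f s)"
      using interval_integral_exp[OF eigenvalue_pos[OF i] t0(2)] by (simp add: r_def)
    finally have duh: "duhamel (- \<mu> i) (\<lambda>u. i \<bullet> f u) s = exp (\<mu> i * r) * duhamel (- \<mu> i) (\<lambda>u. i \<bullet> f u) t0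
        + (1 - exp (\<mu> i * r)) / (- \<mu> i) * (i \<bullet> f s)" .
    have "i \<bullet> w1 = (if i \<in> I then (exp (\<mu> i * r) - 1) * (i \<bullet> convolution I f t0) else 0)"
      "i \<bullet> w2 = (if i \<in> I then (1 - exp (\<mu> i * r)) / (- \<mu> i) * (i \<bullet> f s) else 0)"
      unfolding w1_def w2_def using I i by (simp_all only: inner_basis_sum)
    then show "i \<bullet> (convolution I f s - convolution I f t0) = i \<bullet> (w1 + w2)"
      using duh inner_convolution[OF I i, of f] by (simp add: inner_diff_right inner_add_right left_diff_distrib)
  qed
  have w1: "w1 \<in> interp_space B \<mu> \<rho>" "interp_norm B \<mu> \<rho> w1 \<le> r powr (\<gamma> - \<rho>) * interp_norm B \<mu> \<gamma> (convolution I f t0)"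
  proof -
    have mem: "convolution I f t0 \<in> interp_space B \<mu> \<gamma>"
      using I interp_space_span_proj[of I "convolution I f t0"] by simp
    have le: "\<bar>(- \<mu> i) powr \<rho> * (i \<bullet> w1)\<bar> \<le> r powr (\<gamma> - \<rho>) * \<bar>(- \<mu> i) powr \<gamma> * (i \<bullet> convolution I f t0)\<bar>"
      if i: "i \<in> B" for i
    proof (cases "i \<in> I")
      case True
      have "\<bar>exp (\<mu> i * r) - 1\<bar> = 1 - exp (- (- \<mu> i * r))"
        using eigenvalue_pos[OF i] r by (simp add: mult_nonpos_nonneg)
      also have "\<dots> \<le> (- \<mu> i * r) powr (\<gamma> - \<rho>)"
        using eigenvalue_pos[OF i] r gamma rho by (intro one_minus_exp_le_powr) (auto intro: mult_nonpos_nonneg)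
      also have "\<dots> = r powr (\<gamma> - \<rho>) * (- \<mu> i) powr (\<gamma> - \<rho>)"
        using eigenvalue_pos[OF i] r powr_mult[of "- \<mu> i" r] by (simp add: mult.commute)
      finally have "(- \<mu> i) powr \<rho> * \<bar>exp (\<mu> i * r) - 1\<bar> \<le> (- \<mu> i) powr \<rho> * (r powr (\<gamma> - \<rho>) * (- \<mu> i) powr (\<gamma> - \<rho>))"
        by (intro mult_left_mono) auto
      also have "\<dots> = r powr (\<gamma> - \<rho>) * (- \<mu> i) powr \<gamma>"
        by (simp add: powr_add[symmetric] mult.left_commute)
      finally have "(- \<mu> i) powr \<rho> * \<bar>exp (\<mu> i * r) - 1\<bar> * \<bar>i \<bullet> convolution I f t0\<bar>
          \<le> r powr (\<gamma> - \<rho>) * (- \<mu> i) powr \<gamma> * \<bar>i \<bullet> convolution I f t0\<bar>"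
        by (intro mult_right_mono) auto
      then show ?thesis using True I i by (simp add: w1_def inner_basis_sum abs_mult mult.assoc)
    qed (use I i in \<open>simp add: w1_def inner_basis_sum\<close>)
    show "w1 \<in> interp_space B \<mu> \<rho>" "interp_norm B \<mu> \<rho> w1 \<le> r powr (\<gamma> - \<rho>) * interp_norm B \<mu> \<gamma> (convolution I f t0)"
      using interp_space_comparison[OF mem _ le] by auto
  qed
  have w2: "w2 \<in> interp_space B \<mu> \<rho>" "interp_norm B \<mu> \<rho> w2 \<le> r powr (1 - \<rho>) * norm (f s)"
  proof -
    have le: "\<bar>(- \<mu> i) powr \<rho> * (i \<bullet> w2)\<bar> \<le> r powr (1 - \<rho>) * \<bar>(- \<mu> i) powr 0 * (i \<bullet> f s)\<bar>" if i: "i \<in> B" for i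
    proof (cases "i \<in> I")
      case True
      have pos: "0 < - \<mu> i" using eigenvalue_pos[OF i] .
      have "\<bar>(1 - exp (\<mu> i * r)) / (- \<mu> i)\<bar> = (1 - exp (- (- \<mu> i * r))) / (- \<mu> i)"
        using pos r by (simp add: abs_divide mult_nonpos_nonneg)
      also have "\<dots> \<le> (- \<mu> i * r) powr (1 - \<rho>) / (- \<mu> i)"
        using pos r rho by (intro divide_right_mono one_minus_exp_le_powr) (auto intro: mult_nonpos_nonneg)
      also have "\<dots> = r powr (1 - \<rho>) * (- \<mu> i) powr (- \<rho>)"
        using pos r powr_mult[of "- \<mu> i" r "1 - \<rho>"] powr_diff[of "- \<mu> i" 1 \<rho>]
        by (simp add: powr_minus field_simps)
      finally have "(- \<mu> i) powr \<rho> * \<bar>(1 - exp (\<mu> i * r)) / (- \<mu> i)\<bar>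
          \<le> (- \<mu> i) powr \<rho> * (r powr (1 - \<rho>) * (- \<mu> i) powr (- \<rho>))"
        by (intro mult_left_mono) auto
      also have "\<dots> = r powr (1 - \<rho>)" using pos by (simp add: powr_minus)
      finally have "(- \<mu> i) powr \<rho> * \<bar>(1 - exp (\<mu> i * r)) / (- \<mu> i)\<bar> * \<bar>i \<bullet> f s\<bar> \<le> r powr (1 - \<rho>) * \<bar>i \<bullet> f s\<bar>"
        by (intro mult_right_mono) auto
      moreover have "i \<bullet> w2 = (1 - exp (\<mu> i * r)) / (- \<mu> i) * (i \<bullet> f s)"
        unfolding w2_def using True I i by (simp only: inner_basis_sum if_True)
      moreover have "(- \<mu> i) powr 0 = 1" using pos by simp
      ultimately show ?thesis
        by (simp only: abs_mult abs_of_nonneg[OF powr_ge_zero] mult.assoc mult_1_left abs_one)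
    next
      case False
      then have "i \<bullet> w2 = 0" unfolding w2_def using I i by (simp only: inner_basis_sum if_False)
      then show ?thesis by simp
    qed
    show "w2 \<in> interp_space B \<mu> \<rho>" "interp_norm B \<mu> \<rho> w2 \<le> r powr (1 - \<rho>) * norm (f s)"
      using interp_space_comparison[OF _ _ le] by (auto simp: interp_norm_0)
  qed
  show "convolution I f s - convolution I f t0 \<in> interp_space B \<mu> \<rho>"
    unfolding split by (intro subspace_add[OF interp_space_subspace] w1 w2)
  show "interp_norm B \<mu> \<rho> (convolution I f s - convolution I f t0)
      \<le> (s - t0) powr (\<gamma> - \<rho>) * interp_norm B \<mu> \<gamma> (convolution I f t0) + (s - t0) powr (1 - \<rho>) * norm (f s)"
    unfolding split using norm_on_triangle[OF norm_on_interp_space w1(1) w2(1)] w1(2) w2(2)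
    by (simp add: r_def)
qed

section \<open>Consistency under the truncation\<close>

text \<open>By the conditions on \<open>chi\<close>, a nonnegative power of the step size is left over from each of the two
  terms of \<open>convolution_increment\<close>; it is bounded by the same power of \<open>T\<close>.\<close>

definition increment_const :: real where
  "increment_const = cV * (T powr (\<gamma> - \<rho> - chi * (1 + varphi/2))
     + growth_const * (T powr chi + cG) powr (1 + varphi/2) * T powr (1 - \<rho> - chi * (1 + varphi)))"

lemma increment_const_nonneg: "0 \<le> increment_const"
  unfolding increment_const_def using cV_pos growth_const_pos
  by (intro mult_nonneg_nonneg add_nonneg_nonneg) auto

text \<open>The Lipschitz estimate across a grid cell, after the powers \<open>varphi/2\<close> and \<open>- varphi/2\<close> of
  \<open>h powr (- chi)\<close> have cancelled. Factors \<open>T powr chi\<close> arise from \<open>1 \<le> T powr chi * h powr (- chi)\<close>.\<close>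

definition consistency_const :: real where
  "consistency_const = sqrt c * increment_const * (T powr (chi * varphi/2)
     + (cG + increment_const * T powr (chi * varphi/2) * T powr chi) powr (varphi/2) + cG powr (varphi/2))"

context
  fixes h :: real and I :: "'h set" and n Y :: "real \<Rightarrow> 'h"
  assumes path: "scheme_path h I n Y"
begin

lemma path_h: "0 < h" "h \<le> T" and path_I: "finite I" "I \<subseteq> B"
  and path_noise: "t \<in> {0..T} \<Longrightarrow> span_proj I (n t) = n t"
  and path_grid: "t \<in> {0..T} \<Longrightarrow>
    Y (grid_floor h t) = convolution I (truncated_force h Y n) (grid_floor h t) + n (grid_floor h t)"
  using path by (auto simp: scheme_path_def)

lemma path_floor: "t \<in> {0..T} \<Longrightarrow> grid_floor h t \<in> {0..T}"
  using grid_floor_bounds[OF path_h(1), of t] by auto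

lemma path_grid_span: "t \<in> {0..T} \<Longrightarrow> span_proj I (Y (grid_floor h t)) = Y (grid_floor h t)"
  using path_I path_noise[OF path_floor] by (simp add: path_grid span_proj_add)

text \<open>Under the truncation both the grid value and the force are bounded by powers of
  \<open>h powr (- chi)\<close>, and the two conditions on \<open>chi\<close> are what makes the increment over one cell small
  enough to absorb the growth \<open>varphi/2\<close> of the local Lipschitz constant.\<close>

lemma truncated_increment:
  assumes s: "s \<in> {0..T}"
    and trunc: "interp_norm B \<mu> \<gamma> (Y (grid_floor h s)) + interp_norm B \<mu> \<gamma> (n (grid_floor h s)) \<le> h powr (- chi)"
  defines "N \<equiv> convolution I (truncated_force h Y n)" and "t0 \<equiv> grid_floor h s"
  shows "normV (Y t0) \<le> cG * h powr (- chi)"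
    and "normV (N s - N t0) \<le> increment_const * (h powr (- chi)) powr (- (varphi/2))"
proof -
  define H where "H = h powr (- chi)"
  have h: "0 < h" "h \<le> T" using path_h by auto
  have H: "0 < H" using h by (simp add: H_def)
  have one: "1 \<le> T powr chi * H"
    using h T_pos chi powr_mono2[of chi h T] by (simp add: H_def powr_minus field_simps)
  have t0: "t0 \<in> {0..T}" "0 \<le> s - t0" "s - t0 \<le> h"
    using path_floor[OF s] grid_floor_bounds[OF h(1), of s] by (auto simp: t0_def)
  have mem: "N t \<in> interp_space B \<mu> r" "Y t0 \<in> interp_space B \<mu> r" "n t0 \<in> interp_space B \<mu> r" for t r
    using path_I path_grid_span[OF s, folded t0_def] path_noise[OF t0(1)] span_proj_convolution[folded N_def]
    by (metis interp_space_span_proj N_def span_proj_convolution)+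
  have Y_le: "interp_norm B \<mu> \<gamma> (Y t0) \<le> H"
    using trunc interp_norm_nonneg[of \<gamma> "n (grid_floor h s)"] unfolding H_def t0_def by linarith
  have "N t0 = Y t0 - n t0" using path_grid[OF s] by (simp add: N_def t0_def)
  then have N_le: "interp_norm B \<mu> \<gamma> (N t0) \<le> H"
    using norm_on_triangle[OF norm_on_interp_space mem(2) subspace_neg[OF interp_space_subspace mem(3)], of \<gamma>]
      norm_on_scale[OF norm_on_interp_space mem(3), of \<gamma> "-1"] trunc by (simp add: H_def t0_def)
  have YV: "normV (Y t0) \<le> cG * H"
  proof -
    have "normV (Y t0) \<le> cG * interp_norm B \<mu> \<gamma> (Y t0)"
      using interp_space_gamma(2)[OF mem(2)] by (simp add: cG_def)
    also have "\<dots> \<le> cG * H" using Y_le cG_pos by (intro mult_left_mono) auto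
    finally show ?thesis .
  qed
  then show "normV (Y t0) \<le> cG * h powr (- chi)" by (simp add: H_def)
  have Yt0: "Y t0 \<in> V" using interp_space_gamma(1)[OF mem(2)] .
  let ?a = "1 + varphi/2"
  have a: "0 \<le> ?a" using varphi_pos by simp
  have force: "norm (truncated_force h Y n s) \<le> growth_const * ((T powr chi + cG) powr ?a * H powr ?a)"
  proof -
    have "norm (truncated_force h Y n s) \<le> norm (F (Y t0))" by (simp add: truncated_force_def t0_def)
    also have "\<dots> \<le> growth_const * (1 + normV (Y t0)) powr ?a" by (rule F_growth[OF Yt0])
    also have "\<dots> \<le> growth_const * ((T powr chi + cG) * H) powr ?a"
      using YV one a growth_const_pos normV_nonneg[OF Yt0]
      by (intro mult_left_mono powr_mono2) (auto simp: distrib_right)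
    also have "\<dots> = growth_const * ((T powr chi + cG) powr ?a * H powr ?a)"
      using H cG_pos by (simp add: powr_mult)
    finally show ?thesis .
  qed
  have e1: "h powr (\<gamma> - \<rho>) * H \<le> T powr (\<gamma> - \<rho> - chi * (1 + varphi/2)) * H powr (- (varphi/2))"
  proof -
    have "h powr (\<gamma> - \<rho>) * H = h powr (\<gamma> - \<rho> - chi * (1 + varphi/2)) * H powr (- (varphi/2))"
      by (simp add: H_def powr_powr powr_add[symmetric] algebra_simps)
    also have "\<dots> \<le> T powr (\<gamma> - \<rho> - chi * (1 + varphi/2)) * H powr (- (varphi/2))"
      using h chi varphi_pos by (intro mult_right_mono powr_mono2) (auto simp: field_simps)
    finally show ?thesis .
  qed
  have e2: "h powr (1 - \<rho>) * H powr ?a \<le> T powr (1 - \<rho> - chi * (1 + varphi)) * H powr (- (varphi/2))"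
  proof -
    have "h powr (1 - \<rho>) * H powr ?a = h powr (1 - \<rho> - chi * (1 + varphi)) * H powr (- (varphi/2))"
      by (simp add: H_def powr_powr powr_add[symmetric] algebra_simps)
    also have "\<dots> \<le> T powr (1 - \<rho> - chi * (1 + varphi)) * H powr (- (varphi/2))"
      using h chi varphi_pos by (intro mult_right_mono powr_mono2) (auto simp: field_simps)
    finally show ?thesis .
  qed
  have "normV (N s - N t0) \<le> cV * interp_norm B \<mu> \<rho> (N s - N t0)"
    using convolution_increment(1)[OF h(1) path_I s] unfolding N_def t0_def by (rule normV_le)
  also have "\<dots> \<le> cV * ((s - t0) powr (\<gamma> - \<rho>) * interp_norm B \<mu> \<gamma> (N t0)
      + (s - t0) powr (1 - \<rho>) * norm (truncated_force h Y n s))"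
    using convolution_increment(2)[OF h(1) path_I s] cV_pos unfolding N_def t0_def by (intro mult_left_mono) auto
  also have "\<dots> \<le> cV * (h powr (\<gamma> - \<rho>) * H + h powr (1 - \<rho>) * (growth_const * ((T powr chi + cG) powr ?a * H powr ?a)))"
    using t0 gamma rho N_le force cV_pos by (intro mult_left_mono add_mono mult_mono powr_mono2) auto
  also have "\<dots> = cV * (h powr (\<gamma> - \<rho>) * H + growth_const * (T powr chi + cG) powr ?a * (h powr (1 - \<rho>) * H powr ?a))"
    by (simp add: algebra_simps)
  also have "\<dots> \<le> cV * (T powr (\<gamma> - \<rho> - chi * (1 + varphi/2)) * H powr (- (varphi/2))
      + growth_const * (T powr chi + cG) powr ?a * (T powr (1 - \<rho> - chi * (1 + varphi)) * H powr (- (varphi/2))))"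
    using cV_pos growth_const_pos by (intro mult_left_mono add_mono e1 e2) auto
  also have "\<dots> = increment_const * H powr (- (varphi/2))"
    by (simp add: increment_const_def algebra_simps)
  finally show "normV (N s - N t0) \<le> increment_const * (h powr (- chi)) powr (- (varphi/2))" by (simp add: H_def)
qed

text \<open>The increment of the drift is at most a multiple of \<open>H powr (- (varphi/2))\<close>, \<open>H = h powr (- chi)\<close>, and
  both arguments of \<open>F\<close> are at most multiples of \<open>H\<close>, so the Lipschitz constant between them is at
  most a multiple of \<open>H powr (varphi/2)\<close>.\<close>

lemma truncated_consistency:
  assumes s: "s \<in> {0..T}"
    and trunc: "interp_norm B \<mu> \<gamma> (Y (grid_floor h s)) + interp_norm B \<mu> \<gamma> (n (grid_floor h s)) \<le> h powr (- chi)"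
  shows "norm (F (Y (grid_floor h s)) - F (convolution I (truncated_force h Y n) s + n (grid_floor h s))) \<le> consistency_const"
proof -
  define N where "N = convolution I (truncated_force h Y n)"
  define t0 where "t0 = grid_floor h s"
  define H where "H = h powr (- chi)"
  define E where "E = T powr (chi * varphi/2)"
  have h: "0 < h" "h \<le> T" using path_h by auto
  have H: "0 < H" using h by (simp add: H_def)
  have one: "1 \<le> T powr chi * H"
    using h T_pos chi powr_mono2[of chi h T] by (simp add: H_def powr_minus field_simps)
  have oneE: "1 \<le> E * H powr (varphi/2)"
  proof -
    have "1 \<le> (T powr chi * H) powr (varphi/2)" using one varphi_pos by (intro ge_one_powr_ge_zero) auto
    also have "\<dots> = E * H powr (varphi/2)" using H by (simp add: E_def powr_mult powr_powr)
    finally show ?thesis .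
  qed
  have t0: "t0 \<in> {0..T}" using path_floor[OF s] by (simp add: t0_def)
  note trI = truncated_increment[OF s trunc, folded N_def t0_def H_def]
  have Y0: "Y t0 = N t0 + n t0" using path_grid[OF s] by (simp add: N_def t0_def)
  have mem: "N s \<in> V" "N t0 \<in> V" "n t0 \<in> V"
    using path_I V_span_proj[of I "N s"] V_span_proj[of I "N t0"] V_span_proj[of I "n t0"] path_noise[OF t0]
    by (simp_all add: N_def)
  then have mem': "Y t0 \<in> V" "N s + n t0 \<in> V" by (simp_all add: Y0 V_add)
  have diff: "Y t0 - (N s + n t0) = - (N s - N t0)" by (simp add: Y0)
  have nd: "normV (Y t0 - (N s + n t0)) = normV (N s - N t0)"
    unfolding diff using norm_on_scale[OF V V_diff[OF mem(1,2)], of "-1"] by simp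
  have Hm: "H powr (- (varphi/2)) \<le> E"
    using oneE H by (simp add: powr_minus field_simps)
  have NV: "normV (N s + n t0) \<le> (cG + increment_const * E * T powr chi) * H"
  proof -
    have "normV (N s + n t0) \<le> normV (Y t0) + normV (N s + n t0 - Y t0)"
      using normV_triangle_diff mem' by blast
    also have "normV (N s + n t0 - Y t0) = normV (N s - N t0)"
      using nd normV_minus_commute[OF mem'(1) mem'(2)] by simp
    also have "\<dots> \<le> increment_const * E"
      using trI(2) Hm increment_const_nonneg by (meson order_trans mult_left_mono)
    also have "\<dots> \<le> increment_const * E * (T powr chi * H)"
      using mult_left_mono[OF one, of "increment_const * E"] increment_const_nonneg by (simp add: E_def)
    finally show ?thesis using trI(1) by (simp add: distrib_right mult.assoc)
  qed
  have "norm (F (Y t0) - F (N s + n t0)) \<le> sqrt c * normV (Y t0 - (N s + n t0)) *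
      (1 + normV (Y t0) powr (varphi/2) + normV (N s + n t0) powr (varphi/2))"
    by (rule local_lipschitz_V[OF mem'])
  also have "\<dots> \<le> sqrt c * (increment_const * H powr (- (varphi/2))) *
      (E * H powr (varphi/2) + (cG * H) powr (varphi/2) + ((cG + increment_const * E * T powr chi) * H) powr (varphi/2))"
    unfolding nd using trI c_pos varphi_pos oneE NV increment_const_nonneg normV_nonneg mem' V_diff[OF mem(1,2)]
    by (intro mult_mono add_mono powr_mono2) auto
  also have "\<dots> = sqrt c * increment_const * (H powr (- (varphi/2)) * H powr (varphi/2)) *
      (E + cG powr (varphi/2) + (cG + increment_const * E * T powr chi) powr (varphi/2))"
  proof -
    define X where "X = cG + increment_const * E * T powr chi"
    have "0 \<le> X" using cG_pos increment_const_nonneg by (simp add: X_def E_def)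
    then show ?thesis
      unfolding X_def[symmetric] using H cG_pos by (simp add: powr_mult algebra_simps)
  qed
  also have "H powr (- (varphi/2)) * H powr (varphi/2) = 1" using H by (simp add: powr_add[symmetric])
  finally show ?thesis by (simp add: consistency_const_def N_def t0_def E_def algebra_simps)
qed

end

section \<open>The a priori bound\<close>

text \<open>The Gronwall factor times the integral of the inhomogeneity, divided by \<open>1 + \<Phi> + \<phi>\<close>.\<close>

definition energy_const :: real where
  "energy_const = exp ((2 * c + 1) * T) * (T * (2 + (1 / (2 * (1 - \<epsilon>)) + 1) * consistency_const\<^sup>2))"

lemma energy_const_pos: "0 < energy_const"
proof -
  have "0 \<le> (1 / (2 * (1 - \<epsilon>)) + 1) * consistency_const\<^sup>2" using eps by simp
  then show ?thesis using T_pos by (simp add: energy_const_def add_pos_nonneg)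
qed

text \<open>The energy \<open>\<parallel>N\<parallel>\<^sub>1\<^sub>/\<^sub>2\<^sup>2 + \<phi> \<parallel>N\<parallel>\<^sup>2\<close> of \<open>N = Y - n\<close> is a Lyapunov function. Coercivity is applied with the
  noise frozen at the last grid point, so that the error made is the one of \<open>truncated_consistency\<close>,
  in which no increment of the noise occurs; Young's inequality pays for it with the remaining
  \<open>(1 - \<epsilon>) \<parallel>N\<parallel>\<^sub>1\<^sup>2\<close> of dissipation.\<close>

lemma a_priori_bound:
  assumes path: "scheme_path h I n Y"
    and x: "restrict n {0..T} \<in> mspace (path_metric T (interp_metric B \<mu> 1))" and t: "t \<in> {0..T}"
  shows "(interp_norm B \<mu> (1/2) (convolution I (truncated_force h Y n) t))\<^sup>2
    \<le> energy_const * (1 + \<Phi> (restrict n {0..T}) + \<phi> (restrict n {0..T}))"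
proof -
  define x where "x = restrict n {0..T}"
  define f where "f = truncated_force h Y n"
  define N where "N = convolution I f"
  define \<nu> where "\<nu> i = - \<mu> i" for i
  define d where "d i = duhamel (\<nu> i) (\<lambda>s. i \<bullet> f s)" for i
  \<comment> \<open>The energy and its derivative off the grid.\<close>
  define W where "W s = (\<Sum>i\<in>I. (\<nu> i + \<phi> x) * (d i s)\<^sup>2)" for s
  define W' where "W' s = (\<Sum>i\<in>I. (\<nu> i + \<phi> x) * (2 * d i s * (- \<nu> i * d i s + i \<bullet> f s)))" for s
  define b where "b = 2 * \<Phi> x + (1 / (2 * (1 - \<epsilon>)) + \<phi> x) * consistency_const\<^sup>2"
  have h: "0 < h" and I: "finite I" "I \<subseteq> B" using path_h[OF path] path_I[OF path] by auto
  have phi: "0 \<le> \<phi> x" "0 \<le> \<Phi> x" using phi_nonneg[OF assms(2)] Phi_nonneg[OF assms(2)] by (auto simp: x_def)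
  have nu: "0 < \<nu> i" if "i \<in> I" for i using eigenvalue_pos I that by (auto simp: \<nu>_def)
  have b: "0 \<le> b" using phi eps by (simp add: b_def)
  have inner_N: "i \<bullet> N s = d i s" if "i \<in> I" for i s
    using inner_convolution[OF I, of i f s] that I by (auto simp: N_def d_def \<nu>_def)
  have N_sum: "N s = (\<Sum>i\<in>I. d i s *\<^sub>R i)" for s
    by (simp add: N_def convolution_def d_def \<nu>_def)
  have PN: "span_proj I (N s) = N s" for s using I by (simp add: N_def)
  have "W t \<le> exp ((2 * c + 1) * T) * (\<bar>W 0\<bar> + (LINT s:{0..T}|lborel. b))"
  proof (rule differential_inequality[where W'=W' and S="grid_floor h ` {0..T}"])
    show "continuous_on {0..T} W"
      unfolding W_def[abs_def] d_def[abs_def] f_def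
      by (intro continuous_intros continuous_on_duhamel truncated_force_set_integrable h)
    show "finite (grid_floor h ` {0..T})" by (rule finite_grid[OF h])
    fix s assume s': "s \<in> {0<..<T} - grid_floor h ` {0..T}"
    then have s: "s \<in> {0..T}" "s \<in> {0<..<T}" by auto
    have ngrid: "grid_floor h s \<noteq> s" using s' s(1) by (metis DiffD2 imageI)
    have "(d i has_real_derivative (- \<nu> i * d i s + i \<bullet> f s)) (at s)" for i
      unfolding d_def f_def
      by (rule duhamel_has_derivative[OF truncated_force_set_integrable[OF h] s(2) isCont_truncated_force[OF h ngrid]])
    then show "(W has_real_derivative W' s) (at s)"
      unfolding W_def W'_def
      by (auto intro!: derivative_eq_intros DERIV_sum sum.cong simp: algebra_simps)
    show "W' s \<le> (2 * c + 1) * W s + b"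
    proof (cases "interp_norm B \<mu> \<gamma> (Y (grid_floor h s)) + interp_norm B \<mu> \<gamma> (n (grid_floor h s)) \<le> h powr (- chi)")
      case False
      \<comment> \<open>Without a force the energy decays.\<close>
      then have "f s = 0" by (simp add: f_def truncated_force_def)
      have "W' s \<le> 0"
        unfolding W'_def
      proof (rule sum_nonpos)
        fix i assume i: "i \<in> I"
        have "(\<nu> i + \<phi> x) * (2 * d i s * (- \<nu> i * d i s + i \<bullet> f s)) = - ((\<nu> i + \<phi> x) * (2 * \<nu> i * (d i s)\<^sup>2))"
          by (simp add: \<open>f s = 0\<close> power2_eq_square)
        also have "\<dots> \<le> 0" using nu[OF i] phi by simp
        finally show "(\<nu> i + \<phi> x) * (2 * d i s * (- \<nu> i * d i s + i \<bullet> f s)) \<le> 0" .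
      qed
      moreover have "0 \<le> W s" unfolding W_def using nu phi by (intro sum_nonneg mult_nonneg_nonneg) (auto simp: less_imp_le)
      then have "0 \<le> (2 * c + 1) * W s" using c_pos by (intro mult_nonneg_nonneg) auto
      ultimately show ?thesis using b by linarith
    next
      case True
      define t0 where "t0 = grid_floor h s"
      define f' where "f' = F (N s + n t0)"
      have f: "f s = F (Y t0)" using True by (simp add: f_def truncated_force_def t0_def)
      have t0: "t0 \<in> {0..T}" using path_floor[OF path s(1)] by (simp add: t0_def)
      define e where "e i = i \<bullet> (f s - f')" for i
      have cons: "norm (f s - f') \<le> consistency_const"
        using truncated_consistency[OF path s(1) True]
        by (subst f) (simp add: f'_def t0_def N_def f_def)
      have "(\<Sum>i\<in>I. (e i)\<^sup>2) \<le> (norm (f s - f'))\<^sup>2" unfolding e_def by (rule Bessel_inequality[OF I])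
      also have "\<dots> \<le> consistency_const\<^sup>2" using cons by (intro power_mono) auto
      finally have e_le: "(\<Sum>i\<in>I. (e i)\<^sup>2) \<le> consistency_const\<^sup>2" .
      \<comment> \<open>In coordinates: \<open>S1\<close>, \<open>S2\<close>, \<open>S3\<close> are the squares of the norms of \<open>N\<close> in \<open>H\<^sub>1\<close>, \<open>H\<^sub>1\<^sub>/\<^sub>2\<close> and \<open>H\<close>; \<open>Q\<close> and
        \<open>R\<close> are the pairings of \<open>N\<close> with the replaced force that occur in the coercivity condition.\<close>
      define S1 where "S1 = (\<Sum>i\<in>I. (\<nu> i * d i s)\<^sup>2)"
      define S2 where "S2 = (\<Sum>i\<in>I. \<nu> i * (d i s)\<^sup>2)"
      define S3 where "S3 = (\<Sum>i\<in>I. (d i s)\<^sup>2)"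
      define Q where "Q = (\<Sum>i\<in>I. \<nu> i * d i s * (i \<bullet> f'))"
      define R where "R = (\<Sum>i\<in>I. d i s * (i \<bullet> f'))"
      define U where "U = (\<Sum>i\<in>I. (e i)\<^sup>2)"
      have sq: "((\<nu> i) powr (1/2))\<^sup>2 = \<nu> i" if "i \<in> I" for i
        using nu[OF that] by (simp add: power2_eq_square powr_add[symmetric])
      have n1: "(interp_norm B \<mu> 1 (N s))\<^sup>2 = S1"
        using interp_norm_span_proj[OF I, of 1 "N s"] nu unfolding PN S1_def
        by (simp add: inner_N less_imp_le flip: \<nu>_def cong: sum.cong)
      have n2: "(interp_norm B \<mu> (1/2) (N s))\<^sup>2 = S2"
        using interp_norm_span_proj[OF I, of "1/2" "N s"] unfolding PN S2_def
        by (simp add: inner_N power_mult_distrib sq flip: \<nu>_def cong: sum.cong)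
      have n3: "(norm (N s))\<^sup>2 = S3"
        using norm_span_proj_sq[OF I, of "N s"] unfolding PN S3_def by (simp add: inner_N cong: sum.cong)
      have q: "interp_inner B \<mu> (1/2) (N s) (span_proj I f') = Q"
        using interp_inner_span_proj[OF I, of "1/2" "N s" f'] unfolding PN Q_def
        by (simp add: inner_N sq mult.assoc flip: \<nu>_def cong: sum.cong)
      have r: "N s \<bullet> f' = R"
        unfolding N_sum R_def by (simp add: inner_sum_left)
      have "ereal (interp_inner B \<mu> (1/2) (N s) (span_proj I (F (N s + x t0))) + \<phi> x * (N s \<bullet> F (N s + x t0)))
        \<le> (SUP t\<in>{0..T}. ereal (interp_inner B \<mu> (1/2) (N s) (span_proj I (F (N s + x t))) + \<phi> x * (N s \<bullet> F (N s + x t))))"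
        using t0 by (rule SUP_upper)
      also have "\<dots> \<le> ereal (\<epsilon> * (interp_norm B \<mu> 1 (N s))\<^sup>2 + (c + \<phi> x) * (interp_norm B \<mu> (1/2) (N s))\<^sup>2
               + c * \<phi> x * (norm (N s))\<^sup>2 + \<Phi> x)"
        using I PN assms(2)[folded x_def] by (intro coercive[of I]) (auto simp: Fpow_def range_span_proj_iff)
      finally have coer: "Q + \<phi> x * R \<le> \<epsilon> * S1 + (c + \<phi> x) * S2 + c * \<phi> x * S3 + \<Phi> x"
        using t0 by (simp add: n1 n2 n3 q[unfolded f'_def] r[unfolded f'_def] x_def)
      \<comment> \<open>The weight \<open>1 - \<epsilon>\<close> is the share of the dissipation that coercivity leaves.\<close>
      have young1: "(\<Sum>i\<in>I. \<nu> i * d i s * e i) \<le> (1 - \<epsilon>) * S1 + 1 / (4 * (1 - \<epsilon>)) * U"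
        unfolding S1_def U_def sum_distrib_left sum.distrib[symmetric]
      proof (rule sum_mono)
        fix i
        define k where "k = 1 - \<epsilon>"
        have k: "0 < k" using eps by (simp add: k_def)
        have "0 \<le> (2 * k * (\<nu> i * d i s) - e i)\<^sup>2 / (4 * k)" using k by simp
        also have "\<dots> = k * (\<nu> i * d i s)\<^sup>2 + 1 / (4 * k) * (e i)\<^sup>2 - \<nu> i * d i s * e i"
          using k by (simp add: power2_eq_square field_simps)
        finally show "\<nu> i * d i s * e i \<le> (1 - \<epsilon>) * (\<nu> i * d i s)\<^sup>2 + 1 / (4 * (1 - \<epsilon>)) * (e i)\<^sup>2"
          by (simp add: k_def)
      qed
      have young2: "(\<Sum>i\<in>I. d i s * e i) \<le> 1/2 * S3 + 1/2 * U"
        unfolding S3_def U_def sum_distrib_left sum.distrib[symmetric]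
      proof (rule sum_mono)
        fix i
        have "0 \<le> (d i s - e i)\<^sup>2" by simp
        then show "d i s * e i \<le> 1/2 * (d i s)\<^sup>2 + 1/2 * (e i)\<^sup>2"
          by (simp add: power2_eq_square algebra_simps)
      qed
      have "W' s = (\<Sum>i\<in>I. 2 * (- (\<nu> i * d i s)\<^sup>2 - \<phi> x * (\<nu> i * (d i s)\<^sup>2) + (\<nu> i * d i s * (i \<bullet> f') + \<phi> x * (d i s * (i \<bullet> f')))
          + (\<nu> i * d i s * e i + \<phi> x * (d i s * e i))))"
        unfolding W'_def
        by (rule sum.cong) (simp_all add: e_def inner_diff_right power2_eq_square algebra_simps)
      also have "\<dots> = 2 * (- S1 - \<phi> x * S2 + (Q + \<phi> x * R)
          + ((\<Sum>i\<in>I. \<nu> i * d i s * e i) + \<phi> x * (\<Sum>i\<in>I. d i s * e i)))"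
        unfolding S1_def S2_def Q_def R_def
        by (simp add: sum.distrib sum_subtractf sum_negf sum_distrib_left[symmetric])
      also have "\<dots> \<le> 2 * (- S1 - \<phi> x * S2 + (\<epsilon> * S1 + (c + \<phi> x) * S2 + c * \<phi> x * S3 + \<Phi> x)
          + (((1 - \<epsilon>) * S1 + 1 / (4 * (1 - \<epsilon>)) * U) + \<phi> x * (1/2 * S3 + 1/2 * U)))"
        by (rule mult_left_mono[OF add_mono[OF add_left_mono[OF coer]
              add_mono[OF young1 mult_left_mono[OF young2 phi(1)]]]]) simp
      also have "\<dots> = 2 * c * S2 + (2 * c + 1) * \<phi> x * S3 + 2 * \<Phi> x + (1 / (2 * (1 - \<epsilon>)) + \<phi> x) * U"
        using eps by (simp add: field_simps)
      also have "\<dots> \<le> (2 * c + 1) * S2 + (2 * c + 1) * \<phi> x * S3 + 2 * \<Phi> x + (1 / (2 * (1 - \<epsilon>)) + \<phi> x) * consistency_const\<^sup>2"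
      proof -
        have "0 \<le> S2" unfolding S2_def using nu by (intro sum_nonneg mult_nonneg_nonneg) (auto simp: less_imp_le)
        then show ?thesis
          using phi eps e_le by (intro add_mono mult_right_mono mult_left_mono order_refl) (auto simp: U_def)
      qed
      also have "\<dots> = (2 * c + 1) * W s + b"
        unfolding W_def b_def S2_def S3_def by (simp add: distrib_right sum.distrib sum_distrib_left algebra_simps)
      finally show ?thesis .
    qed
  qed (use c_pos b t in \<open>auto simp: set_integrable_def\<close>)
  also have "W 0 = 0"
  proof -
    have "d i 0 = 0" for i by (simp add: d_def)
    then show ?thesis by (simp add: W_def)
  qed
  also have "(LINT s:{0..T}|lborel. b) = T * b" using T_pos by (simp add: set_lebesgue_integral_def)
  finally have Wt: "W t \<le> exp ((2 * c + 1) * T) * (T * b)" by simp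
  have "(interp_norm B \<mu> (1/2) (N t))\<^sup>2 = (\<Sum>i\<in>I. (\<nu> i powr (1/2) * d i t)\<^sup>2)"
    using interp_norm_span_proj[OF I, of "1/2" "N t"] unfolding PN
    by (simp add: inner_N flip: \<nu>_def cong: sum.cong)
  also have "\<dots> \<le> W t"
    unfolding W_def
  proof (rule sum_mono)
    fix i assume "i \<in> I"
    then have "(\<nu> i powr (1/2) * d i t)\<^sup>2 = \<nu> i * (d i t)\<^sup>2"
      using nu[of i] by (simp add: power_mult_distrib) (simp add: power2_eq_square powr_add[symmetric])
    then show "(\<nu> i powr (1/2) * d i t)\<^sup>2 \<le> (\<nu> i + \<phi> x) * (d i t)\<^sup>2"
      using phi by (simp add: distrib_right)
  qed
  also have "\<dots> \<le> exp ((2 * c + 1) * T) * (T * b)" by (rule Wt)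
  also have "\<dots> \<le> exp ((2 * c + 1) * T) * (T * ((2 + (1 / (2 * (1 - \<epsilon>)) + 1) * consistency_const\<^sup>2) * (1 + \<Phi> x + \<phi> x)))"
  proof (intro mult_left_mono)
    define C2 where "C2 = consistency_const\<^sup>2"
    define k where "k = 1 / (2 * (1 - \<epsilon>))"
    have "0 \<le> k" "0 \<le> C2" using eps by (auto simp: k_def C2_def)
    then have "0 \<le> k * C2 * (\<Phi> x + \<phi> x) + C2 * (1 + \<Phi> x) + 2 + 2 * \<phi> x" using phi by simp
    then have "2 * \<Phi> x + (k + \<phi> x) * C2 \<le> (2 + (k + 1) * C2) * (1 + \<Phi> x + \<phi> x)"
      by (simp add: algebra_simps)
    then show "b \<le> (2 + (1 / (2 * (1 - \<epsilon>)) + 1) * consistency_const\<^sup>2) * (1 + \<Phi> x + \<phi> x)"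
      by (simp add: b_def k_def C2_def)
  qed (use T_pos in auto)
  finally show ?thesis by (simp add: energy_const_def N_def f_def x_def mult.assoc)
qed

section \<open>The error of the drift along a path\<close>

text \<open>With \<open>v = P x\<close> and \<open>w = N + P o\<close> the difference \<open>v - w\<close> is the error \<open>D\<close> of the drift part, so the
  one-sided Lipschitz condition absorbs the unbounded operator, and only the defects
  \<open>F x - F v\<close> and \<open>F w - f\<close> feed the growth of \<open>norm D\<close>.\<close>

lemma pathwise_error:
  fixes x o\<^sub>0 :: "real \<Rightarrow> 'h"
  assumes path: "scheme_path h I n Y"
    and cont: "continuous_on {0..T} (\<lambda>s. F (x s))"
    and mild: "\<And>t i. t \<in> {0..T} \<Longrightarrow> i \<in> B \<Longrightarrow> i \<bullet> x t = duhamel (- \<mu> i) (\<lambda>s. i \<bullet> F (x s)) t + i \<bullet> o\<^sub>0 t"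
  defines "f \<equiv> truncated_force h Y n"
  defines "N \<equiv> convolution I f"
  defines "g \<equiv> \<lambda>s. norm (F (x s) - F (span_proj I (x s))) + norm (F (N s + span_proj I (o\<^sub>0 s)) - f s)"
  assumes g: "set_integrable lborel {0..T} (\<lambda>s. (g s)\<^sup>2)" and t: "t \<in> {0..T}"
  shows "(norm (span_proj I (x t) - span_proj I (o\<^sub>0 t) - N t))\<^sup>2 \<le> exp ((2 * c + 1) * T) * (LINT s:{0..T}|lborel. (g s)\<^sup>2)"
proof -
  have h: "0 < h" and I: "finite I" "I \<subseteq> B" using path_h[OF path] path_I[OF path] by auto
  define D where "D s = span_proj I (x s) - span_proj I (o\<^sub>0 s) - N s" for s
  define d where "d i s = duhamel (- \<mu> i) (\<lambda>s. i \<bullet> F (x s)) s - duhamel (- \<mu> i) (\<lambda>s. i \<bullet> f s) s" for i s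
  have int_x: "set_integrable lborel {0..T} (\<lambda>s. i \<bullet> F (x s))" for i
    by (rule borel_integrable_atLeastAtMost') (intro continuous_intros cont)
  have inner_D: "i \<bullet> D s = d i s" if "i \<in> I" "s \<in> {0..T}" for i s
    using that mild[of s i] I by (auto simp: D_def inner_diff_right inner_span_proj N_def inner_convolution d_def subset_iff)
  have PD: "span_proj I (D s) = D s" for s using I by (simp add: D_def span_proj_diff N_def)
  have D_sum: "D s = (\<Sum>i\<in>I. d i s *\<^sub>R i)" if "s \<in> {0..T}" for s
    using PD[of s] that by (simp add: span_proj_def inner_D cong: sum.cong)
  define W where "W s = (\<Sum>i\<in>I. (d i s)\<^sup>2)" for s
  define W' where "W' s = (\<Sum>i\<in>I. 2 * d i s * (\<mu> i * d i s + i \<bullet> (F (x s) - f s)))" for s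
  have W: "W s = (norm (D s))\<^sup>2" if "s \<in> {0..T}" for s
    using norm_span_proj_sq[OF I, of "D s"] that unfolding PD W_def by (simp add: inner_D cong: sum.cong)
  have "W t \<le> exp ((2 * c + 1) * T) * (\<bar>W 0\<bar> + (LINT s:{0..T}|lborel. (g s)\<^sup>2))"
  proof (rule differential_inequality[where W'=W' and S="grid_floor h ` {0..T}"])
    show "continuous_on {0..T} W"
      unfolding W_def[abs_def] d_def[abs_def] f_def
      by (intro continuous_intros continuous_on_duhamel truncated_force_set_integrable h int_x)
    show "finite (grid_floor h ` {0..T})" by (rule finite_grid[OF h])
    fix s assume s': "s \<in> {0<..<T} - grid_floor h ` {0..T}"
    then have s: "s \<in> {0..T}" "s \<in> {0<..<T}" by auto
    have ngrid: "grid_floor h s \<noteq> s" using s' s(1) by (metis DiffD2 imageI)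
    have contx: "isCont (\<lambda>s. i \<bullet> F (x s)) s" for i
      by (rule continuous_on_interior[of "{0..T}"]) (use s in \<open>auto intro!: continuous_intros cont\<close>)
    have "(d i has_real_derivative (\<mu> i * d i s + i \<bullet> (F (x s) - f s))) (at s)" for i
    proof -
      have "(duhamel (- \<mu> i) (\<lambda>s. i \<bullet> f s) has_real_derivative
          (- (- \<mu> i) * duhamel (- \<mu> i) (\<lambda>s. i \<bullet> f s) s + i \<bullet> f s)) (at s)"
        unfolding f_def by (rule duhamel_has_derivative[OF truncated_force_set_integrable[OF h] s(2) isCont_truncated_force[OF h ngrid]])
      from DERIV_diff[OF duhamel_has_derivative[OF int_x s(2) contx] this]
      show ?thesis
        unfolding d_def by (rule DERIV_cong) (simp add: d_def inner_diff_right algebra_simps)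
    qed
    then show "(W has_real_derivative W' s) (at s)"
      unfolding W_def W'_def
      by (auto intro!: derivative_eq_intros DERIV_sum sum.cong simp: algebra_simps)
    define v where "v = span_proj I (x s)"
    define w where "w = N s + span_proj I (o\<^sub>0 s)"
    have vw: "v - w = D s" by (simp add: v_def w_def D_def)
    have ran: "span_proj I v = v" "span_proj I w = w" using I by (simp_all add: v_def w_def span_proj_add N_def)
    have mono: "D s \<bullet> (diag_op B \<mu> v + F v - diag_op B \<mu> w - F w) \<le> c * (norm (D s))\<^sup>2"
      using monotone[of I v w] I ran by (simp add: vw Fpow_def range_span_proj_iff)
    have diag: "D s \<bullet> (diag_op B \<mu> v - diag_op B \<mu> w) = (\<Sum>i\<in>I. \<mu> i * (d i s)\<^sup>2)"
    proof -
      have "diag_op B \<mu> v - diag_op B \<mu> w = (\<Sum>i\<in>I. (\<mu> i * (i \<bullet> D s)) *\<^sub>R i)"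
        using diag_domain_span_proj(2)[OF I, of \<mu> v] diag_domain_span_proj(2)[OF I, of \<mu> w]
        unfolding ran vw[symmetric]
        by (simp add: sum_subtractf[symmetric] scaleR_diff_left[symmetric] inner_diff_right right_diff_distrib)
      then have "D s \<bullet> (diag_op B \<mu> v - diag_op B \<mu> w) = (\<Sum>i\<in>I. \<mu> i * (i \<bullet> D s) * (i \<bullet> D s))"
        by (simp add: inner_sum_right inner_commute)
      also have "\<dots> = (\<Sum>i\<in>I. \<mu> i * (d i s)\<^sup>2)"
        using s(1) by (simp add: inner_D power2_eq_square mult.assoc cong: sum.cong)
      finally show ?thesis .
    qed
    have gs: "g s = norm (F (x s) - F v) + norm (F w - f s)" by (simp add: g_def v_def w_def)
    have "W' s = (\<Sum>i\<in>I. 2 * (\<mu> i * (d i s)\<^sup>2 + d i s * (i \<bullet> (F (x s) - f s))))"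
      unfolding W'_def by (rule sum.cong) (simp_all add: power2_eq_square algebra_simps)
    also have "\<dots> = 2 * ((\<Sum>i\<in>I. \<mu> i * (d i s)\<^sup>2) + D s \<bullet> (F (x s) - f s))"
      unfolding D_sum[OF s(1)] inner_sum_left inner_scaleR_left by (simp only: sum_distrib_left[symmetric] sum.distrib)
    also have "\<dots> = 2 * (D s \<bullet> (diag_op B \<mu> v + F v - diag_op B \<mu> w - F w) + D s \<bullet> (F (x s) - F v) + D s \<bullet> (F w - f s))"
      unfolding diag[symmetric] by (simp add: inner_diff_right inner_add_right)
    also have "\<dots> \<le> 2 * (c * (norm (D s))\<^sup>2 + norm (D s) * norm (F (x s) - F v) + norm (D s) * norm (F w - f s))"
      by (intro mult_left_mono add_mono mono norm_cauchy_schwarz) auto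
    also have "\<dots> = 2 * c * (norm (D s))\<^sup>2 + 2 * norm (D s) * g s" by (simp add: gs algebra_simps)
    also have "\<dots> \<le> 2 * c * (norm (D s))\<^sup>2 + ((norm (D s))\<^sup>2 + (g s)\<^sup>2)"
      using sum_squares_bound[of "norm (D s)" "g s"] by simp
    also have "\<dots> = (2 * c + 1) * W s + (g s)\<^sup>2" by (simp add: W[OF s(1)] algebra_simps)
    finally show "W' s \<le> (2 * c + 1) * W s + (g s)\<^sup>2" .
  qed (use c_pos g t in auto)
  also have "W 0 = 0" by (simp add: W_def d_def)
  finally show ?thesis using W[OF t] by (simp add: D_def)
qed

section \<open>Smoothing estimates for the drift\<close>

text \<open>The smoothing of the semigroup pays for \<open>\<rho> + r'\<close> powers of \<open>-A\<close>. Of these, \<open>\<rho>\<close> are spent on the norm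
  and \<open>r'\<close> on the section \<open>J\<close>, where \<open>(-A)\<^bsup>-r'\<^esup>\<close> is at most \<open>\<kappa>\<close>.\<close>

lemma duhamel_section_bound:
  fixes q :: "real \<Rightarrow> 'h"
  assumes y: "\<And>i. i \<in> B \<Longrightarrow> i \<bullet> y = (if i \<in> J then duhamel (- \<mu> i) (\<lambda>s. i \<bullet> q s) t else 0)"
    and r': "0 \<le> r'" "\<rho> + r' < 1" and \<kappa>: "0 \<le> \<kappa>" "\<And>i. i \<in> J \<Longrightarrow> i \<in> B \<Longrightarrow> (- \<mu> i) powr (- r') \<le> \<kappa>"
    and q: "q \<in> borel_measurable lborel" "\<And>s. s \<in> {0..T} \<Longrightarrow> norm (q s) \<le> K" and t: "t \<in> {0..T}"
  shows "y \<in> interp_space B \<mu> \<rho>"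
    and "interp_norm B \<mu> \<rho> y \<le> \<kappa> * (LINT s|lborel. singular_kernel (\<rho> + r') t s * norm (q s))"
proof -
  define m where "m i s = of_bool (i \<in> J) * (indicator {0..t} s * exp (- (- \<mu> i * (t - s))))" for i s
  have coord: "i \<bullet> y = (LINT s|lborel. m i s * (i \<bullet> q s))" if "i \<in> B" for i
    using y[OF that] by (simp add: m_def duhamel_def set_lebesgue_integral_def mult.assoc)
  have meas: "m i \<in> borel_measurable lborel" for i unfolding m_def by measurable
  have int: "integrable lborel (\<lambda>s. \<kappa> * singular_kernel (\<rho> + r') t s * norm (q s))"
    unfolding mult.assoc
    by (intro integrable_mult_right kernel_mult_integrable[where T=T and K=K]) (use rho r' q t in auto)
  have le: "AE s in lborel. (- \<mu> i) powr \<rho> * \<bar>m i s\<bar> \<le> \<kappa> * singular_kernel (\<rho> + r') t s" if i: "i \<in> B" for i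
    using AE_lborel_singleton[of t]
  proof eventually_elim
    case (elim s)
    show ?case
    proof (cases "i \<in> J \<and> s \<in> {0..t}")
      case True
      then have s: "0 < t - s" using elim by auto
      have pos: "0 < - \<mu> i" by (rule eigenvalue_pos[OF i])
      have "(- \<mu> i) powr \<rho> * \<bar>m i s\<bar> = (- \<mu> i) powr (- r') * (- \<mu> i) powr (\<rho> + r') * exp (- (- \<mu> i * (t - s)))"
        using True unfolding powr_add[symmetric] by (simp add: m_def)
      also have "\<dots> \<le> \<kappa> * ((- \<mu> i) powr (\<rho> + r') * exp (- (- \<mu> i * (t - s))))"
        using \<kappa>(2)[of i] True i unfolding mult.assoc by (intro mult_right_mono) auto
      also have "\<dots> \<le> \<kappa> * (t - s) powr (- (\<rho> + r'))"
        using powr_mult_exp_le[OF _ _ pos s, of "\<rho> + r'"] rho r' \<kappa>(1) by (intro mult_left_mono) auto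
      finally show ?thesis using True by (simp add: singular_kernel_def)
    next
      case False
      then have "m i s = 0" by (auto simp: m_def)
      then show ?thesis using \<kappa>(1) by simp
    qed
  qed
  have k: "0 \<le> \<kappa> * singular_kernel (\<rho> + r') t s" for s using \<kappa>(1) by simp
  note * = interp_norm_integral_le[OF coord meas q(1) k le int]
  show "y \<in> interp_space B \<mu> \<rho>" by (rule *(1))
  show "interp_norm B \<mu> \<rho> y \<le> \<kappa> * (LINT s|lborel. singular_kernel (\<rho> + r') t s * norm (q s))"
    using *(2) by (simp add: mult.assoc)
qed

lemma truncated_force_measurable: "0 < h \<Longrightarrow> truncated_force h Y n \<in> borel_measurable lborel"
  unfolding truncated_force_def[abs_def]
  by (rule measurable_step_function[where G="\<lambda>u. of_bool (interp_norm B \<mu> \<gamma> (Y u) + interp_norm B \<mu> \<gamma> (n u)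
      \<le> h powr (- chi)) *\<^sub>R F (Y u)"])

lemma truncated_force_bounded:
  assumes "0 < h"
  obtains K where "\<And>s. s \<in> {0..T} \<Longrightarrow> norm (truncated_force h Y n s) \<le> K"
proof -
  have "finite ((\<lambda>u. truncated_force h Y n u) ` grid_floor h ` {0..T})"
    by (intro finite_imageI finite_grid assms)
  then have "bounded ((\<lambda>u. truncated_force h Y n u) ` grid_floor h ` {0..T})" by (rule finite_imp_bounded)
  then obtain K where K: "\<forall>v\<in>(\<lambda>u. truncated_force h Y n u) ` grid_floor h ` {0..T}. norm v \<le> K"
    unfolding bounded_iff by (elim exE)
  have "norm (truncated_force h Y n s) \<le> K" if "s \<in> {0..T}" for s
  proof -
    have "truncated_force h Y n (grid_floor h s) = truncated_force h Y n s"
      by (rule truncated_force_const) (rule grid_floor_idem[OF assms])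
    then show ?thesis using K that by (metis imageI)
  qed
  with that show thesis by blast
qed

text \<open>For the rate of convergence the increment of the drift is estimated by moments of the force in place of
  the truncation, which permits any exponent \<open>r' < 1 - \<rho>\<close>. The part of the convolution before the last grid
  point gains \<open>h powr r'\<close> from the time regularity of the semigroup, the part after it from the length
  of the interval.\<close>

lemma convolution_increment_rate:
  fixes n Y :: "real \<Rightarrow> 'h"
  assumes h: "0 < h" and I: "finite I" "I \<subseteq> B" and r': "0 \<le> r'" "\<rho> + r' < 1" and s: "s \<in> {0..T}"
  defines "f \<equiv> truncated_force h Y n" and "t0 \<equiv> grid_floor h s"
  shows "interp_norm B \<mu> \<rho> (convolution I f s - convolution I f t0)
    \<le> h powr r' * (LINT u|lborel. (singular_kernel (\<rho> + r') t0 u + singular_kernel (\<rho> + r') s u) * norm (f u))"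
proof -
  let ?a = "\<rho> + r'"
  have t0: "0 \<le> t0" "t0 \<le> s" "s < t0 + h" "t0 \<in> {0..T}" using grid_floor_bounds[OF h, of s] s by (auto simp: t0_def)
  define m where "m i u = of_bool (i \<in> I) * (indicator {0..s} u * exp (- (- \<mu> i * (s - u)))
      - indicator {0..t0} u * exp (- (- \<mu> i * (t0 - u))))" for i u
  have int_f: "set_integrable lborel {0..t} (\<lambda>u. exp (- (- \<mu> i * (t - u))) * (i \<bullet> f u))" if "t \<in> {0..T}" for i t
    unfolding f_def by (rule set_integrable_duhamel[OF truncated_force_set_integrable[OF h]]) (use that in auto)
  have coord: "i \<bullet> (convolution I f s - convolution I f t0) = (LINT u|lborel. m i u * (i \<bullet> f u))" if i: "i \<in> B" for i
  proof (cases "i \<in> I")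
    case True
    have "i \<bullet> (convolution I f s - convolution I f t0)
      = (LINT u|lborel. indicator {0..s} u *\<^sub>R (exp (- (- \<mu> i * (s - u))) * (i \<bullet> f u)))
        - (LINT u|lborel. indicator {0..t0} u *\<^sub>R (exp (- (- \<mu> i * (t0 - u))) * (i \<bullet> f u)))"
      using True I i by (simp add: inner_diff_right inner_convolution duhamel_def set_lebesgue_integral_def)
    also have "\<dots> = (LINT u|lborel. indicator {0..s} u *\<^sub>R (exp (- (- \<mu> i * (s - u))) * (i \<bullet> f u))
        - indicator {0..t0} u *\<^sub>R (exp (- (- \<mu> i * (t0 - u))) * (i \<bullet> f u)))"
      by (rule Bochner_Integration.integral_diff[symmetric])
        (use int_f[OF s] int_f[OF t0(4)] in \<open>auto simp: set_integrable_def\<close>)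
    also have "\<dots> = (LINT u|lborel. m i u * (i \<bullet> f u))"
      using True by (intro Bochner_Integration.integral_cong) (simp_all add: m_def left_diff_distrib mult.assoc)
    finally show ?thesis .
  qed (use I i in \<open>simp add: inner_diff_right inner_convolution m_def\<close>)
  have meas: "m i \<in> borel_measurable lborel" for i unfolding m_def by measurable
  have fm: "f \<in> borel_measurable lborel" unfolding f_def by (rule truncated_force_measurable[OF h])
  obtain K where K: "\<And>u. u \<in> {0..T} \<Longrightarrow> norm (f u) \<le> K"
    unfolding f_def using truncated_force_bounded[OF h] by metis
  let ?k = "\<lambda>u. h powr r' * (singular_kernel ?a t0 u + singular_kernel ?a s u)"
  have int: "integrable lborel (\<lambda>u. ?k u * norm (f u))"
    unfolding mult.assoc distrib_right
    by (intro integrable_mult_right Bochner_Integration.integrable_add kernel_mult_integrable[where T=T and K=K])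
      (use rho r' fm K s t0(4) in auto)
  have le: "AE u in lborel. (- \<mu> i) powr \<rho> * \<bar>m i u\<bar> \<le> ?k u" if i: "i \<in> B" for i
    using AE_lborel_singleton[of t0] AE_lborel_singleton[of s]
  proof eventually_elim
    case (elim u)
    have pos: "0 < - \<mu> i" by (rule eigenvalue_pos[OF i])
    have k0: "0 \<le> singular_kernel ?a t0 u" "0 \<le> singular_kernel ?a s u" by auto
    consider "i \<notin> I \<or> u \<notin> {0..s}" | "i \<in> I" "0 \<le> u" "u < t0" | "i \<in> I" "t0 < u" "u < s"
      using elim by fastforce
    then show ?case
    proof cases
      case 1
      then have "m i u = 0" using t0 by (auto simp: m_def indicator_def)
      then show ?thesis using k0 by simp
    next
      case 2
      have "\<bar>m i u\<bar> = \<bar>exp (- (- \<mu> i * (s - u))) - exp (- (- \<mu> i * (t0 - u)))\<bar>"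
        using 2 t0 by (simp add: m_def)
      also have "exp (- (- \<mu> i * (s - u))) = exp (- (- \<mu> i * (t0 - u))) * exp (- (- \<mu> i * (s - t0)))"
        by (simp add: exp_add[symmetric] algebra_simps)
      also have "\<bar>exp (- (- \<mu> i * (t0 - u))) * exp (- (- \<mu> i * (s - t0))) - exp (- (- \<mu> i * (t0 - u)))\<bar>
          = exp (- (- \<mu> i * (t0 - u))) * \<bar>exp (- (- \<mu> i * (s - t0))) - 1\<bar>"
        by (metis abs_exp_cancel abs_mult mult.right_neutral right_diff_distrib)
      also have "\<bar>exp (- (- \<mu> i * (s - t0))) - 1\<bar> = 1 - exp (- (- \<mu> i * (s - t0)))"
        using pos t0 by (simp add: mult_nonpos_nonneg)
      also have "\<dots> \<le> (- \<mu> i * (s - t0)) powr r'"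
        using pos t0 r' rho by (intro one_minus_exp_le_powr) (auto intro: mult_nonpos_nonneg)
      also have "\<dots> = (- \<mu> i) powr r' * (s - t0) powr r'"
        by (rule powr_mult)
      finally have "(- \<mu> i) powr \<rho> * \<bar>m i u\<bar> \<le> (- \<mu> i) powr \<rho> * (exp (- (- \<mu> i * (t0 - u))) * ((- \<mu> i) powr r' * (s - t0) powr r'))"
        by (intro mult_left_mono) auto
      also have "\<dots> = (s - t0) powr r' * ((- \<mu> i) powr ?a * exp (- (- \<mu> i * (t0 - u))))"
        by (simp add: powr_add mult_ac)
      also have "\<dots> \<le> h powr r' * (t0 - u) powr (- ?a)"
        using pos 2 t0 r' rho by (intro mult_mono powr_mono2 powr_mult_exp_le) auto
      also have "\<dots> \<le> ?k u"
        using 2 k0(2) by (intro mult_left_mono) (auto simp: singular_kernel_def[of ?a t0])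
      finally show ?thesis .
    next
      case 3
      have "(- \<mu> i) powr \<rho> * \<bar>m i u\<bar> = (- \<mu> i) powr \<rho> * exp (- (- \<mu> i * (s - u)))"
        using 3 t0 by (simp add: m_def)
      also have "\<dots> \<le> (s - u) powr (- \<rho>)"
        using pos 3 rho by (intro powr_mult_exp_le) auto
      also have "\<dots> = (s - u) powr r' * (s - u) powr (- ?a)"
        by (simp add: powr_add[symmetric])
      also have "\<dots> \<le> h powr r' * (s - u) powr (- ?a)"
        using 3 t0 r' by (intro mult_right_mono powr_mono2) auto
      also have "\<dots> \<le> ?k u"
        using 3 t0 k0(1) by (intro mult_left_mono) (auto simp: singular_kernel_def[of ?a s])
      finally show ?thesis .
    qed
  qed
  have k: "0 \<le> ?k u" for u by simp
  show ?thesis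
    using interp_norm_integral_le(2)[OF coord meas fm k le int] by (simp add: mult.assoc)
qed

end

section \<open>Moment bounds\<close>

text \<open>Bounds are stated for the \<open>q\<close>-th moment and not for its root: powers and products of random
  variables then only change the exponent.\<close>

definition moment_le :: "'w measure \<Rightarrow> real \<Rightarrow> ('w \<Rightarrow> real) \<Rightarrow> real \<Rightarrow> bool" where
  "moment_le P q Z K \<longleftrightarrow> Z \<in> borel_measurable P \<and> (\<forall>\<omega>\<in>space P. 0 \<le> Z \<omega>) \<and> 0 \<le> K \<and>
     (\<integral>\<^sup>+\<omega>. ennreal (Z \<omega> powr q) \<partial>P) \<le> ennreal K"

lemma moment_le_weaken: "moment_le P q Z K \<Longrightarrow> K \<le> L \<Longrightarrow> moment_le P q Z L"
  unfolding moment_le_def by (auto intro: order_trans ennreal_leI)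

lemma moment_le_mono:
  assumes Z: "moment_le P q Z K" and "0 \<le> q" and Y: "Y \<in> borel_measurable P" "\<And>\<omega>. \<omega> \<in> space P \<Longrightarrow> 0 \<le> Y \<omega>"
    and le: "AE \<omega> in P. Y \<omega> \<le> Z \<omega>"
  shows "moment_le P q Y K"
proof -
  have "(\<integral>\<^sup>+\<omega>. ennreal (Y \<omega> powr q) \<partial>P) \<le> (\<integral>\<^sup>+\<omega>. ennreal (Z \<omega> powr q) \<partial>P)"
    using le AE_space
    by (intro nn_integral_mono_AE) (elim AE_mp, auto intro!: AE_I2 ennreal_leI powr_mono2 Y \<open>0 \<le> q\<close>)
  then show ?thesis using Z Y by (auto simp: moment_le_def)
qed

lemma moment_le_add:
  assumes "moment_le P q Y K" "moment_le P q Z L" "0 \<le> q"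
  shows "moment_le P q (\<lambda>\<omega>. Y \<omega> + Z \<omega>) (2 powr q * (K + L))"
proof -
  note [measurable] = assms(1,2)[unfolded moment_le_def, THEN conjunct1]
  have "(\<integral>\<^sup>+\<omega>. ennreal ((Y \<omega> + Z \<omega>) powr q) \<partial>P)
      \<le> (\<integral>\<^sup>+\<omega>. ennreal (2 powr q) * (ennreal (Y \<omega> powr q) + ennreal (Z \<omega> powr q)) \<partial>P)"
    by (rule nn_integral_mono)
      (use assms in \<open>auto simp: moment_le_def ennreal_plus[symmetric] ennreal_mult[symmetric]
        simp del: ennreal_plus intro!: ennreal_leI powr_add_le\<close>)
  also have "\<dots> = ennreal (2 powr q) * ((\<integral>\<^sup>+\<omega>. ennreal (Y \<omega> powr q) \<partial>P) + (\<integral>\<^sup>+\<omega>. ennreal (Z \<omega> powr q) \<partial>P))"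
    by (simp add: nn_integral_cmult nn_integral_add)
  also have "\<dots> \<le> ennreal (2 powr q) * (ennreal K + ennreal L)"
    using assms by (intro mult_left_mono add_mono) (auto simp: moment_le_def)
  also have "\<dots> = ennreal (2 powr q * (K + L))"
    using assms by (simp add: moment_le_def ennreal_mult)
  finally show ?thesis using assms by (auto simp: moment_le_def)
qed

lemma moment_le_cmult:
  assumes "moment_le P q Z K" "0 \<le> c"
  shows "moment_le P q (\<lambda>\<omega>. c * Z \<omega>) (c powr q * K)"
proof -
  note [measurable] = assms(1)[unfolded moment_le_def, THEN conjunct1]
  have "(\<integral>\<^sup>+\<omega>. ennreal ((c * Z \<omega>) powr q) \<partial>P) = (\<integral>\<^sup>+\<omega>. ennreal (c powr q) * ennreal (Z \<omega> powr q) \<partial>P)"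
    using assms by (intro nn_integral_cong) (auto simp: moment_le_def powr_mult ennreal_mult)
  also have "\<dots> = ennreal (c powr q) * (\<integral>\<^sup>+\<omega>. ennreal (Z \<omega> powr q) \<partial>P)" by (simp add: nn_integral_cmult)
  also have "\<dots> \<le> ennreal (c powr q) * ennreal K"
    using assms by (intro mult_left_mono) (auto simp: moment_le_def)
  finally show ?thesis using assms by (auto simp: moment_le_def ennreal_mult)
qed

lemma moment_le_powr:
  assumes "moment_le P (a * q) Z K"
  shows "moment_le P q (\<lambda>\<omega>. Z \<omega> powr a) K"
  using assms by (auto simp: moment_le_def powr_powr)

lemma (in prob_space) moment_le_const: "0 \<le> c \<Longrightarrow> moment_le M q (\<lambda>_. c) (c powr q)"
  by (simp add: moment_le_def emeasure_space_1)

lemma (in prob_space) moment_le_lower: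
  assumes Z: "moment_le M q Z K" and "0 < q'" "q' \<le> q"
  shows "moment_le M q' Z (1 + K)"
proof -
  note [measurable] = Z[unfolded moment_le_def, THEN conjunct1]
  have "z powr q' \<le> 1 + z powr q" if "0 \<le> z" for z :: real
  proof (cases "z \<le> 1")
    case True
    then have "z powr q' \<le> 1" using that assms by (intro powr_le1) auto
    then show ?thesis using powr_ge_zero[of z q] by linarith
  next
    case False
    then have "z powr q' \<le> z powr q" using assms by (intro powr_mono) auto
    then show ?thesis by simp
  qed
  then have "(\<integral>\<^sup>+\<omega>. ennreal (Z \<omega> powr q') \<partial>M) \<le> (\<integral>\<^sup>+\<omega>. ennreal 1 + ennreal (Z \<omega> powr q) \<partial>M)"
    using Z by (intro nn_integral_mono)
      (simp add: moment_le_def ennreal_plus[symmetric] del: ennreal_plus ennreal_1 add: ennreal_leI)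
  also have "\<dots> = ennreal 1 + (\<integral>\<^sup>+\<omega>. ennreal (Z \<omega> powr q) \<partial>M)"
    by (simp add: nn_integral_add emeasure_space_1)
  also have "\<dots> \<le> ennreal (1 + K)"
    using Z by (subst ennreal_plus) (auto simp: moment_le_def intro!: add_mono)
  finally show ?thesis using Z by (auto simp: moment_le_def)
qed

text \<open>The Cauchy--Schwarz inequality.\<close>

lemma moment_le_mult:
  assumes Y: "moment_le P (2 * q) Y K" and Z: "moment_le P (2 * q) Z L"
  shows "moment_le P q (\<lambda>\<omega>. Y \<omega> * Z \<omega>) (sqrt (K * L))"
proof -
  note [measurable] = Y[unfolded moment_le_def, THEN conjunct1] Z[unfolded moment_le_def, THEN conjunct1]
  let ?I = "\<integral>\<^sup>+\<omega>. ennreal ((Y \<omega> * Z \<omega>) powr q) \<partial>P"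
  have sq: "(ennreal (z powr q))\<^sup>2 = ennreal (z powr (2 * q))" for z
    by (simp add: power2_eq_square ennreal_mult[symmetric] powr_add[symmetric])
  have "?I = (\<integral>\<^sup>+\<omega>. ennreal (Y \<omega> powr q) * ennreal (Z \<omega> powr q) \<partial>P)"
    using Y Z by (intro nn_integral_cong) (auto simp: moment_le_def powr_mult ennreal_mult)
  then have "?I\<^sup>2 \<le> (\<integral>\<^sup>+\<omega>. ennreal (Y \<omega> powr (2 * q)) \<partial>P) * (\<integral>\<^sup>+\<omega>. ennreal (Z \<omega> powr (2 * q)) \<partial>P)"
    using Cauchy_Schwarz_nn_integral[of "\<lambda>\<omega>. ennreal (Y \<omega> powr q)" P "\<lambda>\<omega>. ennreal (Z \<omega> powr q)"]
    by (simp add: sq)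
  also have "\<dots> \<le> ennreal K * ennreal L"
    using Y Z by (intro mult_mono) (auto simp: moment_le_def)
  also have "\<dots> = (ennreal (sqrt (K * L)))\<^sup>2"
    using Y Z by (simp add: moment_le_def ennreal_power ennreal_mult)
  finally have *: "?I\<^sup>2 \<le> (ennreal (sqrt (K * L)))\<^sup>2" .
  have KL: "0 \<le> sqrt (K * L)" using Y Z by (simp add: moment_le_def)
  have "?I \<le> ennreal (sqrt (K * L))"
  proof (cases ?I)
    case (real x)
    then have "x\<^sup>2 \<le> (sqrt (K * L))\<^sup>2"
      using * KL by (simp add: ennreal_power ennreal_le_iff del: real_sqrt_pow2)
    then have "x \<le> sqrt (K * L)" using KL by (rule power2_le_imp_le)
    then show ?thesis unfolding real(2) by (rule ennreal_leI)
  next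
    case top
    then show ?thesis using * KL by (simp add: ennreal_power power2_eq_square[of "top::ennreal"] top_unique del: real_sqrt_pow2)
  qed
  then show ?thesis using Y Z by (auto simp: moment_le_def)
qed

text \<open>Linearity of the integral holds for measurable functions. The positive part of \<open>(Z - a) / b\<close> is
  one, and it lies below \<open>Y\<close>.\<close>

lemma (in prob_space) nn_integral_le_affine:
  assumes Z: "Z \<in> borel_measurable M" and a: "0 \<le> a" and b: "0 < b" and K: "0 \<le> K"
    and Y: "\<And>\<omega>. 0 \<le> Y \<omega>" "(\<integral>\<^sup>+\<omega>. ennreal (Y \<omega>) \<partial>M) \<le> ennreal K"
    and le: "AE \<omega> in M. Z \<omega> \<le> a + b * Y \<omega>"
  shows "(\<integral>\<^sup>+\<omega>. ennreal (Z \<omega>) \<partial>M) \<le> ennreal (a + b * K)"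
proof -
  define g where "g \<omega> = max 0 ((Z \<omega> - a) / b)" for \<omega>
  have [measurable]: "g \<in> borel_measurable M" unfolding g_def using Z by measurable
  have "(\<integral>\<^sup>+\<omega>. ennreal (g \<omega>) \<partial>M) \<le> (\<integral>\<^sup>+\<omega>. ennreal (Y \<omega>) \<partial>M)"
  proof (rule nn_integral_mono_AE)
    show "AE \<omega> in M. ennreal (g \<omega>) \<le> ennreal (Y \<omega>)"
      using le
    proof eventually_elim
      case (elim \<omega>)
      then have "(Z \<omega> - a) / b \<le> Y \<omega>" using b by (simp add: field_simps)
      then show ?case using Y(1)[of \<omega>] by (intro ennreal_leI) (simp add: g_def)
    qed
  qed
  then have g: "(\<integral>\<^sup>+\<omega>. ennreal (g \<omega>) \<partial>M) \<le> ennreal K" using Y(2) by (rule order_trans)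
  have "(\<integral>\<^sup>+\<omega>. ennreal (Z \<omega>) \<partial>M) \<le> (\<integral>\<^sup>+\<omega>. ennreal a + ennreal b * ennreal (g \<omega>) \<partial>M)"
  proof (rule nn_integral_mono)
    fix \<omega>
    have "(Z \<omega> - a) / b \<le> g \<omega>" "0 \<le> g \<omega>" by (auto simp: g_def)
    then have "Z \<omega> \<le> a + b * g \<omega>" using b by (simp add: field_simps)
    then have "ennreal (Z \<omega>) \<le> ennreal (a + b * g \<omega>)" by (rule ennreal_leI)
    also have "\<dots> = ennreal a + ennreal b * ennreal (g \<omega>)"
      using a b \<open>0 \<le> g \<omega>\<close> by (simp add: ennreal_mult)
    finally show "ennreal (Z \<omega>) \<le> ennreal a + ennreal b * ennreal (g \<omega>)" .
  qed
  also have "\<dots> = ennreal a + ennreal b * (\<integral>\<^sup>+\<omega>. ennreal (g \<omega>) \<partial>M)"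
    by (simp add: nn_integral_add nn_integral_cmult emeasure_space_1)
  also have "\<dots> \<le> ennreal a + ennreal b * ennreal K"
    using g by (intro add_left_mono mult_left_mono) auto
  also have "\<dots> = ennreal (a + b * K)" using a b K by (simp add: ennreal_mult)
  finally show ?thesis .
qed

text \<open>Convexity of the power at \<open>a\<close>, in the form of Young's inequality for the exponents \<open>q\<close> and
  \<open>q / (q - 1)\<close>.\<close>

lemma powr_tangent_le:
  fixes a y q :: real
  assumes "1 \<le> q" "0 \<le> a" "0 \<le> y"
  shows "q * (a powr (q - 1) * y) \<le> y powr q + (q - 1) * a powr q"
proof (cases "a = 0 \<or> y = 0")
  case True
  then show ?thesis using assms by auto
next
  case False
  then have pos: "0 < a" "0 < y" using assms by auto
  have "(y powr q) powr (1/q) * (a powr q) powr ((q - 1)/q) \<le> (1/q) * y powr q + ((q - 1)/q) * a powr q"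
    by (rule Youngs_inequality_0) (use assms pos in \<open>auto simp: field_simps\<close>)
  then have "y * a powr (q - 1) \<le> (1/q) * y powr q + ((q - 1)/q) * a powr q"
    using assms pos by (simp add: powr_powr)
  then have "q * (y * a powr (q - 1)) \<le> q * ((1/q) * y powr q + ((q - 1)/q) * a powr q)"
    using assms by (intro mult_left_mono) auto
  also have "\<dots> = y powr q + (q - 1) * a powr q" using assms by (simp add: distrib_left)
  finally show ?thesis by (simp add: mult.commute)
qed

text \<open>Jensen's inequality for the measure with density \<open>k\<close>, followed by Tonelli's theorem. Integrating the
  tangent at \<open>a = Z / \<kappa>\<close> proves Jensen's inequality also when the total mass of \<open>k\<close> is smaller than \<open>\<kappa>\<close>.\<close>

lemma (in prob_space) moment_le_kernel_integral:
  fixes Y :: "real \<Rightarrow> 'a \<Rightarrow> real"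
  assumes q: "1 \<le> q" and K: "0 \<le> K" and \<kappa>: "0 < \<kappa>"
    and Y: "(\<lambda>(s, \<omega>). Y s \<omega>) \<in> borel_measurable (lborel \<Otimes>\<^sub>M M)" "\<And>s \<omega>. \<omega> \<in> space M \<Longrightarrow> 0 \<le> Y s \<omega>"
    and k: "integrable lborel k" "\<And>s. 0 \<le> k s" "(LINT s|lborel. k s) \<le> \<kappa>"
    and mom: "\<And>s. k s \<noteq> 0 \<Longrightarrow> moment_le M q (Y s) K"
    and Z: "Z \<in> borel_measurable M" "\<And>\<omega>. \<omega> \<in> space M \<Longrightarrow> 0 \<le> Z \<omega>"
    and le: "AE \<omega> in M. integrable lborel (\<lambda>s. k s * Y s \<omega>) \<and> Z \<omega> \<le> (LINT s|lborel. k s * Y s \<omega>)"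
  shows "moment_le M q Z (\<kappa> powr q * K)"
proof -
  interpret PS: pair_sigma_finite lborel M ..
  note [measurable] = Y(1) borel_measurable_integrable[OF k(1)]
  let ?X = "\<lambda>\<omega>. \<integral>\<^sup>+s. ennreal (k s) * ennreal (Y s \<omega> powr q) \<partial>lborel"
  have point: "ennreal (Z \<omega> powr q) \<le> ennreal (\<kappa> powr (q - 1)) * ?X \<omega>"
    if \<omega>: "\<omega> \<in> space M" and int: "integrable lborel (\<lambda>s. k s * Y s \<omega>)"
      and Zle: "Z \<omega> \<le> (LINT s|lborel. k s * Y s \<omega>)" for \<omega>
  proof -
    define a where "a = Z \<omega> / \<kappa>"
    have a: "0 \<le> a" using Z(2)[OF \<omega>] \<kappa> by (simp add: a_def)
    have Za: "Z \<omega> = \<kappa> * a" using \<kappa> by (simp add: a_def)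
    have [measurable]: "(\<lambda>s. Y s \<omega>) \<in> borel_measurable lborel"
      using measurable_compose[OF measurable_Pair2'[OF \<omega>] Y(1)] by simp
    have "ennreal (q * a powr (q - 1) * (\<kappa> * a)) \<le> ennreal (LINT s|lborel. q * a powr (q - 1) * (k s * Y s \<omega>))"
      using Zle q by (intro ennreal_leI) (simp add: Za mult_left_mono)
    also have "\<dots> = (\<integral>\<^sup>+s. ennreal (q * a powr (q - 1) * (k s * Y s \<omega>)) \<partial>lborel)"
      using int q k(2) Y(2)[OF \<omega>] by (subst nn_integral_eq_integral) auto
    also have "\<dots> \<le> (\<integral>\<^sup>+s. ennreal (k s) * ennreal (Y s \<omega> powr q) + ennreal ((q - 1) * a powr q) * ennreal (k s) \<partial>lborel)"
    proof (rule nn_integral_mono)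
      fix s
      have "k s * (q * (a powr (q - 1) * Y s \<omega>)) \<le> k s * (Y s \<omega> powr q + (q - 1) * a powr q)"
        by (intro mult_left_mono powr_tangent_le q a Y(2)[OF \<omega>] k(2))
      then have "ennreal (q * a powr (q - 1) * (k s * Y s \<omega>)) \<le> ennreal (k s * Y s \<omega> powr q + (q - 1) * a powr q * k s)"
        by (intro ennreal_leI) (simp add: algebra_simps)
      also have "\<dots> = ennreal (k s) * ennreal (Y s \<omega> powr q) + ennreal ((q - 1) * a powr q) * ennreal (k s)"
        using k(2) q by (simp add: ennreal_mult)
      finally show "ennreal (q * a powr (q - 1) * (k s * Y s \<omega>)) \<le> \<dots>" .
    qed
    also have "\<dots> = ?X \<omega> + ennreal ((q - 1) * a powr q) * (\<integral>\<^sup>+s. ennreal (k s) \<partial>lborel)"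
      by (subst nn_integral_add) (auto simp: nn_integral_cmult)
    also have "\<dots> \<le> ?X \<omega> + ennreal ((q - 1) * a powr q) * ennreal \<kappa>"
      using k by (intro add_left_mono mult_left_mono) (auto simp: nn_integral_eq_integral ennreal_leI)
    finally have *: "ennreal (q * a powr (q - 1) * (\<kappa> * a)) \<le> ?X \<omega> + ennreal ((q - 1) * a powr q * \<kappa>)"
      using q \<kappa> by (simp add: ennreal_mult)
    have "q * a powr (q - 1) * (\<kappa> * a) = \<kappa> * a powr q + (q - 1) * a powr q * \<kappa>"
      using a by (cases "a = 0") (simp_all add: powr_diff field_simps)
    with * have "ennreal (\<kappa> * a powr q) + ennreal ((q - 1) * a powr q * \<kappa>) \<le> ?X \<omega> + ennreal ((q - 1) * a powr q * \<kappa>)"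
      using q \<kappa> by (simp add: ennreal_plus[symmetric] del: ennreal_plus)
    then have "ennreal (\<kappa> * a powr q) \<le> ?X \<omega>"
      by (simp add: ennreal_add_left_cancel_le add.commute[of _ "ennreal ((q - 1) * a powr q * \<kappa>)"])
    then have "ennreal (\<kappa> powr (q - 1)) * ennreal (\<kappa> * a powr q) \<le> ennreal (\<kappa> powr (q - 1)) * ?X \<omega>"
      by (intro mult_left_mono) auto
    moreover have "\<kappa> powr (q - 1) * (\<kappa> * a powr q) = Z \<omega> powr q"
      using \<kappa> a by (simp add: Za powr_mult powr_diff)
    ultimately show ?thesis using \<kappa> by (simp add: ennreal_mult[symmetric])
  qed
  have "(\<integral>\<^sup>+\<omega>. ennreal (Z \<omega> powr q) \<partial>M) \<le> (\<integral>\<^sup>+\<omega>. ennreal (\<kappa> powr (q - 1)) * ?X \<omega> \<partial>M)"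
    using le AE_space by (intro nn_integral_mono_AE) (elim AE_mp, auto intro!: AE_I2 point)
  also have "\<dots> = ennreal (\<kappa> powr (q - 1)) * (\<integral>\<^sup>+\<omega>. ?X \<omega> \<partial>M)"
    by (intro nn_integral_cmult) measurable
  also have "(\<integral>\<^sup>+\<omega>. ?X \<omega> \<partial>M) = (\<integral>\<^sup>+s. \<integral>\<^sup>+\<omega>. ennreal (k s) * ennreal (Y s \<omega> powr q) \<partial>M \<partial>lborel)"
    using PS.Fubini[of "\<lambda>(s, \<omega>). ennreal (k s) * ennreal (Y s \<omega> powr q)"] by simp
  also have "\<dots> \<le> (\<integral>\<^sup>+s. ennreal (k s) * ennreal K \<partial>lborel)"
  proof (rule nn_integral_mono)
    fix s
    show "(\<integral>\<^sup>+\<omega>. ennreal (k s) * ennreal (Y s \<omega> powr q) \<partial>M) \<le> ennreal (k s) * ennreal K"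
    proof (cases "k s = 0")
      case False
      from mom[OF this] have m: "Y s \<in> borel_measurable M" "(\<integral>\<^sup>+\<omega>. ennreal (Y s \<omega> powr q) \<partial>M) \<le> ennreal K"
        by (auto simp: moment_le_def)
      then show ?thesis by (simp add: nn_integral_cmult mult_left_mono)
    qed simp
  qed
  also have "\<dots> = (\<integral>\<^sup>+s. ennreal (k s) \<partial>lborel) * ennreal K" by (simp add: nn_integral_multc)
  also have "\<dots> \<le> ennreal \<kappa> * ennreal K"
    using k by (intro mult_right_mono) (auto simp: nn_integral_eq_integral ennreal_leI)
  finally have "(\<integral>\<^sup>+\<omega>. ennreal (Z \<omega> powr q) \<partial>M) \<le> ennreal (\<kappa> powr (q - 1)) * (ennreal \<kappa> * ennreal K)"
    by (simp add: mult_left_mono)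
  also have "\<dots> = ennreal (\<kappa> powr q * K)"
    using \<kappa> K by (simp add: ennreal_mult[symmetric] powr_diff)
  finally show ?thesis using Z K by (auto simp: moment_le_def)
qed

section \<open>Moments of families of processes\<close>

text \<open>A family \<open>Z\<close> of processes, indexed by \<open>d\<close>, is of order \<open>e d\<close> in the \<open>q\<close>-th mean, uniformly
  over the index and over time. Estimates are stated for \<open>q\<close>-th powers throughout, so \<open>e d\<close> appears
  to the power \<open>q\<close>.\<close>

locale moment_family = prob_space P for P :: "'w measure" +
  fixes D :: "'d set" and T :: real
  assumes T_nonneg: "0 \<le> T"
begin

definition morder :: "real \<Rightarrow> ('d \<Rightarrow> real) \<Rightarrow> ('d \<Rightarrow> real \<Rightarrow> 'w \<Rightarrow> real) \<Rightarrow> bool" where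
  "morder q e Z \<longleftrightarrow> (\<exists>K\<ge>0. \<forall>d\<in>D. \<forall>t\<in>{0..T}. moment_le P q (Z d t) (K * e d powr q))"

lemma morderI:
  "0 \<le> K \<Longrightarrow> (\<And>d t. d \<in> D \<Longrightarrow> t \<in> {0..T} \<Longrightarrow> moment_le P q (Z d t) (K * e d powr q)) \<Longrightarrow> morder q e Z"
  unfolding morder_def by blast

lemma morder_mono:
  assumes "morder q e Z" "0 \<le> q"
    and "\<And>d t. d \<in> D \<Longrightarrow> t \<in> {0..T} \<Longrightarrow> Y d t \<in> borel_measurable P"
    and "\<And>d t \<omega>. d \<in> D \<Longrightarrow> t \<in> {0..T} \<Longrightarrow> \<omega> \<in> space P \<Longrightarrow> 0 \<le> Y d t \<omega>"
    and "\<And>d t. d \<in> D \<Longrightarrow> t \<in> {0..T} \<Longrightarrow> AE \<omega> in P. Y d t \<omega> \<le> Z d t \<omega>"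
  shows "morder q e Y"
proof -
  obtain K where K: "0 \<le> K" "\<And>d t. d \<in> D \<Longrightarrow> t \<in> {0..T} \<Longrightarrow> moment_le P q (Z d t) (K * e d powr q)"
    using assms(1) unfolding morder_def by blast
  show ?thesis
    by (rule morderI[OF K(1)], rule moment_le_mono[OF K(2)]) (use assms in auto)
qed

lemma morder_add:
  assumes "morder q e Y" "morder q e Z" "0 \<le> q"
  shows "morder q e (\<lambda>d t \<omega>. Y d t \<omega> + Z d t \<omega>)"
proof -
  obtain K where K: "0 \<le> K" "\<And>d t. d \<in> D \<Longrightarrow> t \<in> {0..T} \<Longrightarrow> moment_le P q (Y d t) (K * e d powr q)"
    using assms(1) unfolding morder_def by blast
  obtain L where L: "0 \<le> L" "\<And>d t. d \<in> D \<Longrightarrow> t \<in> {0..T} \<Longrightarrow> moment_le P q (Z d t) (L * e d powr q)"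
    using assms(2) unfolding morder_def by blast
  show ?thesis
  proof (rule morderI[of "2 powr q * (K + L)"])
    fix d t assume "d \<in> D" "t \<in> {0..T}"
    from moment_le_add[OF K(2)[OF this] L(2)[OF this] assms(3)]
    show "moment_le P q (\<lambda>\<omega>. Y d t \<omega> + Z d t \<omega>) (2 powr q * (K + L) * e d powr q)"
      by (simp add: algebra_simps)
  qed (use K L in simp)
qed

lemma morder_cmult:
  assumes "morder q e Z" "0 \<le> a"
  shows "morder q e (\<lambda>d t \<omega>. a * Z d t \<omega>)"
proof -
  obtain K where K: "0 \<le> K" "\<And>d t. d \<in> D \<Longrightarrow> t \<in> {0..T} \<Longrightarrow> moment_le P q (Z d t) (K * e d powr q)"
    using assms(1) unfolding morder_def by blast
  show ?thesis
  proof (rule morderI[of "a powr q * K"])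
    fix d t assume "d \<in> D" "t \<in> {0..T}"
    from moment_le_cmult[OF K(2)[OF this] assms(2)]
    show "moment_le P q (\<lambda>\<omega>. a * Z d t \<omega>) (a powr q * K * e d powr q)" by (simp add: mult.assoc)
  qed (use K in simp)
qed

lemma morder_scale:
  assumes "morder q (\<lambda>_. 1) Z" "0 \<le> q" "0 \<le> C" "\<And>d. d \<in> D \<Longrightarrow> 0 \<le> r d \<and> r d \<le> C * e d" "\<And>d. d \<in> D \<Longrightarrow> 0 \<le> e d"
  shows "morder q e (\<lambda>d t \<omega>. r d * Z d t \<omega>)"
proof -
  obtain K where K: "0 \<le> K" "\<And>d t. d \<in> D \<Longrightarrow> t \<in> {0..T} \<Longrightarrow> moment_le P q (Z d t) (K * 1 powr q)"
    using assms(1) unfolding morder_def by blast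
  show ?thesis
  proof (rule morderI[of "C powr q * K"])
    fix d t assume d: "d \<in> D" "t \<in> {0..T}"
    have "r d powr q \<le> (C * e d) powr q" using assms(2,4) d by (intro powr_mono2) auto
    also have "\<dots> = C powr q * e d powr q" using assms(3,5) d by (simp add: powr_mult)
    finally have "r d powr q * K \<le> C powr q * e d powr q * K" using K(1) by (rule mult_right_mono)
    then have "r d powr q * (K * 1 powr q) \<le> C powr q * K * e d powr q" by (simp add: mult_ac)
    with moment_le_cmult[OF K(2)[OF d]] assms(4)[OF d(1)]
    show "moment_le P q (\<lambda>\<omega>. r d * Z d t \<omega>) (C powr q * K * e d powr q)"
      by (blast intro: moment_le_weaken)
  qed (use K in simp)
qed

lemma morder_weight:
  assumes "morder q e Z" "0 \<le> q" "\<And>d. d \<in> D \<Longrightarrow> 0 \<le> e d \<and> e d \<le> e' d"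
  shows "morder q e' Z"
proof -
  obtain K where K: "0 \<le> K" "\<And>d t. d \<in> D \<Longrightarrow> t \<in> {0..T} \<Longrightarrow> moment_le P q (Z d t) (K * e d powr q)"
    using assms(1) unfolding morder_def by blast
  show ?thesis
  proof (rule morderI[OF K(1)])
    fix d t assume d: "d \<in> D" "t \<in> {0..T}"
    show "moment_le P q (Z d t) (K * e' d powr q)"
      by (rule moment_le_weaken[OF K(2)[OF d]]) (use assms(2,3) d K(1) in \<open>auto intro!: mult_left_mono powr_mono2\<close>)
  qed
qed

lemma morder_mult:
  assumes "morder (2 * q) e Y" "morder (2 * q) (\<lambda>_. 1) Z" "\<And>d. d \<in> D \<Longrightarrow> 0 \<le> e d"
  shows "morder q e (\<lambda>d t \<omega>. Y d t \<omega> * Z d t \<omega>)"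
proof -
  obtain K where K: "0 \<le> K" "\<And>d t. d \<in> D \<Longrightarrow> t \<in> {0..T} \<Longrightarrow> moment_le P (2 * q) (Y d t) (K * e d powr (2 * q))"
    using assms(1) unfolding morder_def by blast
  obtain L where L: "0 \<le> L" "\<And>d t. d \<in> D \<Longrightarrow> t \<in> {0..T} \<Longrightarrow> moment_le P (2 * q) (Z d t) (L * 1 powr (2 * q))"
    using assms(2) unfolding morder_def by blast
  show ?thesis
  proof (rule morderI[of "sqrt (K * L)"])
    fix d t assume d: "d \<in> D" "t \<in> {0..T}"
    have "e d powr (2 * q) = (e d powr q)\<^sup>2"
      by (simp add: power2_eq_square powr_add[symmetric])
    then have "sqrt (K * e d powr (2 * q) * (L * 1 powr (2 * q))) = sqrt (K * L) * e d powr q"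
      by (simp add: real_sqrt_mult)
    with moment_le_mult[OF K(2)[OF d] L(2)[OF d]]
    show "moment_le P q (\<lambda>\<omega>. Y d t \<omega> * Z d t \<omega>) (sqrt (K * L) * e d powr q)" by simp
  qed (use K L in simp)
qed

lemma morder_const: "0 \<le> a \<Longrightarrow> morder q (\<lambda>_. 1) (\<lambda>d t \<omega>. a)"
  by (rule morderI[of "a powr q"]) (use moment_le_const[of a q] in auto)

lemma morder_half:
  assumes "morder (2 * q) e Z" "\<And>d. d \<in> D \<Longrightarrow> 0 \<le> e d"
  shows "morder q e Z"
  using morder_mult[OF assms(1) morder_const[of 1] assms(2)] by simp

lemma morder_lower:
  assumes "morder q (\<lambda>_. 1) Z" "0 < q'" "q' \<le> q"
  shows "morder q' (\<lambda>_. 1) Z"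
proof -
  obtain K where K: "0 \<le> K" "\<And>d t. d \<in> D \<Longrightarrow> t \<in> {0..T} \<Longrightarrow> moment_le P q (Z d t) (K * 1 powr q)"
    using assms(1) unfolding morder_def by blast
  show ?thesis
    by (rule morderI[of "1 + K"]) (use moment_le_lower[OF K(2) assms(2,3)] K in auto)
qed

lemma morder_powr:
  assumes "morder (a * q) e Z"
  shows "morder q (\<lambda>d. e d powr a) (\<lambda>d t \<omega>. Z d t \<omega> powr a)"
proof -
  obtain K where K: "0 \<le> K" "\<And>d t. d \<in> D \<Longrightarrow> t \<in> {0..T} \<Longrightarrow> moment_le P (a * q) (Z d t) (K * e d powr (a * q))"
    using assms unfolding morder_def by blast
  show ?thesis
    by (rule morderI[OF K(1)]) (use moment_le_powr[OF K(2)] in \<open>simp add: powr_powr\<close>)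
qed

lemma morder_powr_1:
  "morder (a * q) (\<lambda>_. 1) Z \<Longrightarrow> morder q (\<lambda>_. 1) (\<lambda>d t \<omega>. Z d t \<omega> powr a)"
  using morder_powr[of a q "\<lambda>_. 1"] by simp

lemma morder_time_change:
  assumes "morder q e Z" "\<And>d t. d \<in> D \<Longrightarrow> t \<in> {0..T} \<Longrightarrow> \<tau> d t \<in> {0..T}"
  shows "morder q e (\<lambda>d t. Z d (\<tau> d t))"
  using assms unfolding morder_def by blast

lemma morder_kernel:
  assumes Y: "morder q e Y" and q: "1 \<le> q" and e: "\<And>d. d \<in> D \<Longrightarrow> 0 \<le> e d" and \<kappa>: "0 < \<kappa>"
    and joint: "\<And>d. d \<in> D \<Longrightarrow> (\<lambda>(s, \<omega>). Y d s \<omega>) \<in> borel_measurable (lborel \<Otimes>\<^sub>M P)"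
    and nonneg: "\<And>d s \<omega>. d \<in> D \<Longrightarrow> \<omega> \<in> space P \<Longrightarrow> 0 \<le> Y d s \<omega>"
    and bounded: "\<And>d \<omega>. d \<in> D \<Longrightarrow> \<omega> \<in> space P \<Longrightarrow> \<exists>K. \<forall>s\<in>{0..T}. Y d s \<omega> \<le> K"
    and k: "\<And>d t. d \<in> D \<Longrightarrow> t \<in> {0..T} \<Longrightarrow> integrable lborel (k d t)"
      "\<And>d t s. d \<in> D \<Longrightarrow> t \<in> {0..T} \<Longrightarrow> 0 \<le> k d t s"
      "\<And>d t. d \<in> D \<Longrightarrow> t \<in> {0..T} \<Longrightarrow> (LINT s|lborel. k d t s) \<le> \<kappa>"
      "\<And>d t s. d \<in> D \<Longrightarrow> t \<in> {0..T} \<Longrightarrow> s \<notin> {0..T} \<Longrightarrow> k d t s = 0"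
  shows "morder q e (\<lambda>d t \<omega>. LINT s|lborel. k d t s * Y d s \<omega>)"
proof -
  obtain K where K: "0 \<le> K" "\<And>d t. d \<in> D \<Longrightarrow> t \<in> {0..T} \<Longrightarrow> moment_le P q (Y d t) (K * e d powr q)"
    using Y unfolding morder_def by blast
  show ?thesis
  proof (rule morderI[of "\<kappa> powr q * K"])
    fix d t assume d: "d \<in> D" "t \<in> {0..T}"
    note [measurable] = borel_measurable_integrable[OF k(1)[OF d]] joint[OF d(1)]
    have "moment_le P q (\<lambda>\<omega>. LINT s|lborel. k d t s * Y d s \<omega>) (\<kappa> powr q * (K * e d powr q))"
    proof (rule moment_le_kernel_integral[OF q _ \<kappa> joint[OF d(1)] nonneg[OF d(1)] k(1-3)[OF d]])
      show "0 \<le> K * e d powr q" using K(1) by simp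
      show "moment_le P q (Y d s) (K * e d powr q)" if "k d t s \<noteq> 0" for s
        using k(4)[OF d, of s] that K(2)[OF d(1)] by blast
      have "(\<lambda>(\<omega>, s). k d t s * Y d s \<omega>) \<in> borel_measurable (P \<Otimes>\<^sub>M lborel)"
        using measurable_compose[OF measurable_pair_swap'[of P lborel] joint[OF d(1)]] by (simp add: split_beta') measurable
      then show "(\<lambda>\<omega>. LINT s|lborel. k d t s * Y d s \<omega>) \<in> borel_measurable P"
        by (rule lborel.borel_measurable_lebesgue_integral)
      show "0 \<le> (LINT s|lborel. k d t s * Y d s \<omega>)" if "\<omega> \<in> space P" for \<omega>
        using k(2)[OF d] nonneg[OF d(1) that] by (intro Bochner_Integration.integral_nonneg) auto
      show "AE \<omega> in P. integrable lborel (\<lambda>s. k d t s * Y d s \<omega>)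
          \<and> (LINT s|lborel. k d t s * Y d s \<omega>) \<le> (LINT s|lborel. k d t s * Y d s \<omega>)"
      proof (rule AE_I2)
        fix \<omega> assume \<omega>: "\<omega> \<in> space P"
        obtain L where L: "\<And>s. s \<in> {0..T} \<Longrightarrow> Y d s \<omega> \<le> L" using bounded[OF d(1) \<omega>] by blast
        have [measurable]: "(\<lambda>s. Y d s \<omega>) \<in> borel_measurable lborel"
          using measurable_compose[OF measurable_Pair2'[OF \<omega>] joint[OF d(1)]] by simp
        have "integrable lborel (\<lambda>s. k d t s * Y d s \<omega>)"
        proof (rule Bochner_Integration.integrable_bound[of _ "\<lambda>s. k d t s * L"])
          show "AE s in lborel. norm (k d t s * Y d s \<omega>) \<le> norm (k d t s * L)"
          proof (rule AE_I2)
            fix s :: real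
            show "norm (k d t s * Y d s \<omega>) \<le> norm (k d t s * L)"
            proof (cases "s \<in> {0..T}")
              case True
              then have "\<bar>Y d s \<omega>\<bar> \<le> \<bar>L\<bar>" using L[OF True] nonneg[OF d(1) \<omega>, of s] by simp
              then show ?thesis by (simp add: abs_mult mult_left_mono)
            qed (use k(4)[OF d] in simp)
          qed
        qed (use k(1)[OF d] in auto)
        then show "integrable lborel (\<lambda>s. k d t s * Y d s \<omega>)
          \<and> (LINT s|lborel. k d t s * Y d s \<omega>) \<le> (LINT s|lborel. k d t s * Y d s \<omega>)" by simp
      qed
    qed
    then show "moment_le P q (\<lambda>\<omega>. LINT s|lborel. k d t s * Y d s \<omega>) (\<kappa> powr q * K * e d powr q)"
      by (simp add: mult.assoc)
  qed (use K in simp)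
qed

end

section \<open>The processes\<close>

text \<open>All processes are indexed by \<open>\<real>\<close>, as one obtains by freezing them outside of \<open>[0, T]\<close>; this keeps
  joint measurability statements free of the interval.\<close>

locale spde_scheme = spde_coefficients B \<mu> \<delta> T c varphi \<epsilon> \<rho> \<gamma> chi V normV cV cH \<phi> \<Phi> F + prob_space P
  for B :: "'h::{real_inner, banach, second_countable_topology} set" and \<mu> \<delta> T c varphi \<epsilon> \<rho> \<gamma> chi
    V normV cV cH \<phi> \<Phi> F and P :: "'w measure" +
  fixes \<D> :: "'h set set" and X O\<^sub>0 :: "real \<Rightarrow> 'w \<Rightarrow> 'h" and \<O> \<X> :: "nat \<Rightarrow> 'h set \<Rightarrow> real \<Rightarrow> 'w \<Rightarrow> 'h"
    and vartheta p varrho :: real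
  assumes D: "\<And>I. I \<in> \<D> \<Longrightarrow> finite I" "\<And>I. I \<in> \<D> \<Longrightarrow> I \<subseteq> B"
    and X_process: "\<And>t. X t \<in> P \<rightarrow>\<^sub>M metric_borel (norm_metric V normV)"
    and X_V: "\<And>t \<omega>. \<omega> \<in> space P \<Longrightarrow> X t \<omega> \<in> V"
    and X_continuous: "\<And>\<omega>. \<omega> \<in> space P \<Longrightarrow> continuous_map euclideanreal (mtopology_of (norm_metric V normV)) (\<lambda>t. X t \<omega>)"
    and O_process: "\<And>t. O\<^sub>0 t \<in> P \<rightarrow>\<^sub>M metric_borel (norm_metric V normV)"
    and O_V: "\<And>t \<omega>. \<omega> \<in> space P \<Longrightarrow> O\<^sub>0 t \<omega> \<in> V"
    and O_continuous: "\<And>\<omega>. \<omega> \<in> space P \<Longrightarrow> continuous_map euclideanreal (mtopology_of (norm_metric V normV)) (\<lambda>t. O\<^sub>0 t \<omega>)"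
    and noise_process: "\<And>M I t. 1 \<le> M \<Longrightarrow> I \<in> \<D> \<Longrightarrow> \<O> M I t \<in> P \<rightarrow>\<^sub>M metric_borel (interp_metric B \<mu> 1)"
    and noise_path: "\<And>M I \<omega>. 1 \<le> M \<Longrightarrow> I \<in> \<D> \<Longrightarrow> \<omega> \<in> space P \<Longrightarrow>
      restrict (\<lambda>t. \<O> M I t \<omega>) {0..T} \<in> mspace (path_metric T (interp_metric B \<mu> 1))"
    and noise_span: "\<And>M I t \<omega>. 1 \<le> M \<Longrightarrow> I \<in> \<D> \<Longrightarrow> \<omega> \<in> space P \<Longrightarrow> span_proj I (\<O> M I t \<omega>) = \<O> M I t \<omega>"
    and scheme_process: "\<And>M I t. 1 \<le> M \<Longrightarrow> I \<in> \<D> \<Longrightarrow> \<X> M I t \<in> P \<rightarrow>\<^sub>M metric_borel (interp_metric B \<mu> \<gamma>)"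
    and scheme_space: "\<And>M I t \<omega>. 1 \<le> M \<Longrightarrow> I \<in> \<D> \<Longrightarrow> \<omega> \<in> space P \<Longrightarrow> \<X> M I t \<omega> \<in> interp_space B \<mu> \<gamma>"
    and mild_solution: "\<And>t. t \<in> {0..T} \<Longrightarrow> AE \<omega> in P. X t \<omega> =
        (LINT s:{0..t}|lborel. diag_semigroup B \<mu> (t - s) (F (X s \<omega>))) + O\<^sub>0 t \<omega>"
    and scheme: "\<And>M I t. 1 \<le> M \<Longrightarrow> I \<in> \<D> \<Longrightarrow> t \<in> {0..T} \<Longrightarrow> AE \<omega> in P. \<X> M I t \<omega> =
        (LINT s:{0..t}|lborel. span_proj I (diag_semigroup B \<mu> (t - s)
          (of_bool (interp_norm B \<mu> \<gamma> (\<X> M I (grid_floor (T / M) s) \<omega>)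
                    + interp_norm B \<mu> \<gamma> (\<O> M I (grid_floor (T / M) s) \<omega>) \<le> (M / T) powr chi)
           *\<^sub>R F (\<X> M I (grid_floor (T / M) s) \<omega>)))) + \<O> M I t \<omega>"
    and vartheta_pos: "0 < vartheta" and p: "2 \<le> p" "1 \<le> p * varphi"
    and varrho: "0 \<le> varrho" "varrho < 1 - \<rho>"
    and X_moment: "\<exists>K. \<forall>t\<in>{0..T}. (\<integral>\<^sup>+\<omega>. ennreal (normV (X t \<omega>) powr (p * (1 + varphi/2) * max 2 varphi)) \<partial>P) \<le> ennreal K"
    and PO_moment: "\<exists>K. \<forall>t\<in>{0..T}. \<forall>I\<in>\<D>. (\<integral>\<^sup>+\<omega>. ennreal (normV (span_proj I (O\<^sub>0 t \<omega>)) powr (p * varphi)) \<partial>P) \<le> ennreal K"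
    and noise_moment: "\<exists>K. \<forall>M\<ge>1. \<forall>I\<in>\<D>. \<forall>t\<in>{0..T}. (\<integral>\<^sup>+\<omega>. ennreal
        (\<bar>(interp_norm B \<mu> \<gamma> (\<O> M I t \<omega>))\<^sup>2 + \<Phi> (restrict (\<lambda>t. \<O> M I t \<omega>) {0..T}) + \<phi> (restrict (\<lambda>t. \<O> M I t \<omega>) {0..T})\<bar>
           powr (p * Max {2 * vartheta, 2 + varphi, (1 + varphi/2) * varphi / 2})) \<partial>P) \<le> ennreal K"
begin

lemma X_measurable:
  fixes f :: "'h \<Rightarrow> 'b::real_normed_vector"
  assumes "continuous_map (mtopology_of (norm_metric V normV)) euclidean f"
  shows "(\<lambda>\<omega>. f (X t \<omega>)) \<in> borel_measurable P" "(\<lambda>\<omega>. f (O\<^sub>0 t \<omega>)) \<in> borel_measurable P"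
    "1 \<le> M \<Longrightarrow> I \<in> \<D> \<Longrightarrow> (\<lambda>\<omega>. f (\<X> M I t \<omega>)) \<in> borel_measurable P"
  using borel_measurable_metric_borel[OF X_process assms] borel_measurable_metric_borel[OF O_process assms]
    borel_measurable_metric_borel[OF scheme_process continuous_map_gamma[OF assms]] by auto

lemma path_continuous:
  fixes f :: "'h \<Rightarrow> 'b::real_normed_vector"
  assumes "continuous_map (mtopology_of (norm_metric V normV)) euclidean f" "\<omega> \<in> space P"
  shows "continuous_on A (\<lambda>t. f (X t \<omega>))" "continuous_on A (\<lambda>t. f (O\<^sub>0 t \<omega>))"
  using continuous_map_compose[OF X_continuous[OF assms(2)] assms(1)]
    continuous_map_compose[OF O_continuous[OF assms(2)] assms(1)]
  by (auto simp: o_def intro: continuous_on_subset)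

text \<open>The equation holds almost surely at each single time. A countable dense set of times has a common
  null set, off which the continuity in \<open>t\<close> of every coordinate gives the equation at all times.\<close>

lemma mild_solution_coordinates:
  "AE \<omega> in P. \<forall>t\<in>{0..T}. \<forall>i\<in>B. i \<bullet> X t \<omega> = duhamel (- \<mu> i) (\<lambda>s. i \<bullet> F (X s \<omega>)) t + i \<bullet> O\<^sub>0 t \<omega>"
proof -
  obtain Q where Q: "countable Q" "Q \<subseteq> {0..T}" "{0..T} \<subseteq> closure Q"
    using separable by blast
  have "AE \<omega> in P. \<forall>t\<in>Q. X t \<omega> = (LINT s:{0..t}|lborel. diag_semigroup B \<mu> (t - s) (F (X s \<omega>))) + O\<^sub>0 t \<omega>"
    unfolding AE_ball_countable[OF Q(1)] using Q(2) mild_solution by blast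
  with AE_space show ?thesis
  proof eventually_elim
    case (elim \<omega>)
    show ?case
    proof (intro ballI)
      fix t i assume t: "t \<in> {0..T}" and i: "i \<in> B"
      have cF: "continuous_on A (\<lambda>s. F (X s \<omega>))" for A by (rule path_continuous(1)[OF F_continuous elim(1)])
      define g where "g t = i \<bullet> X t \<omega> - duhamel (- \<mu> i) (\<lambda>s. i \<bullet> F (X s \<omega>)) t - i \<bullet> O\<^sub>0 t \<omega>" for t
      have "closure Q \<subseteq> {0..T}" using Q(2) by (intro closure_minimal) auto
      then have cl: "closure Q = {0..T}" using Q(3) by auto
      have "g t = 0"
      proof (rule continuous_constant_on_closure[of Q g 0 t])
        show "continuous_on (closure Q) g"
          unfolding g_def cl
          by (intro continuous_intros continuous_on_duhamel borel_integrable_atLeastAtMost' cF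
              path_continuous[OF continuous_map_V_inclusion elim(1)])
        show "t \<in> closure Q" using t cl by simp
        show "g u = 0" if "u \<in> Q" for u
        proof -
          have "i \<bullet> X u \<omega> = i \<bullet> (LINT s:{0..u}|lborel. diag_semigroup B \<mu> (u - s) (F (X s \<omega>))) + i \<bullet> O\<^sub>0 u \<omega>"
            using elim(2) that by (metis inner_add_right)
          then show ?thesis by (simp add: g_def inner_semigroup_convolution[OF cF i])
        qed
      qed
      then show "i \<bullet> X t \<omega> = duhamel (- \<mu> i) (\<lambda>s. i \<bullet> F (X s \<omega>)) t + i \<bullet> O\<^sub>0 t \<omega>" by (simp add: g_def)
    qed
  qed
qed

definition force :: "nat \<Rightarrow> 'h set \<Rightarrow> 'w \<Rightarrow> real \<Rightarrow> 'h" where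
  "force M I \<omega> = truncated_force (T / M) (\<lambda>t. \<X> M I t \<omega>) (\<lambda>t. \<O> M I t \<omega>)"

definition drift :: "nat \<Rightarrow> 'h set \<Rightarrow> real \<Rightarrow> 'w \<Rightarrow> 'h" where
  "drift M I t \<omega> = convolution I (force M I \<omega>) t"

lemma step_pos: "1 \<le> M \<Longrightarrow> 0 < T / real M"
  using T_pos by simp

lemma scheme_drift:
  assumes M: "1 \<le> M" and I: "I \<in> \<D>" and t: "t \<in> {0..T}"
  shows "AE \<omega> in P. \<X> M I t \<omega> = drift M I t \<omega> + \<O> M I t \<omega>"
  using scheme[OF assms]
proof eventually_elim
  case (elim \<omega>)
  have powr: "(M / T) powr chi = (T / M) powr (- chi)"
    using M T_pos by (simp add: powr_minus powr_divide)
  have f: "force M I \<omega> s = of_bool (interp_norm B \<mu> \<gamma> (\<X> M I (grid_floor (T / M) s) \<omega>)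
                    + interp_norm B \<mu> \<gamma> (\<O> M I (grid_floor (T / M) s) \<omega>) \<le> (M / T) powr chi)
           *\<^sub>R F (\<X> M I (grid_floor (T / M) s) \<omega>)" for s
    by (simp add: force_def truncated_force_def powr)
  have int: "integrable lborel (\<lambda>s. indicator {0..t} s *\<^sub>R (exp (- (- \<mu> i * (t - s))) * (i \<bullet> force M I \<omega> s)))" for i
    using set_integrable_duhamel[OF truncated_force_set_integrable[OF step_pos[OF M]], of 0 t "- \<mu> i" t i] t
    by (simp add: set_integrable_def force_def)
  have "(LINT s:{0..t}|lborel. span_proj I (diag_semigroup B \<mu> (t - s) (force M I \<omega> s)))
      = (LINT s|lborel. (\<Sum>i\<in>I. (indicator {0..t} s *\<^sub>R (exp (- (- \<mu> i * (t - s))) * (i \<bullet> force M I \<omega> s))) *\<^sub>R i))"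
    unfolding set_lebesgue_integral_def
  proof (rule Bochner_Integration.integral_cong)
    fix s :: real
    show "indicator {0..t} s *\<^sub>R span_proj I (diag_semigroup B \<mu> (t - s) (force M I \<omega> s))
        = (\<Sum>i\<in>I. (indicator {0..t} s *\<^sub>R (exp (- (- \<mu> i * (t - s))) * (i \<bullet> force M I \<omega> s))) *\<^sub>R i)"
      using D(2)[OF I] by (auto simp: indicator_def span_proj_semigroup mult.commute)
  qed simp
  also have "\<dots> = drift M I t \<omega>"
    unfolding drift_def convolution_def duhamel_def set_lebesgue_integral_def
    by (subst Bochner_Integration.integral_sum)
      (intro integrable_scaleR_left int, intro sum.cong refl integral_scaleR_left int)
  finally show ?case using elim by (simp add: f)
qed

text \<open>The exceptional set of the scheme may depend on the time, but only the finitely many grid points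
  matter.\<close>

lemma scheme_path_AE:
  assumes M: "1 \<le> M" and I: "I \<in> \<D>"
  shows "AE \<omega> in P. scheme_path (T / M) I (\<lambda>t. \<O> M I t \<omega>) (\<lambda>t. \<X> M I t \<omega>)"
proof -
  note h = step_pos[OF M]
  have "AE \<omega> in P. \<forall>u\<in>grid_floor (T / M) ` {0..T}. \<X> M I u \<omega> = drift M I u \<omega> + \<O> M I u \<omega>"
  proof (rule AE_finite_allI[OF finite_grid[OF h]])
    fix u assume "u \<in> grid_floor (T / M) ` {0..T}"
    then obtain s where s: "s \<in> {0..T}" "u = grid_floor (T / M) s" by blast
    have "u \<in> {0..T}" using grid_floor_bounds[OF h, of s] s by auto
    then show "AE \<omega> in P. \<X> M I u \<omega> = drift M I u \<omega> + \<O> M I u \<omega>" by (rule scheme_drift[OF M I])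
  qed
  with AE_space show ?thesis
  proof eventually_elim
    case (elim \<omega>)
    have "T / M \<le> T" using M T_pos by (simp add: field_simps)
    then show ?case
      using elim h D[OF I] noise_span[OF M I elim(1)]
      by (simp add: scheme_path_def drift_def force_def)
  qed
qed

section \<open>Measurability of the scheme\<close>

lemma noise_measurable: "1 \<le> M \<Longrightarrow> I \<in> \<D> \<Longrightarrow> (\<lambda>\<omega>. \<O> M I t \<omega>) \<in> borel_measurable P"
  by (rule borel_measurable_metric_borel[OF noise_process continuous_map_H1_inclusion])

lemma continuous_section_measurable:
  fixes G :: "'h \<Rightarrow> 'b::topological_space"
  assumes "continuous_on UNIV G" "U \<in> borel_measurable P"
  shows "(\<lambda>\<omega>. G (U \<omega>)) \<in> borel_measurable P"
  using measurable_compose[OF assms(2) borel_measurable_continuous_onI[OF assms(1)]] .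

lemma scheme_norm_measurable: "1 \<le> M \<Longrightarrow> I \<in> \<D> \<Longrightarrow> (\<lambda>\<omega>. interp_norm B \<mu> \<gamma> (\<X> M I t \<omega>)) \<in> borel_measurable P"
  by (rule borel_measurable_metric_borel[OF scheme_process continuous_map_gamma_norm])

lemma noise_norm_measurable:
  assumes "1 \<le> M" "I \<in> \<D>"
  shows "(\<lambda>\<omega>. interp_norm B \<mu> \<gamma> (\<O> M I t \<omega>)) \<in> borel_measurable P"
proof -
  have "(\<lambda>\<omega>. interp_norm B \<mu> \<gamma> (span_proj I (\<O> M I t \<omega>))) \<in> borel_measurable P"
    by (rule continuous_section_measurable[OF continuous_on_interp_norm_span_proj[OF D[OF assms(2)]] noise_measurable[OF assms]])
  then show ?thesis by (rule measurable_cong[THEN iffD1, rotated]) (simp add: noise_span[OF assms])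
qed

lemma force_jointly_measurable:
  assumes "1 \<le> M" "I \<in> \<D>"
  shows "(\<lambda>(s, \<omega>). force M I \<omega> s) \<in> borel_measurable (lborel \<Otimes>\<^sub>M P)"
proof -
  have "(\<lambda>\<omega>. of_bool (interp_norm B \<mu> \<gamma> (\<X> M I u \<omega>) + interp_norm B \<mu> \<gamma> (\<O> M I u \<omega>) \<le> (T / M) powr (- chi))
      *\<^sub>R F (\<X> M I u \<omega>)) \<in> borel_measurable P" for u
  proof -
    note [measurable] = scheme_norm_measurable[OF assms, of u] noise_norm_measurable[OF assms, of u]
      X_measurable(3)[OF F_continuous assms, of u]
    have "(\<lambda>\<omega>. if interp_norm B \<mu> \<gamma> (\<X> M I u \<omega>) + interp_norm B \<mu> \<gamma> (\<O> M I u \<omega>) \<le> (T / M) powr (- chi)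
        then F (\<X> M I u \<omega>) else 0) \<in> borel_measurable P" by measurable
    then show ?thesis by (rule measurable_cong[THEN iffD1, rotated]) simp
  qed
  then show ?thesis
    unfolding force_def truncated_force_def
    by (rule measurable_grid_floor_compose[OF step_pos[OF assms(1)],
          where G="\<lambda>u \<omega>. of_bool (interp_norm B \<mu> \<gamma> (\<X> M I u \<omega>) + interp_norm B \<mu> \<gamma> (\<O> M I u \<omega>) \<le> (T / M) powr (- chi))
            *\<^sub>R F (\<X> M I u \<omega>)"])
qed

lemma force_measurable:
  assumes "1 \<le> M" "I \<in> \<D>"
  shows "(\<lambda>\<omega>. force M I \<omega> s) \<in> borel_measurable P"
  using measurable_compose[OF measurable_Pair1'[of s lborel P] force_jointly_measurable[OF assms]] by simp

lemma drift_measurable: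
  assumes "1 \<le> M" "I \<in> \<D>"
  shows "drift M I t \<in> borel_measurable P"
proof -
  have "(\<lambda>\<omega>. duhamel (- \<mu> i) (\<lambda>s. i \<bullet> force M I \<omega> s) t) \<in> borel_measurable P" for i
    unfolding duhamel_def set_lebesgue_integral_def
  proof (rule lborel.borel_measurable_lebesgue_integral)
    have [measurable]: "(\<lambda>(\<omega>, s). force M I \<omega> s) \<in> borel_measurable (P \<Otimes>\<^sub>M lborel)"
      using measurable_compose[OF measurable_pair_swap'[of P lborel] force_jointly_measurable[OF assms]]
      by (simp add: split_beta')
    show "(\<lambda>(\<omega>, s). indicator {0..t} s *\<^sub>R (exp (- (- \<mu> i * (t - s))) * (i \<bullet> force M I \<omega> s)))
        \<in> borel_measurable (P \<Otimes>\<^sub>M lborel)"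
      by measurable
  qed
  then show ?thesis
    unfolding drift_def[abs_def] convolution_def
    by (intro borel_measurable_sum borel_measurable_scaleR borel_measurable_const)
qed

lemma span_proj_drift: "I \<in> \<D> \<Longrightarrow> span_proj I (drift M I t \<omega>) = drift M I t \<omega>"
  using D by (simp add: drift_def)

section \<open>Moments of the scheme\<close>

text \<open>The integrability of \<open>\<parallel>\<O>\<^sub>t\<parallel>\<^sub>\<gamma>\<^sup>2 + \<Phi>(\<O>) + \<phi>(\<O>)\<close>. The norms \<open>\<parallel>\<O>\<^sub>t\<parallel>\<^sub>\<gamma>\<close> and \<open>\<parallel>\<X>\<^sub>t\<parallel>\<^sub>\<gamma>\<close> have twice as many moments.\<close>

definition qN :: real where
  "qN = p * Max {2 * vartheta, 2 + varphi, (1 + varphi/2) * varphi / 2}"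

lemma qN_ge: "2 * vartheta * p \<le> qN" "p * (2 + varphi) \<le> qN" "0 < qN"
proof -
  have "2 * vartheta \<le> Max {2 * vartheta, 2 + varphi, (1 + varphi/2) * varphi / 2}"
    "2 + varphi \<le> Max {2 * vartheta, 2 + varphi, (1 + varphi/2) * varphi / 2}" by (auto intro: Max_ge)
  then show *: "2 * vartheta * p \<le> qN" "p * (2 + varphi) \<le> qN"
    using p(1) by (auto simp: qN_def mult.commute[of _ p] intro!: mult_left_mono)
  have "0 < p * (2 + varphi)" using p(1) varphi_pos by simp
  with *(2) show "0 < qN" by linarith
qed

text \<open>By the a priori bound \<open>\<parallel>\<X>\<^sub>t\<parallel>\<^sub>\<gamma>\<^sup>2\<close> is at most an affine function of
  \<open>\<parallel>\<O>\<^sub>t\<parallel>\<^sub>\<gamma>\<^sup>2 + \<Phi>(\<O>) + \<phi>(\<O>)\<close>.\<close>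

lemma scheme_moments:
  "\<exists>K\<ge>0. \<forall>M\<ge>1. \<forall>I\<in>\<D>. \<forall>t\<in>{0..T}.
    moment_le P (2 * qN) (\<lambda>\<omega>. interp_norm B \<mu> \<gamma> (\<O> M I t \<omega>)) K \<and>
    moment_le P (2 * qN) (\<lambda>\<omega>. interp_norm B \<mu> \<gamma> (\<X> M I t \<omega>)) K"
proof -
  define W where "W M I t \<omega> = \<bar>(interp_norm B \<mu> \<gamma> (\<O> M I t \<omega>))\<^sup>2 + \<Phi> (restrict (\<lambda>t. \<O> M I t \<omega>) {0..T})
    + \<phi> (restrict (\<lambda>t. \<O> M I t \<omega>) {0..T})\<bar>" for M I t \<omega>
  obtain K0 where "\<forall>M\<ge>1. \<forall>I\<in>\<D>. \<forall>t\<in>{0..T}. (\<integral>\<^sup>+\<omega>. ennreal (W M I t \<omega> powr qN) \<partial>P) \<le> ennreal K0"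
    using noise_moment unfolding W_def qN_def by blast
  then have K: "(\<integral>\<^sup>+\<omega>. ennreal (W M I t \<omega> powr qN) \<partial>P) \<le> ennreal (max 0 K0)"
    if "1 \<le> M" "I \<in> \<D>" "t \<in> {0..T}" for M I t
    using that by (meson ennreal_leI max.cobounded2 order_trans)
  define C1 where "C1 = 2 * ((\<delta> powr (\<gamma> - 1/2))\<^sup>2 * energy_const) + 2"
  have C1: "2 \<le> C1" using energy_const_pos by (simp add: C1_def)
  define b where "b = C1 powr qN * 2 powr qN"
  have b: "1 \<le> b" unfolding b_def using C1 qN_ge(3) by (intro mult_ge1_I ge_one_powr_ge_zero) auto
  have W0: "0 \<le> W M I t \<omega>" for M I t \<omega> by (simp add: W_def)
  have powr: "z powr (2 * qN) \<le> b + b * W M I t \<omega> powr qN" if z: "0 \<le> z" "z\<^sup>2 \<le> C1 * (1 + W M I t \<omega>)" for z M I t \<omega>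
  proof -
    have "z\<^sup>2 = z powr 2" using z(1) by (cases "z = 0") simp_all
    then have "z powr (2 * qN) = (z\<^sup>2) powr qN" by (simp only: powr_powr)
    also have "\<dots> \<le> (C1 * (1 + W M I t \<omega>)) powr qN" using z qN_ge(3) by (intro powr_mono2) auto
    also have "\<dots> = C1 powr qN * (1 + W M I t \<omega>) powr qN" using C1 W0[of M I t \<omega>] by (simp add: powr_mult)
    also have "\<dots> \<le> C1 powr qN * (2 powr qN * (1 powr qN + W M I t \<omega> powr qN))"
      using W0 qN_ge(3) by (intro mult_left_mono powr_add_le) auto
    finally show ?thesis by (simp add: b_def algebra_simps)
  qed
  have mom: "moment_le P (2 * qN) Z (b + b * max 0 K0)"
    if "1 \<le> M" "I \<in> \<D>" "t \<in> {0..T}" and Z: "Z \<in> borel_measurable P" "\<And>\<omega>. 0 \<le> Z \<omega>"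
      and le: "AE \<omega> in P. (Z \<omega>)\<^sup>2 \<le> C1 * (1 + W M I t \<omega>)" for Z M I t
    unfolding moment_le_def
  proof (intro conjI ballI)
    show "(\<integral>\<^sup>+\<omega>. ennreal (Z \<omega> powr (2 * qN)) \<partial>P) \<le> ennreal (b + b * max 0 K0)"
    proof (rule nn_integral_le_affine[where Y="\<lambda>\<omega>. W M I t \<omega> powr qN"])
      show "AE \<omega> in P. Z \<omega> powr (2 * qN) \<le> b + b * W M I t \<omega> powr qN"
        using le by eventually_elim (rule powr[OF Z(2)])
    qed (use Z b K[OF that(1-3)] in auto)
  qed (use Z b in auto)
  show ?thesis
  proof (intro exI[of _ "b + b * max 0 K0"] conjI allI impI ballI)
    show "0 \<le> b + b * max 0 K0" using b by simp
    fix M I t assume *: "(1::nat) \<le> M" "I \<in> \<D>" "t \<in> {0..T}"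
    have parts: "(interp_norm B \<mu> \<gamma> (\<O> M I t \<omega>))\<^sup>2 \<le> W M I t \<omega>"
      "1 + \<Phi> (restrict (\<lambda>t. \<O> M I t \<omega>) {0..T}) + \<phi> (restrict (\<lambda>t. \<O> M I t \<omega>) {0..T}) \<le> 1 + W M I t \<omega>"
      if "\<omega> \<in> space P" for \<omega>
      using phi_nonneg[OF noise_path[OF *(1,2) that]] Phi_nonneg[OF noise_path[OF *(1,2) that]]
      unfolding W_def by auto
    show "moment_le P (2 * qN) (\<lambda>\<omega>. interp_norm B \<mu> \<gamma> (\<O> M I t \<omega>)) (b + b * max 0 K0)"
    proof (rule mom[OF * noise_norm_measurable[OF *(1,2)] interp_norm_nonneg], rule AE_I2)
      fix \<omega> assume "\<omega> \<in> space P"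
      have "W M I t \<omega> \<le> 1 * (1 + W M I t \<omega>)" by simp
      also have "\<dots> \<le> C1 * (1 + W M I t \<omega>)" using C1 W0[of M I t \<omega>] by (intro mult_right_mono) auto
      finally show "(interp_norm B \<mu> \<gamma> (\<O> M I t \<omega>))\<^sup>2 \<le> C1 * (1 + W M I t \<omega>)"
        using parts(1)[OF \<open>\<omega> \<in> space P\<close>] by linarith
    qed
    show "moment_le P (2 * qN) (\<lambda>\<omega>. interp_norm B \<mu> \<gamma> (\<X> M I t \<omega>)) (b + b * max 0 K0)"
    proof (rule mom[OF * scheme_norm_measurable[OF *(1,2)] interp_norm_nonneg])
      show "AE \<omega> in P. (interp_norm B \<mu> \<gamma> (\<X> M I t \<omega>))\<^sup>2 \<le> C1 * (1 + W M I t \<omega>)"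
        using AE_space scheme_drift[OF *] scheme_path_AE[OF *(1,2)]
      proof eventually_elim
        case (elim \<omega>)
        let ?N = "drift M I t \<omega>"
        have mem: "?N \<in> interp_space B \<mu> r" "\<O> M I t \<omega> \<in> interp_space B \<mu> r" for r
          using interp_space_span_proj[OF D[OF *(2)], of ?N] interp_space_span_proj[OF D[OF *(2)], of "\<O> M I t \<omega>"]
          by (simp_all only: span_proj_drift[OF *(2)] noise_span[OF *(1,2) elim(1)])
        define n where "n = interp_norm B \<mu> \<gamma> (\<O> M I t \<omega>)"
        define k where "k = interp_norm B \<mu> \<gamma> ?N"
        have half: "(interp_norm B \<mu> (1/2) ?N)\<^sup>2 \<le> energy_const * (1 + W M I t \<omega>)"
          using a_priori_bound[OF elim(3) noise_path[OF *(1,2) elim(1)] *(3)]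
            mult_left_mono[OF parts(2)[OF elim(1)], of energy_const] energy_const_pos
          unfolding drift_def force_def by linarith
        have "k \<le> \<delta> powr (\<gamma> - 1/2) * interp_norm B \<mu> (1/2) ?N"
          unfolding k_def by (rule interp_space_mono(2)[OF mem(1) gamma(2)])
        then have "k\<^sup>2 \<le> (\<delta> powr (\<gamma> - 1/2) * interp_norm B \<mu> (1/2) ?N)\<^sup>2" by (intro power_mono) (auto simp: k_def)
        also have "\<dots> = (\<delta> powr (\<gamma> - 1/2))\<^sup>2 * (interp_norm B \<mu> (1/2) ?N)\<^sup>2" by (rule power_mult_distrib)
        also have "\<dots> \<le> (\<delta> powr (\<gamma> - 1/2))\<^sup>2 * (energy_const * (1 + W M I t \<omega>))" using half by (intro mult_left_mono) auto
        finally have k2: "k\<^sup>2 \<le> (\<delta> powr (\<gamma> - 1/2))\<^sup>2 * energy_const * (1 + W M I t \<omega>)" by (simp add: mult.assoc)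
        have n2: "n\<^sup>2 \<le> 1 + W M I t \<omega>" using parts(1)[OF elim(1)] by (simp add: n_def)
        have "interp_norm B \<mu> \<gamma> (\<X> M I t \<omega>) \<le> k + n"
          unfolding elim(2) k_def n_def by (rule norm_on_triangle[OF norm_on_interp_space mem])
        then have "(interp_norm B \<mu> \<gamma> (\<X> M I t \<omega>))\<^sup>2 \<le> (k + n)\<^sup>2" by (intro power_mono) auto
        also have "\<dots> \<le> 2 * k\<^sup>2 + 2 * n\<^sup>2" using sum_squares_bound[of k n] by (simp add: power2_sum)
        also have "\<dots> \<le> 2 * ((\<delta> powr (\<gamma> - 1/2))\<^sup>2 * energy_const * (1 + W M I t \<omega>)) + 2 * (1 + W M I t \<omega>)"
          using k2 n2 by (intro add_mono mult_left_mono) auto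
        also have "\<dots> = C1 * (1 + W M I t \<omega>)" by (simp add: C1_def algebra_simps)
        finally show ?case .
      qed
    qed
  qed
qed

section \<open>Solution and drift uniformly over the discretisations\<close>

text \<open>A discretisation together with a number \<open>e\<close> that dominates every term on the right-hand side of
  the error estimate. Such an \<open>e\<close> plays the role of the rate: the estimate holds with one constant if
  the error is of order \<open>e\<close> uniformly over all these triples.\<close>

definition discs :: "(nat \<times> 'h set \<times> real) set" where
  "discs = {(M, I, e). 1 \<le> M \<and> I \<in> \<D> \<and> 0 < e \<and> real M powr (- min (vartheta * chi) varrho) \<le> e \<and>
    (\<forall>i\<in>B - I. (- \<mu> i) powr (- varrho) \<le> e) \<and>
    (\<forall>t\<in>{0..T}. moment_le P (2 * p) (\<lambda>\<omega>. normV (O\<^sub>0 t \<omega> - span_proj I (O\<^sub>0 t \<omega>))) (e powr (2 * p)) \<and>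
      moment_le P (2 * p) (\<lambda>\<omega>. normV (span_proj I (O\<^sub>0 t \<omega>) - \<O> M I t \<omega>)) (e powr (2 * p)) \<and>
      moment_le P (2 * p) (\<lambda>\<omega>. normV (span_proj I (O\<^sub>0 t \<omega> - O\<^sub>0 (grid_floor (T / M) t) \<omega>))) (e powr (2 * p)))}"

sublocale moment_family P discs T
  by unfold_locales (use T_pos in simp)

abbreviation "steps d \<equiv> fst d"
abbreviation "modes d \<equiv> fst (snd d)"
abbreviation "rate d \<equiv> snd (snd d)"

lemma discsD:
  assumes "d \<in> discs"
  shows "1 \<le> steps d" "modes d \<in> \<D>" "0 < rate d" "real (steps d) powr (- min (vartheta * chi) varrho) \<le> rate d"
    "\<And>i. i \<in> B \<Longrightarrow> i \<notin> modes d \<Longrightarrow> (- \<mu> i) powr (- varrho) \<le> rate d"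
  using assms by (auto simp: discs_def)

lemma discs_modes: "d \<in> discs \<Longrightarrow> finite (modes d)" "d \<in> discs \<Longrightarrow> modes d \<subseteq> B"
  using discsD(2) D by auto

lemma rate_nonneg: "d \<in> discs \<Longrightarrow> 0 \<le> rate d"
  using discsD(3) by (simp add: less_imp_le)

lemma discs_noise_moments:
  "morder (2 * p) rate (\<lambda>d t \<omega>. normV (O\<^sub>0 t \<omega> - span_proj (modes d) (O\<^sub>0 t \<omega>)))"
  "morder (2 * p) rate (\<lambda>d t \<omega>. normV (span_proj (modes d) (O\<^sub>0 t \<omega>) - \<O> (steps d) (modes d) t \<omega>))"
  "morder (2 * p) rate (\<lambda>d t \<omega>. normV (span_proj (modes d) (O\<^sub>0 t \<omega> - O\<^sub>0 (grid_floor (T / real (steps d)) t) \<omega>)))"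
  by (rule morderI[of 1]; force simp: discs_def)+

lemma grid_floor_time: "d \<in> discs \<Longrightarrow> t \<in> {0..T} \<Longrightarrow> grid_floor (T / real (steps d)) t \<in> {0..T}"
  using grid_floor_bounds[OF step_pos[OF discsD(1)], of d t] by auto

lemma scheme_morder:
  "morder (2 * qN) (\<lambda>_. 1) (\<lambda>d t \<omega>. interp_norm B \<mu> \<gamma> (\<O> (steps d) (modes d) t \<omega>))"
  "morder (2 * qN) (\<lambda>_. 1) (\<lambda>d t \<omega>. interp_norm B \<mu> \<gamma> (\<X> (steps d) (modes d) t \<omega>))"
proof -
  obtain K where "0 \<le> K" "\<forall>M\<ge>1. \<forall>I\<in>\<D>. \<forall>t\<in>{0..T}.
    moment_le P (2 * qN) (\<lambda>\<omega>. interp_norm B \<mu> \<gamma> (\<O> M I t \<omega>)) K \<and>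
    moment_le P (2 * qN) (\<lambda>\<omega>. interp_norm B \<mu> \<gamma> (\<X> M I t \<omega>)) K"
    using scheme_moments by blast
  then show "morder (2 * qN) (\<lambda>_. 1) (\<lambda>d t \<omega>. interp_norm B \<mu> \<gamma> (\<O> (steps d) (modes d) t \<omega>))"
    "morder (2 * qN) (\<lambda>_. 1) (\<lambda>d t \<omega>. interp_norm B \<mu> \<gamma> (\<X> (steps d) (modes d) t \<omega>))"
    using discsD(1,2) by (auto intro!: morderI[of K])
qed

definition qX :: real where "qX = p * (1 + varphi/2) * max 2 varphi"

lemma qX_ge: "2 * p * (1 + varphi/2) \<le> qX" "p * varphi * (1 + varphi/2) \<le> qX" "p * varphi \<le> qX"
proof -
  have a: "0 \<le> p * (1 + varphi/2)" using p(1) varphi_pos by simp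
  have "2 * p * (1 + varphi/2) = p * (1 + varphi/2) * 2" "p * varphi * (1 + varphi/2) = p * (1 + varphi/2) * varphi" by simp_all
  then show "2 * p * (1 + varphi/2) \<le> qX" "p * varphi * (1 + varphi/2) \<le> qX"
    unfolding qX_def by (simp_all only:) (intro mult_left_mono a max.cobounded1 max.cobounded2)+
  have "p * varphi * 1 \<le> p * varphi * (1 + varphi/2)" using p varphi_pos by (intro mult_left_mono) auto
  with \<open>p * varphi * (1 + varphi/2) \<le> qX\<close> show "p * varphi \<le> qX" by simp
qed

lemma X_morder: "morder qX (\<lambda>_. 1) (\<lambda>d t \<omega>. normV (X t \<omega>))"
proof -
  obtain K where K: "\<forall>t\<in>{0..T}. (\<integral>\<^sup>+\<omega>. ennreal (normV (X t \<omega>) powr qX) \<partial>P) \<le> ennreal K"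
    using X_moment unfolding qX_def by blast
  show ?thesis
  proof (rule morderI[of "max 0 K"])
    fix d :: "nat \<times> 'h set \<times> real" and t assume "t \<in> {0..T}"
    then have "(\<integral>\<^sup>+\<omega>. ennreal (normV (X t \<omega>) powr qX) \<partial>P) \<le> ennreal (max 0 K)"
      using K by (meson ennreal_leI max.cobounded2 order_trans)
    then show "moment_le P qX (\<lambda>\<omega>. normV (X t \<omega>)) (max 0 K * 1 powr qX)"
      by (simp add: moment_le_def normV_nonneg X_V X_measurable(1)[OF continuous_map_V_norm])
  qed simp
qed

lemma PO_measurable:
  assumes "I \<in> \<D>" shows "(\<lambda>\<omega>. normV (span_proj I (O\<^sub>0 t \<omega>))) \<in> borel_measurable P"
  by (rule continuous_section_measurable[OF continuous_on_normV_span_proj[OF D[OF assms]]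
        X_measurable(2)[OF continuous_map_V_inclusion]])

lemma PO_morder: "morder (p * varphi) (\<lambda>_. 1) (\<lambda>d t \<omega>. normV (span_proj (modes d) (O\<^sub>0 t \<omega>)))"
proof -
  obtain K where K: "\<forall>t\<in>{0..T}. \<forall>I\<in>\<D>. (\<integral>\<^sup>+\<omega>. ennreal (normV (span_proj I (O\<^sub>0 t \<omega>)) powr (p * varphi)) \<partial>P) \<le> ennreal K"
    using PO_moment by blast
  show ?thesis
  proof (rule morderI[of "max 0 K"])
    fix d t assume d: "d \<in> discs" "t \<in> {0..T}"
    then have "(\<integral>\<^sup>+\<omega>. ennreal (normV (span_proj (modes d) (O\<^sub>0 t \<omega>)) powr (p * varphi)) \<partial>P) \<le> ennreal (max 0 K)"
      using K discsD(2)[OF d(1)] by (meson ennreal_leI max.cobounded2 order_trans)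
    then show "moment_le P (p * varphi) (\<lambda>\<omega>. normV (span_proj (modes d) (O\<^sub>0 t \<omega>))) (max 0 K * 1 powr (p * varphi))"
      using discs_modes[OF d(1)]
      by (simp add: moment_le_def normV_nonneg PO_measurable[OF discsD(2)[OF d(1)]])
  qed simp
qed

lemma growth_morder:
  fixes U :: "nat \<times> 'h set \<times> real \<Rightarrow> real \<Rightarrow> 'w \<Rightarrow> 'h"
  assumes U: "morder q' (\<lambda>_. 1) (\<lambda>d t \<omega>. normV (U d t \<omega>))" and q: "0 < q" "q * (1 + varphi/2) \<le> q'"
    and V': "\<And>d t \<omega>. d \<in> discs \<Longrightarrow> t \<in> {0..T} \<Longrightarrow> \<omega> \<in> space P \<Longrightarrow> U d t \<omega> \<in> V"
    and meas: "\<And>d t. d \<in> discs \<Longrightarrow> t \<in> {0..T} \<Longrightarrow> (\<lambda>\<omega>. norm (F (U d t \<omega>))) \<in> borel_measurable P"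
  shows "morder q (\<lambda>_. 1) (\<lambda>d t \<omega>. norm (F (U d t \<omega>)))"
proof -
  have "morder ((1 + varphi/2) * q) (\<lambda>_. 1) (\<lambda>d t \<omega>. 1 + normV (U d t \<omega>))"
    by (intro morder_add morder_const morder_lower[OF U]) (use q varphi_pos in \<open>auto simp: mult.commute\<close>)
  then have "morder q (\<lambda>_. 1) (\<lambda>d t \<omega>. growth_const * (1 + normV (U d t \<omega>)) powr (1 + varphi/2))"
    by (intro morder_cmult morder_powr_1) (use growth_const_pos in auto)
  then show ?thesis
    by (rule morder_mono) (use q meas F_growth V' in \<open>auto intro!: AE_I2\<close>)
qed

lemma FX_morder:
  assumes "0 < q" "q * (1 + varphi/2) \<le> qX"
  shows "morder q (\<lambda>_. 1) (\<lambda>d t \<omega>. norm (F (X t \<omega>)))"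
  by (rule growth_morder[OF X_morder assms])
    (use X_V X_measurable(1)[OF F_continuous] in auto)

lemma FX_path:
  assumes "\<omega> \<in> space P"
  shows "(\<lambda>s. F (X s \<omega>)) \<in> borel_measurable lborel"
    and "\<exists>K. \<forall>s\<in>{0..T}. norm (F (X s \<omega>)) \<le> K"
proof -
  have cont: "continuous_on A (\<lambda>s. F (X s \<omega>))" for A by (rule path_continuous(1)[OF F_continuous assms])
  show "(\<lambda>s. F (X s \<omega>)) \<in> borel_measurable lborel"
    using borel_measurable_continuous_onI[OF cont] by simp
  have "compact ((\<lambda>s. F (X s \<omega>)) ` {0..T})" by (intro compact_continuous_image cont) auto
  then have "bounded ((\<lambda>s. F (X s \<omega>)) ` {0..T})" by (rule compact_imp_bounded)
  then obtain K where "\<forall>v\<in>(\<lambda>s. F (X s \<omega>)) ` {0..T}. norm v \<le> K"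
    unfolding bounded_iff by (elim exE)
  then show "\<exists>K. \<forall>s\<in>{0..T}. norm (F (X s \<omega>)) \<le> K"
    by (intro exI[of _ K] ballI) (drule bspec, erule imageI, assumption)
qed

lemma kernel_X_morder:
  assumes a: "0 \<le> a" "a < 1" and q: "1 \<le> q" "q * (1 + varphi/2) \<le> qX"
  shows "morder q (\<lambda>_. 1) (\<lambda>d t \<omega>. LINT s|lborel. singular_kernel a t s * norm (F (X s \<omega>)))"
proof (rule morder_kernel[where \<kappa>="T powr (1 - a) / (1 - a)"])
  show "morder q (\<lambda>_. 1) (\<lambda>d s \<omega>. norm (F (X s \<omega>)))" using q by (intro FX_morder) auto
  show "0 < T powr (1 - a) / (1 - a)" using T_pos a by simp
  show "(\<lambda>(s, \<omega>). norm (F (X s \<omega>))) \<in> borel_measurable (lborel \<Otimes>\<^sub>M P)"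
  proof (rule measurable_continuous_process[of "\<lambda>s. s" UNIV "\<lambda>s \<omega>. norm (F (X s \<omega>))"])
    show "(\<lambda>\<omega>. norm (F (X s \<omega>))) \<in> borel_measurable P" for s
      by (rule measurable_compose[OF X_measurable(1)[OF F_continuous] borel_measurable_norm])
    show "continuous_on UNIV (\<lambda>s. norm (F (X s \<omega>)))" if "\<omega> \<in> space P" for \<omega>
      by (rule continuous_on_norm[OF path_continuous(1)[OF F_continuous that]])
  qed auto
  show "\<exists>K. \<forall>s\<in>{0..T}. norm (F (X s \<omega>)) \<le> K" if "\<omega> \<in> space P" for \<omega> by (rule FX_path(2)[OF that])
  show "singular_kernel a t s = 0" if "t \<in> {0..T}" "s \<notin> {0..T}" for t s
    using that by (auto simp: singular_kernel_def indicator_def)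
qed (use q singular_kernel_integral_le[OF a] in auto)

text \<open>The part of the solution outside of the section: the noise contributes directly, and the drift
  gains the factor \<open>\<parallel>(-A)\<^bsup>-varrho\<^esup> (1 - P)\<parallel>\<close> at the price of the kernel \<open>(t - s)\<^bsup>-\<rho>-varrho\<^esup>\<close>.\<close>

lemma complement_morder:
  "morder (2 * p) rate (\<lambda>d t \<omega>. normV (X t \<omega> - span_proj (modes d) (X t \<omega>)))"
proof -
  let ?J = "\<lambda>t \<omega>. LINT s|lborel. singular_kernel (\<rho> + varrho) t s * norm (F (X s \<omega>))"
  have "morder (2 * p) rate (\<lambda>d t \<omega>. rate d * ?J t \<omega>)"
    by (rule morder_scale[OF kernel_X_morder, where C=1])
      (use rho varrho p qX_ge rate_nonneg in auto)
  then have "morder (2 * p) rate (\<lambda>d t \<omega>. normV (O\<^sub>0 t \<omega> - span_proj (modes d) (O\<^sub>0 t \<omega>)) + cV * (rate d * ?J t \<omega>))"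
    by (intro morder_add discs_noise_moments morder_cmult) (use cV_pos p in auto)
  then show ?thesis
  proof (rule morder_mono)
    fix d t assume d: "d \<in> discs" "t \<in> {0..T}"
    note I = discs_modes[OF d(1)]
    show "(\<lambda>\<omega>. normV (X t \<omega> - span_proj (modes d) (X t \<omega>))) \<in> borel_measurable P"
      by (rule X_measurable(1)[OF continuous_map_V_complement[OF I]])
    show "0 \<le> normV (X t \<omega> - span_proj (modes d) (X t \<omega>))" if "\<omega> \<in> space P" for \<omega>
      using I X_V[OF that] by (intro normV_nonneg V_diff) auto
    show "AE \<omega> in P. normV (X t \<omega> - span_proj (modes d) (X t \<omega>))
        \<le> normV (O\<^sub>0 t \<omega> - span_proj (modes d) (O\<^sub>0 t \<omega>)) + cV * (rate d * ?J t \<omega>)"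
      using AE_space mild_solution_coordinates
    proof eventually_elim
      case (elim \<omega>)
      let ?I = "modes d"
      obtain K where K: "\<And>s. s \<in> {0..T} \<Longrightarrow> norm (F (X s \<omega>)) \<le> K" using FX_path(2)[OF elim(1)] by blast
      define y where "y = (X t \<omega> - O\<^sub>0 t \<omega>) - span_proj ?I (X t \<omega> - O\<^sub>0 t \<omega>)"
      have y: "i \<bullet> y = (if i \<in> B - ?I then duhamel (- \<mu> i) (\<lambda>s. i \<bullet> F (X s \<omega>)) t else 0)" if "i \<in> B" for i
        using elim(2) d(2) that I by (simp add: y_def inner_diff_right inner_span_proj)
      have y_le: "y \<in> interp_space B \<mu> \<rho>" "interp_norm B \<mu> \<rho> y \<le> rate d * ?J t \<omega>"
        using duhamel_section_bound[OF y varrho(1) _ rate_nonneg[OF d(1)] _ FX_path(1)[OF elim(1)] K d(2)]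
          varrho(2) discsD(5)[OF d(1)] by auto
      have yV: "y \<in> V" using y_le(1) interp_space_subset_V by blast
      have "normV y \<le> cV * interp_norm B \<mu> \<rho> y" by (rule normV_le[OF y_le(1)])
      also have "\<dots> \<le> cV * (rate d * ?J t \<omega>)" using y_le(2) cV_pos by (intro mult_left_mono) auto
      finally have ny: "normV y \<le> cV * (rate d * ?J t \<omega>)" .
      have "X t \<omega> - span_proj ?I (X t \<omega>) = (O\<^sub>0 t \<omega> - span_proj ?I (O\<^sub>0 t \<omega>)) + y"
        by (simp add: y_def span_proj_diff)
      then have "normV (X t \<omega> - span_proj ?I (X t \<omega>)) \<le> normV (O\<^sub>0 t \<omega> - span_proj ?I (O\<^sub>0 t \<omega>)) + normV y"
        using normV_triangle[of "O\<^sub>0 t \<omega> - span_proj ?I (O\<^sub>0 t \<omega>)" y] yV O_V[OF elim(1)] I by (simp add: V_diff)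
      with ny show ?case by linarith
    qed
  qed (use p in auto)
qed

lemma PX_measurable:
  assumes "I \<in> \<D>" shows "(\<lambda>\<omega>. normV (span_proj I (X t \<omega>))) \<in> borel_measurable P"
  by (rule continuous_section_measurable[OF continuous_on_normV_span_proj[OF D[OF assms]]
        X_measurable(1)[OF continuous_map_V_inclusion]])

text \<open>The norms of the projections on \<open>V\<close> may grow with the section, so moments of \<open>P X\<close> do not follow from those of
  \<open>X\<close>. They come from the moments of \<open>P O\<close> and the smoothing of the semigroup.\<close>

lemma section_morder:
  "morder (p * varphi) (\<lambda>_. 1) (\<lambda>d t \<omega>. normV (span_proj (modes d) (X t \<omega>)))"
proof -
  let ?J = "\<lambda>t \<omega>. LINT s|lborel. singular_kernel (\<rho> + 0) t s * norm (F (X s \<omega>))"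
  have "morder (p * varphi) (\<lambda>_. 1) (\<lambda>d t \<omega>. normV (span_proj (modes d) (O\<^sub>0 t \<omega>)) + cV * (1 * ?J t \<omega>))"
    by (intro morder_add PO_morder morder_cmult kernel_X_morder) (use rho cV_pos p qX_ge in auto)
  then show ?thesis
  proof (rule morder_mono)
    fix d t assume d: "d \<in> discs" "t \<in> {0..T}"
    note I = discs_modes[OF d(1)]
    show "(\<lambda>\<omega>. normV (span_proj (modes d) (X t \<omega>))) \<in> borel_measurable P"
      by (rule PX_measurable[OF discsD(2)[OF d(1)]])
    show "0 \<le> normV (span_proj (modes d) (X t \<omega>))" for \<omega> using I by (intro normV_nonneg) auto
    show "AE \<omega> in P. normV (span_proj (modes d) (X t \<omega>))
        \<le> normV (span_proj (modes d) (O\<^sub>0 t \<omega>)) + cV * (1 * ?J t \<omega>)"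
      using AE_space mild_solution_coordinates
    proof eventually_elim
      case (elim \<omega>)
      let ?I = "modes d"
      obtain K where K: "\<And>s. s \<in> {0..T} \<Longrightarrow> norm (F (X s \<omega>)) \<le> K" using FX_path(2)[OF elim(1)] by blast
      define y where "y = span_proj ?I (X t \<omega> - O\<^sub>0 t \<omega>)"
      have y: "i \<bullet> y = (if i \<in> ?I then duhamel (- \<mu> i) (\<lambda>s. i \<bullet> F (X s \<omega>)) t else 0)" if "i \<in> B" for i
        using elim(2) d(2) that I by (simp add: y_def inner_diff_right inner_span_proj)
      have one: "(- \<mu> i) powr (- 0) \<le> 1" for i by simp
      have y_le: "y \<in> interp_space B \<mu> \<rho>" "interp_norm B \<mu> \<rho> y \<le> 1 * ?J t \<omega>"
        using duhamel_section_bound[OF y order_refl _ zero_le_one one FX_path(1)[OF elim(1)] K d(2)] rho by auto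
      have yV: "y \<in> V" using y_le(1) interp_space_subset_V by blast
      have "normV y \<le> cV * interp_norm B \<mu> \<rho> y" by (rule normV_le[OF y_le(1)])
      also have "\<dots> \<le> cV * (1 * ?J t \<omega>)" using y_le(2) cV_pos by (intro mult_left_mono) auto
      finally have ny: "normV y \<le> cV * (1 * ?J t \<omega>)" .
      have "span_proj ?I (X t \<omega>) = span_proj ?I (O\<^sub>0 t \<omega>) + y" by (simp add: y_def span_proj_diff)
      then have "normV (span_proj ?I (X t \<omega>)) \<le> normV (span_proj ?I (O\<^sub>0 t \<omega>)) + normV y"
        using normV_triangle[of "span_proj ?I (O\<^sub>0 t \<omega>)" y] yV I by simp
      with ny show ?case by linarith
    qed
  qed (use p in auto)
qed

lemma scheme_V: "1 \<le> M \<Longrightarrow> I \<in> \<D> \<Longrightarrow> \<omega> \<in> space P \<Longrightarrow> \<X> M I t \<omega> \<in> V"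
  using interp_space_gamma(1) scheme_space by blast

lemma scheme_normV_le:
  "1 \<le> M \<Longrightarrow> I \<in> \<D> \<Longrightarrow> \<omega> \<in> space P \<Longrightarrow> normV (\<X> M I t \<omega>) \<le> cG * interp_norm B \<mu> \<gamma> (\<X> M I t \<omega>)"
  unfolding cG_def by (rule interp_space_gamma(2)[OF scheme_space])

lemma norm_force_le: "norm (force M I \<omega> t) \<le> norm (F (\<X> M I (grid_floor (T / M) t) \<omega>))"
  by (simp add: force_def truncated_force_def)

lemma FXX_morder: "morder (2 * p) (\<lambda>_. 1) (\<lambda>d t \<omega>. norm (F (\<X> (steps d) (modes d) t \<omega>)))"
proof (rule growth_morder)
  have "morder (2 * qN) (\<lambda>_. 1) (\<lambda>d t \<omega>. cG * interp_norm B \<mu> \<gamma> (\<X> (steps d) (modes d) t \<omega>))"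
    using cG_pos by (intro morder_cmult scheme_morder) auto
  then show "morder (2 * qN) (\<lambda>_. 1) (\<lambda>d t \<omega>. normV (\<X> (steps d) (modes d) t \<omega>))"
  proof (rule morder_mono)
    fix d t assume d: "d \<in> discs" "t \<in> {0..T}"
    note MI = discsD(1,2)[OF d(1)]
    show "(\<lambda>\<omega>. normV (\<X> (steps d) (modes d) t \<omega>)) \<in> borel_measurable P"
      by (rule X_measurable(3)[OF continuous_map_V_norm MI])
    show "0 \<le> normV (\<X> (steps d) (modes d) t \<omega>)" if "\<omega> \<in> space P" for \<omega>
      by (rule normV_nonneg[OF scheme_V[OF MI that]])
    show "AE \<omega> in P. normV (\<X> (steps d) (modes d) t \<omega>) \<le> cG * interp_norm B \<mu> \<gamma> (\<X> (steps d) (modes d) t \<omega>)"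
      by (rule AE_I2) (rule scheme_normV_le[OF MI])
  qed (use qN_ge(3) in simp)
  show "0 < 2 * p" using p by simp
  show "2 * p * (1 + varphi/2) \<le> 2 * qN" using qN_ge(2,3) by (simp add: algebra_simps)
  fix d :: "nat \<times> 'h set \<times> real" and t assume d: "d \<in> discs"
  note MI = discsD(1,2)[OF d]
  show "\<X> (steps d) (modes d) t \<omega> \<in> V" if "\<omega> \<in> space P" for \<omega> by (rule scheme_V[OF MI that])
  show "(\<lambda>\<omega>. norm (F (\<X> (steps d) (modes d) t \<omega>))) \<in> borel_measurable P"
    by (rule measurable_compose[OF X_measurable(3)[OF F_continuous MI] borel_measurable_norm])
qed

lemma force_morder: "morder (2 * p) (\<lambda>_. 1) (\<lambda>d t \<omega>. norm (force (steps d) (modes d) \<omega> t))"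
proof (rule morder_mono)
  show "morder (2 * p) (\<lambda>_. 1) (\<lambda>d t \<omega>. norm (F (\<X> (steps d) (modes d) (grid_floor (T / real (steps d)) t) \<omega>)))"
    by (rule morder_time_change[OF FXX_morder grid_floor_time])
  show "(\<lambda>\<omega>. norm (force (steps d) (modes d) \<omega> t)) \<in> borel_measurable P" if "d \<in> discs" for d t
    by (rule measurable_compose[OF force_measurable[OF discsD(1,2)[OF that]] borel_measurable_norm])
qed (use p norm_force_le in auto)

lemma force_path:
  assumes "1 \<le> M"
  shows "\<exists>K. \<forall>s\<in>{0..T}. norm (force M I \<omega> s) \<le> K"
  unfolding force_def using truncated_force_bounded[OF step_pos[OF assms]] by metis

lemma kernel_force_morder:
  assumes a: "0 \<le> a" "a < 1"
  shows "morder (2 * p) (\<lambda>_. 1) (\<lambda>d t \<omega>. LINT s|lborel.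
    (singular_kernel a (grid_floor (T / real (steps d)) t) s + singular_kernel a t s) * norm (force (steps d) (modes d) \<omega> s))"
proof (rule morder_kernel[OF force_morder, where \<kappa>="2 * (T powr (1 - a) / (1 - a))"])
  show "0 < 2 * (T powr (1 - a) / (1 - a))" using T_pos a by simp
  fix d assume d: "d \<in> discs"
  note MI = discsD(1,2)[OF d]
  show "(\<lambda>(s, \<omega>). norm (force (steps d) (modes d) \<omega> s)) \<in> borel_measurable (lborel \<Otimes>\<^sub>M P)"
    using measurable_compose[OF force_jointly_measurable[OF MI] borel_measurable_norm] by (simp add: split_beta')
  show "\<exists>K. \<forall>s\<in>{0..T}. norm (force (steps d) (modes d) \<omega> s) \<le> K" for \<omega> by (rule force_path[OF MI(1)])
  fix t assume t: "t \<in> {0..T}"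
  note ft = grid_floor_time[OF d t]
  show "integrable lborel (\<lambda>s. singular_kernel a (grid_floor (T / real (steps d)) t) s + singular_kernel a t s)"
    by (intro Bochner_Integration.integrable_add singular_kernel_integral_le(1)[OF a t] singular_kernel_integral_le(1)[OF a ft])
  have "(LINT s|lborel. singular_kernel a (grid_floor (T / real (steps d)) t) s + singular_kernel a t s)
    = (LINT s|lborel. singular_kernel a (grid_floor (T / real (steps d)) t) s) + (LINT s|lborel. singular_kernel a t s)"
    by (intro Bochner_Integration.integral_add singular_kernel_integral_le(1)[OF a t] singular_kernel_integral_le(1)[OF a ft])
  then show "(LINT s|lborel. singular_kernel a (grid_floor (T / real (steps d)) t) s + singular_kernel a t s)
      \<le> 2 * (T powr (1 - a) / (1 - a))"
    using singular_kernel_integral_le(2)[OF a t] singular_kernel_integral_le(2)[OF a ft] by simp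
  show "singular_kernel a (grid_floor (T / real (steps d)) t) s + singular_kernel a t s = 0" if "s \<notin> {0..T}" for s
    using that t ft by (auto simp: singular_kernel_def indicator_def)
qed (use p in auto)

text \<open>The drift is \<open>\<X> - \<O>\<close>, both of which are controlled in \<open>H\<^sub>\<gamma>\<close>.\<close>

lemma drift_morder: "morder (p * varphi) (\<lambda>_. 1) (\<lambda>d t \<omega>. normV (drift (steps d) (modes d) t \<omega>))"
proof -
  have "p * varphi \<le> 2 * qN" using qN_ge p by (simp add: algebra_simps)
  then have low: "morder (p * varphi) (\<lambda>_. 1) Z" if "morder (2 * qN) (\<lambda>_. 1) Z" for Z
    using morder_lower[OF that, of "p * varphi"] p by simp
  have "morder (p * varphi) (\<lambda>_. 1) (\<lambda>d t \<omega>. cG * (interp_norm B \<mu> \<gamma> (\<X> (steps d) (modes d) t \<omega>)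
      + interp_norm B \<mu> \<gamma> (\<O> (steps d) (modes d) t \<omega>)))"
    by (intro morder_cmult morder_add low scheme_morder) (use cG_pos p in auto)
  then show ?thesis
  proof (rule morder_mono)
    fix d t assume d: "d \<in> discs" "t \<in> {0..T}"
    note MI = discsD(1,2)[OF d(1)] and I = discs_modes[OF d(1)]
    have "(\<lambda>\<omega>. normV (span_proj (modes d) (drift (steps d) (modes d) t \<omega>))) \<in> borel_measurable P"
      by (rule continuous_section_measurable[OF continuous_on_normV_span_proj[OF I] drift_measurable[OF MI]])
    then show "(\<lambda>\<omega>. normV (drift (steps d) (modes d) t \<omega>)) \<in> borel_measurable P"
      by (simp add: span_proj_drift[OF MI(2)])
    have mem: "drift (steps d) (modes d) t \<omega> \<in> interp_space B \<mu> \<gamma>" for \<omega>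
      using interp_space_span_proj[OF I, of "drift (steps d) (modes d) t \<omega>"] by (simp only: span_proj_drift[OF MI(2)])
    show "0 \<le> normV (drift (steps d) (modes d) t \<omega>)" for \<omega>
      by (rule normV_nonneg[OF interp_space_gamma(1)[OF mem]])
    show "AE \<omega> in P. normV (drift (steps d) (modes d) t \<omega>) \<le> cG * (interp_norm B \<mu> \<gamma> (\<X> (steps d) (modes d) t \<omega>)
      + interp_norm B \<mu> \<gamma> (\<O> (steps d) (modes d) t \<omega>))"
      using AE_space scheme_drift[OF MI d(2)]
    proof eventually_elim
      case (elim \<omega>)
      have memO: "\<O> (steps d) (modes d) t \<omega> \<in> interp_space B \<mu> \<gamma>"
        using interp_space_span_proj[OF I, of "\<O> (steps d) (modes d) t \<omega>"] by (simp only: noise_span[OF MI elim(1)])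
      have eq: "drift (steps d) (modes d) t \<omega> = \<X> (steps d) (modes d) t \<omega> + (- 1) *\<^sub>R \<O> (steps d) (modes d) t \<omega>"
        using elim(2) by simp
      have "normV (drift (steps d) (modes d) t \<omega>) \<le> cG * interp_norm B \<mu> \<gamma> (drift (steps d) (modes d) t \<omega>)"
        unfolding cG_def by (rule interp_space_gamma(2)[OF mem])
      also have "interp_norm B \<mu> \<gamma> (drift (steps d) (modes d) t \<omega>) \<le> interp_norm B \<mu> \<gamma> (\<X> (steps d) (modes d) t \<omega>)
          + interp_norm B \<mu> \<gamma> (\<O> (steps d) (modes d) t \<omega>)"
        using norm_on_triangle[OF norm_on_interp_space scheme_space[OF MI elim(1)] subspace_scale[OF interp_space_subspace memO], of t "- 1"]
          norm_on_scale[OF norm_on_interp_space memO, of "- 1"] unfolding eq by simp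
      finally show ?case using cG_pos by (simp add: mult_left_mono)
    qed
  qed (use p in simp)
qed

section \<open>The defects\<close>

text \<open>The arguments \<open>N + P O\<close> and \<open>\<X>\<close> at the last grid point, between which \<open>F\<close> is discretised in time. Writing
  both as projections makes measurability a matter of finitely many coordinates.\<close>

definition continuous_arg :: "nat \<times> 'h set \<times> real \<Rightarrow> real \<Rightarrow> 'w \<Rightarrow> 'h" where
  "continuous_arg d t \<omega> = span_proj (modes d) (drift (steps d) (modes d) t \<omega> + O\<^sub>0 t \<omega>)"

definition grid_arg :: "nat \<times> 'h set \<times> real \<Rightarrow> real \<Rightarrow> 'w \<Rightarrow> 'h" where
  "grid_arg d t \<omega> = span_proj (modes d) (\<X> (steps d) (modes d) (grid_floor (T / real (steps d)) t) \<omega>)"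

lemma args_measurable:
  assumes "d \<in> discs"
  shows "(\<lambda>\<omega>. drift (steps d) (modes d) t \<omega> + O\<^sub>0 t \<omega>) \<in> borel_measurable P"
    and "(\<lambda>\<omega>. \<X> (steps d) (modes d) t \<omega>) \<in> borel_measurable P"
  using drift_measurable[OF discsD(1,2)[OF assms]] X_measurable(2)[OF continuous_map_V_inclusion]
    X_measurable(3)[OF continuous_map_V_inclusion discsD(1,2)[OF assms]]
  by (auto intro!: borel_measurable_add)

lemma args_V: "d \<in> discs \<Longrightarrow> continuous_arg d t \<omega> \<in> V" "d \<in> discs \<Longrightarrow> grid_arg d t \<omega> \<in> V"
  using discs_modes by (simp_all add: continuous_arg_def grid_arg_def)

lemma grid_arg_AE:
  assumes d: "d \<in> discs"
  shows "AE \<omega> in P. \<forall>t\<in>{0..T}. grid_arg d t \<omega> = \<X> (steps d) (modes d) (grid_floor (T / real (steps d)) t) \<omega> \<and>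
    grid_arg d t \<omega> = drift (steps d) (modes d) (grid_floor (T / real (steps d)) t) \<omega>
      + \<O> (steps d) (modes d) (grid_floor (T / real (steps d)) t) \<omega>"
  using scheme_path_AE[OF discsD(1,2)[OF d]]
proof eventually_elim
  case (elim \<omega>)
  show ?case
    using path_grid_span[OF elim] path_grid[OF elim]
    by (simp add: grid_arg_def drift_def force_def)
qed

text \<open>The distance between the two arguments: the increment of the drift over a part of a grid cell,
  an increment of the noise, and the error of the approximate noise at the grid point.\<close>

lemma args_diff_morder: "morder (2 * p) rate (\<lambda>d t \<omega>. normV (continuous_arg d t \<omega> - grid_arg d t \<omega>))"
proof -
  let ?J = "\<lambda>d t \<omega>. LINT s|lborel. (singular_kernel (\<rho> + varrho) (grid_floor (T / real (steps d)) t) s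
    + singular_kernel (\<rho> + varrho) t s) * norm (force (steps d) (modes d) \<omega> s)"
  have h_rate: "(T / real (steps d)) powr varrho \<le> T powr varrho * rate d" if d: "d \<in> discs" for d
  proof -
    have "(T / real (steps d)) powr varrho = T powr varrho * real (steps d) powr (- varrho)"
      using T_pos by (simp add: powr_divide powr_minus_divide)
    also have "real (steps d) powr (- varrho) \<le> real (steps d) powr (- min (vartheta * chi) varrho)"
      using discsD(1)[OF d] by (intro powr_mono) auto
    also have "\<dots> \<le> rate d" by (rule discsD(4)[OF d])
    finally show ?thesis by (simp add: mult_left_mono)
  qed
  have "morder (2 * p) rate (\<lambda>d t \<omega>. (T / real (steps d)) powr varrho * ?J d t \<omega>)"
    by (rule morder_scale[OF kernel_force_morder, where C="T powr varrho"])
      (use rho varrho p h_rate rate_nonneg in auto)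
  then have "morder (2 * p) rate (\<lambda>d t \<omega>. cV * ((T / real (steps d)) powr varrho * ?J d t \<omega>)
      + (normV (span_proj (modes d) (O\<^sub>0 t \<omega> - O\<^sub>0 (grid_floor (T / real (steps d)) t) \<omega>))
        + normV (span_proj (modes d) (O\<^sub>0 (grid_floor (T / real (steps d)) t) \<omega>)
            - \<O> (steps d) (modes d) (grid_floor (T / real (steps d)) t) \<omega>)))"
    by (intro morder_add morder_cmult discs_noise_moments
        morder_time_change[OF discs_noise_moments(2) grid_floor_time]) (use cV_pos p in auto)
  then show ?thesis
  proof (rule morder_mono)
    fix d t assume d: "d \<in> discs" "t \<in> {0..T}"
    note MI = discsD(1,2)[OF d(1)] and I = discs_modes[OF d(1)]
    define t0 where "t0 = grid_floor (T / real (steps d)) t"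
    have "(\<lambda>\<omega>. normV (span_proj (modes d) (drift (steps d) (modes d) t \<omega> + O\<^sub>0 t \<omega> - \<X> (steps d) (modes d) t0 \<omega>))) \<in> borel_measurable P"
      using args_measurable[OF d(1)]
      by (intro continuous_section_measurable[OF continuous_on_normV_span_proj[OF I]] borel_measurable_diff)
    then show "(\<lambda>\<omega>. normV (continuous_arg d t \<omega> - grid_arg d t \<omega>)) \<in> borel_measurable P"
      by (simp add: continuous_arg_def grid_arg_def t0_def span_proj_diff)
    show "0 \<le> normV (continuous_arg d t \<omega> - grid_arg d t \<omega>)" for \<omega>
      by (intro normV_nonneg V_diff args_V d)
    show "AE \<omega> in P. normV (continuous_arg d t \<omega> - grid_arg d t \<omega>) \<le> cV * ((T / real (steps d)) powr varrho * ?J d t \<omega>)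
      + (normV (span_proj (modes d) (O\<^sub>0 t \<omega> - O\<^sub>0 (grid_floor (T / real (steps d)) t) \<omega>))
        + normV (span_proj (modes d) (O\<^sub>0 (grid_floor (T / real (steps d)) t) \<omega>)
            - \<O> (steps d) (modes d) (grid_floor (T / real (steps d)) t) \<omega>))"
      using AE_space grid_arg_AE[OF d(1)]
    proof eventually_elim
      case (elim \<omega>)
      let ?I = "modes d" and ?N = "\<lambda>t. drift (steps d) (modes d) t \<omega>"
      let ?o = "\<O> (steps d) (modes d) t0 \<omega>"
      have Po: "span_proj ?I ?o = ?o" by (rule noise_span[OF MI elim(1)])
      have oV: "?o \<in> V" using V_span_proj[OF I, of ?o] Po by simp
      have PN: "span_proj ?I (?N s) = ?N s" for s by (rule span_proj_drift[OF MI(2)])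
      have mem: "?N t - ?N t0 \<in> interp_space B \<mu> \<rho>"
        using interp_space_span_proj[OF I, of "?N t - ?N t0"] by (simp only: span_proj_diff PN)
      then have NV: "?N t - ?N t0 \<in> V" using interp_space_subset_V by blast
      have "interp_norm B \<mu> \<rho> (?N t - ?N t0) \<le> (T / real (steps d)) powr varrho * ?J d t \<omega>"
        using convolution_increment_rate[OF step_pos[OF MI(1)] I varrho(1) _ d(2)] varrho(2)
        unfolding drift_def force_def t0_def by auto
      then have "cV * interp_norm B \<mu> \<rho> (?N t - ?N t0) \<le> cV * ((T / real (steps d)) powr varrho * ?J d t \<omega>)"
        using cV_pos by (intro mult_left_mono) auto
      then have nN: "normV (?N t - ?N t0) \<le> cV * ((T / real (steps d)) powr varrho * ?J d t \<omega>)"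
        using normV_le[OF mem] by linarith
      have "grid_arg d t \<omega> = ?N t0 + ?o" using bspec[OF elim(2) d(2)] unfolding t0_def by (rule conjunct2)
      then have eq: "continuous_arg d t \<omega> - grid_arg d t \<omega>
          = (?N t - ?N t0) + (span_proj ?I (O\<^sub>0 t \<omega> - O\<^sub>0 t0 \<omega>) + (span_proj ?I (O\<^sub>0 t0 \<omega>) - ?o))"
        by (simp add: continuous_arg_def span_proj_add span_proj_diff PN)
      have V2: "span_proj ?I (O\<^sub>0 t \<omega> - O\<^sub>0 t0 \<omega>) \<in> V" "span_proj ?I (O\<^sub>0 t0 \<omega>) - ?o \<in> V"
        using I oV by (auto intro!: V_diff)
      have "normV (continuous_arg d t \<omega> - grid_arg d t \<omega>) \<le> normV (?N t - ?N t0)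
          + (normV (span_proj ?I (O\<^sub>0 t \<omega> - O\<^sub>0 t0 \<omega>)) + normV (span_proj ?I (O\<^sub>0 t0 \<omega>) - ?o))"
        unfolding eq
        using normV_triangle[OF NV V_add[OF V2]] normV_triangle[OF V2] by linarith
      with nN show ?case unfolding t0_def by linarith
    qed
  qed (use p in simp)
qed

text \<open>The Cauchy--Schwarz inequality for the local Lipschitz estimate: the difference is small in the \<open>2 p\<close>-th
  mean, and \<open>normV powr (varphi/2)\<close> is bounded there when \<open>normV\<close> is bounded in the \<open>p varphi\<close>-th.\<close>

lemma lipschitz_morder:
  fixes U W :: "nat \<times> 'h set \<times> real \<Rightarrow> real \<Rightarrow> 'w \<Rightarrow> 'h"
  assumes diff: "morder (2 * p) rate (\<lambda>d t \<omega>. normV (U d t \<omega> - W d t \<omega>))"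
    and U: "morder (p * varphi) (\<lambda>_. 1) (\<lambda>d t \<omega>. normV (U d t \<omega>))"
    and W: "morder (p * varphi) (\<lambda>_. 1) (\<lambda>d t \<omega>. normV (W d t \<omega>))"
    and UW: "\<And>d t \<omega>. d \<in> discs \<Longrightarrow> \<omega> \<in> space P \<Longrightarrow> U d t \<omega> \<in> V \<and> W d t \<omega> \<in> V"
    and meas: "\<And>d t. d \<in> discs \<Longrightarrow> (\<lambda>\<omega>. norm (F (U d t \<omega>) - F (W d t \<omega>))) \<in> borel_measurable P"
  shows "morder p rate (\<lambda>d t \<omega>. norm (F (U d t \<omega>) - F (W d t \<omega>)))"
proof -
  have e: "varphi / 2 * (2 * p) = p * varphi" by simp
  have "morder (2 * p) (\<lambda>_. 1) (\<lambda>d t \<omega>. 1 + normV (U d t \<omega>) powr (varphi/2) + normV (W d t \<omega>) powr (varphi/2))"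
    by (intro morder_add morder_const morder_powr_1[of "varphi/2" "2 * p", unfolded e] U W) (use p in auto)
  then have "morder p rate (\<lambda>d t \<omega>. sqrt c * normV (U d t \<omega> - W d t \<omega>)
      * (1 + normV (U d t \<omega>) powr (varphi/2) + normV (W d t \<omega>) powr (varphi/2)))"
    by (intro morder_mult morder_cmult diff rate_nonneg) (use c_pos in auto)
  then show ?thesis
    by (rule morder_mono) (use p meas UW local_lipschitz_V in \<open>auto intro!: AE_I2\<close>)
qed

lemma args_F_measurable:
  assumes "d \<in> discs"
  shows "(\<lambda>\<omega>. F (continuous_arg d t \<omega>)) \<in> borel_measurable P" "(\<lambda>\<omega>. F (grid_arg d t \<omega>)) \<in> borel_measurable P"
    "(\<lambda>\<omega>. normV (continuous_arg d t \<omega>)) \<in> borel_measurable P" "(\<lambda>\<omega>. normV (grid_arg d t \<omega>)) \<in> borel_measurable P"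
    "(\<lambda>\<omega>. F (span_proj (modes d) (X t \<omega>))) \<in> borel_measurable P"
  unfolding continuous_arg_def grid_arg_def
  using continuous_section_measurable[OF continuous_on_F_span_proj[OF discs_modes[OF assms]]]
    continuous_section_measurable[OF continuous_on_normV_span_proj[OF discs_modes[OF assms]]]
    args_measurable[OF assms] X_measurable(1)[OF continuous_map_V_inclusion]
  by auto

lemma defect_space: "morder p rate (\<lambda>d t \<omega>. norm (F (X t \<omega>) - F (span_proj (modes d) (X t \<omega>))))"
proof (rule lipschitz_morder[OF complement_morder _ section_morder])
  show "morder (p * varphi) (\<lambda>_. 1) (\<lambda>d t \<omega>. normV (X t \<omega>))"
    by (rule morder_lower[OF X_morder]) (use p qX_ge in auto)
  show "(\<lambda>\<omega>. norm (F (X t \<omega>) - F (span_proj (modes d) (X t \<omega>)))) \<in> borel_measurable P" if "d \<in> discs" for d t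
    by (intro borel_measurable_norm[THEN measurable_compose[rotated]] borel_measurable_diff
        X_measurable(1)[OF F_continuous] args_F_measurable(5)[OF that])
qed (use X_V discs_modes in auto)

lemma defect_time: "morder p rate (\<lambda>d t \<omega>. norm (F (continuous_arg d t \<omega>) - F (grid_arg d t \<omega>)))"
proof (rule lipschitz_morder[OF args_diff_morder])
  have "morder (p * varphi) (\<lambda>_. 1) (\<lambda>d t \<omega>. normV (drift (steps d) (modes d) t \<omega>) + normV (span_proj (modes d) (O\<^sub>0 t \<omega>)))"
    by (intro morder_add drift_morder PO_morder) (use p in auto)
  then show "morder (p * varphi) (\<lambda>_. 1) (\<lambda>d t \<omega>. normV (continuous_arg d t \<omega>))"
  proof (rule morder_mono)
    fix d t assume d: "d \<in> discs" "t \<in> {0..T}"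
    show "(\<lambda>\<omega>. normV (continuous_arg d t \<omega>)) \<in> borel_measurable P" by (rule args_F_measurable[OF d(1)])
    show "AE \<omega> in P. normV (continuous_arg d t \<omega>)
        \<le> normV (drift (steps d) (modes d) t \<omega>) + normV (span_proj (modes d) (O\<^sub>0 t \<omega>))"
    proof (rule AE_I2)
      fix \<omega>
      have "drift (steps d) (modes d) t \<omega> \<in> V"
        using V_span_proj[OF discs_modes[OF d(1)], of "drift (steps d) (modes d) t \<omega>"]
        by (simp only: span_proj_drift[OF discsD(2)[OF d(1)]])
      then show "normV (continuous_arg d t \<omega>)
        \<le> normV (drift (steps d) (modes d) t \<omega>) + normV (span_proj (modes d) (O\<^sub>0 t \<omega>))"
        using normV_triangle[of "drift (steps d) (modes d) t \<omega>" "span_proj (modes d) (O\<^sub>0 t \<omega>)"]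
          discs_modes[OF d(1)]
        by (simp add: continuous_arg_def span_proj_add span_proj_drift[OF discsD(2)[OF d(1)]])
    qed
  qed (use p args_V normV_nonneg in auto)
  have "p * varphi \<le> 2 * qN" using qN_ge p by (simp add: algebra_simps)
  then have "morder (p * varphi) (\<lambda>_. 1) (\<lambda>d t \<omega>. interp_norm B \<mu> \<gamma> (\<X> (steps d) (modes d) t \<omega>))"
    by (intro morder_lower[OF scheme_morder(2)]) (use p in auto)
  from morder_time_change[OF this grid_floor_time]
  have "morder (p * varphi) (\<lambda>_. 1) (\<lambda>d t \<omega>. cG * interp_norm B \<mu> \<gamma> (\<X> (steps d) (modes d) (grid_floor (T / real (steps d)) t) \<omega>))"
    by (intro morder_cmult) (use cG_pos in auto)
  then show "morder (p * varphi) (\<lambda>_. 1) (\<lambda>d t \<omega>. normV (grid_arg d t \<omega>))"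
  proof (rule morder_mono)
    fix d t assume d: "d \<in> discs" "t \<in> {0..T}"
    show "(\<lambda>\<omega>. normV (grid_arg d t \<omega>)) \<in> borel_measurable P" by (rule args_F_measurable[OF d(1)])
    show "AE \<omega> in P. normV (grid_arg d t \<omega>)
        \<le> cG * interp_norm B \<mu> \<gamma> (\<X> (steps d) (modes d) (grid_floor (T / real (steps d)) t) \<omega>)"
      using AE_space grid_arg_AE[OF d(1)]
      by eventually_elim (use d scheme_normV_le[OF discsD(1,2)[OF d(1)]] in auto)
  qed (use p args_V normV_nonneg in auto)
  show "continuous_arg d t \<omega> \<in> V \<and> grid_arg d t \<omega> \<in> V" if "d \<in> discs" for d t \<omega> using args_V[OF that] by blast
  show "(\<lambda>\<omega>. norm (F (continuous_arg d t \<omega>) - F (grid_arg d t \<omega>))) \<in> borel_measurable P" if "d \<in> discs" for d t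
    by (intro borel_measurable_norm[THEN measurable_compose[rotated]] borel_measurable_diff
        args_F_measurable[OF that])
qed

text \<open>Where the truncation is active, \<open>h powr chi * (\<parallel>\<X>\<parallel>\<^sub>\<gamma> + \<parallel>\<O>\<parallel>\<^sub>\<gamma>) > 1\<close>, and any power of this number may be
  inserted as a factor. The power \<open>vartheta\<close> gives the rate \<open>vartheta * chi\<close>.\<close>

lemma defect_truncation: "morder p rate (\<lambda>d t \<omega>. norm (F (grid_arg d t \<omega>) - force (steps d) (modes d) \<omega> t))"
proof -
  define A where "A d t \<omega> = interp_norm B \<mu> \<gamma> (\<X> (steps d) (modes d) t \<omega>) + interp_norm B \<mu> \<gamma> (\<O> (steps d) (modes d) t \<omega>)"
    for d :: "nat \<times> 'h set \<times> real" and t \<omega>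
  have "morder (2 * qN) (\<lambda>_. 1) A"
    unfolding A_def[abs_def] by (intro morder_add scheme_morder) (use qN_ge(3) in simp)
  then have "morder (vartheta * (2 * p)) (\<lambda>_. 1) A"
    by (rule morder_lower) (use vartheta_pos p qN_ge(1,3) in \<open>auto simp: algebra_simps\<close>)
  then have "morder (2 * p) (\<lambda>_. 1) (\<lambda>d t \<omega>. A d t \<omega> powr vartheta)" by (rule morder_powr_1)
  then have "morder p (\<lambda>_. 1) (\<lambda>d t \<omega>. A d t \<omega> powr vartheta * norm (F (\<X> (steps d) (modes d) t \<omega>)))"
    by (rule morder_mult[OF _ FXX_morder]) simp
  from morder_time_change[OF this grid_floor_time]
  have "morder p (\<lambda>_. 1) (\<lambda>d t \<omega>. A d (grid_floor (T / real (steps d)) t) \<omega> powr vartheta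
      * norm (F (\<X> (steps d) (modes d) (grid_floor (T / real (steps d)) t) \<omega>)))" by simp
  then have "morder p rate (\<lambda>d t \<omega>. (T / real (steps d)) powr (chi * vartheta) * (A d (grid_floor (T / real (steps d)) t) \<omega> powr vartheta
      * norm (F (\<X> (steps d) (modes d) (grid_floor (T / real (steps d)) t) \<omega>))))"
  proof (rule morder_scale[where C="T powr (chi * vartheta)"])
    fix d assume d: "d \<in> discs"
    have "(T / real (steps d)) powr (chi * vartheta) = T powr (chi * vartheta) * real (steps d) powr (- (chi * vartheta))"
      using T_pos by (simp add: powr_divide powr_minus_divide)
    also have "real (steps d) powr (- (chi * vartheta)) \<le> real (steps d) powr (- min (vartheta * chi) varrho)"
      using discsD(1)[OF d] by (intro powr_mono) (auto simp: mult.commute)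
    also have "\<dots> \<le> rate d" by (rule discsD(4)[OF d])
    finally show "0 \<le> (T / real (steps d)) powr (chi * vartheta) \<and> (T / real (steps d)) powr (chi * vartheta) \<le> T powr (chi * vartheta) * rate d"
      by (simp add: mult_left_mono)
  qed (use p rate_nonneg in auto)
  then show ?thesis
  proof (rule morder_mono)
    fix d t assume d: "d \<in> discs" "t \<in> {0..T}"
    note MI = discsD(1,2)[OF d(1)]
    show "(\<lambda>\<omega>. norm (F (grid_arg d t \<omega>) - force (steps d) (modes d) \<omega> t)) \<in> borel_measurable P"
      by (intro borel_measurable_norm[THEN measurable_compose[rotated]] borel_measurable_diff
        args_F_measurable[OF d(1)] force_measurable[OF MI])
    define t0 where "t0 = grid_floor (T / real (steps d)) t"
    define h where "h = T / real (steps d)"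
    have h: "0 < h" unfolding h_def by (rule step_pos[OF MI(1)])
    show "AE \<omega> in P. norm (F (grid_arg d t \<omega>) - force (steps d) (modes d) \<omega> t) \<le> (T / real (steps d)) powr (chi * vartheta)
        * (A d (grid_floor (T / real (steps d)) t) \<omega> powr vartheta * norm (F (\<X> (steps d) (modes d) (grid_floor (T / real (steps d)) t) \<omega>)))"
      using grid_arg_AE[OF d(1)]
    proof eventually_elim
      case (elim \<omega>)
      let ?f = "F (\<X> (steps d) (modes d) t0 \<omega>)"
      have g: "grid_arg d t \<omega> = \<X> (steps d) (modes d) t0 \<omega>" using elim d(2) by (simp add: t0_def)
      have f: "force (steps d) (modes d) \<omega> t = of_bool (A d t0 \<omega> \<le> h powr (- chi)) *\<^sub>R ?f"
        by (simp add: force_def truncated_force_def A_def t0_def h_def)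
      have A: "0 \<le> A d t0 \<omega>" by (simp add: A_def)
      have "norm (?f - of_bool (A d t0 \<omega> \<le> h powr (- chi)) *\<^sub>R ?f) \<le> h powr (chi * vartheta) * (A d t0 \<omega> powr vartheta * norm ?f)"
      proof (cases "A d t0 \<omega> \<le> h powr (- chi)")
        case True
        then show ?thesis by simp
      next
        case False
        then have "1 \<le> h powr chi * A d t0 \<omega>" using h by (simp add: powr_minus field_simps)
        then have "1 \<le> (h powr chi * A d t0 \<omega>) powr vartheta" using vartheta_pos by (intro ge_one_powr_ge_zero) auto
        also have "\<dots> = h powr (chi * vartheta) * A d t0 \<omega> powr vartheta" using A by (simp add: powr_mult powr_powr)
        finally have "1 * norm ?f \<le> h powr (chi * vartheta) * A d t0 \<omega> powr vartheta * norm ?f"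
          by (intro mult_right_mono) auto
        then show ?thesis using False by (simp add: mult.assoc)
      qed
      then show ?case unfolding g f unfolding t0_def h_def .
    qed
  qed (use p in auto)
qed

text \<open>The source term of \<open>pathwise_error\<close>. Its second summand is split at \<open>F (grid_arg d t \<omega>)\<close>.\<close>

definition defect :: "nat \<times> 'h set \<times> real \<Rightarrow> real \<Rightarrow> 'w \<Rightarrow> real" where
  "defect d t \<omega> = norm (F (X t \<omega>) - F (span_proj (modes d) (X t \<omega>)))
    + norm (F (continuous_arg d t \<omega>) - force (steps d) (modes d) \<omega> t)"

lemma defect_nonneg: "0 \<le> defect d t \<omega>"
  by (simp add: defect_def)

lemma defect_morder: "morder p rate defect"
proof -
  have "morder p rate (\<lambda>d t \<omega>. norm (F (X t \<omega>) - F (span_proj (modes d) (X t \<omega>)))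
      + (norm (F (continuous_arg d t \<omega>) - F (grid_arg d t \<omega>)) + norm (F (grid_arg d t \<omega>) - force (steps d) (modes d) \<omega> t)))"
    by (intro morder_add defect_space defect_time defect_truncation) (use p in auto)
  then show ?thesis
  proof (rule morder_mono)
    fix d t assume d: "d \<in> discs" "t \<in> {0..T}"
    show "defect d t \<in> borel_measurable P"
      unfolding defect_def[abs_def]
      by (intro borel_measurable_add borel_measurable_norm[THEN measurable_compose[rotated]] borel_measurable_diff
        args_F_measurable[OF d(1)] force_measurable[OF discsD(1,2)[OF d(1)]] X_measurable(1)[OF F_continuous])
    have "norm (a - b) \<le> norm (a - e) + norm (e - b)" for a b e :: 'h
      using norm_triangle_ineq[of "a - e" "e - b"] by simp
    then show "AE \<omega> in P. defect d t \<omega> \<le> norm (F (X t \<omega>) - F (span_proj (modes d) (X t \<omega>)))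
      + (norm (F (continuous_arg d t \<omega>) - F (grid_arg d t \<omega>)) + norm (F (grid_arg d t \<omega>) - force (steps d) (modes d) \<omega> t))"
      by (intro AE_I2) (simp add: defect_def)
  qed (use p defect_nonneg in auto)
qed

lemma defect_path:
  assumes d: "d \<in> discs" and \<omega>: "\<omega> \<in> space P"
  shows "continuous_on {0..T} (\<lambda>t. F (X t \<omega>))" "continuous_on {0..T} (\<lambda>t. F (span_proj (modes d) (X t \<omega>)))"
    "continuous_on {0..T} (\<lambda>t. F (continuous_arg d t \<omega>))"
proof -
  note I = discs_modes[OF d]
  show "continuous_on {0..T} (\<lambda>t. F (X t \<omega>))" by (rule path_continuous(1)[OF F_continuous \<omega>])
  show "continuous_on {0..T} (\<lambda>t. F (span_proj (modes d) (X t \<omega>)))"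
    by (rule continuous_on_compose2[OF continuous_on_F_span_proj[OF I] path_continuous(1)[OF continuous_map_V_inclusion \<omega>]]) simp
  have "continuous_on {0..T} (\<lambda>t. drift (steps d) (modes d) t \<omega>)"
    unfolding drift_def force_def
    by (intro continuous_on_convolution truncated_force_set_integrable step_pos discsD(1)[OF d])
  then have "continuous_on {0..T} (\<lambda>t. drift (steps d) (modes d) t \<omega> + O\<^sub>0 t \<omega>)"
    by (intro continuous_on_add path_continuous(2)[OF continuous_map_V_inclusion \<omega>])
  then show "continuous_on {0..T} (\<lambda>t. F (continuous_arg d t \<omega>))"
    unfolding continuous_arg_def by (rule continuous_on_compose2[OF continuous_on_F_span_proj[OF I]]) simp
qed

lemma defect_bounded:
  assumes d: "d \<in> discs" and \<omega>: "\<omega> \<in> space P"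
  shows "\<exists>K. \<forall>t\<in>{0..T}. defect d t \<omega> \<le> K"
proof -
  have "continuous_on {0..T} (\<lambda>t. norm (F (X t \<omega>) - F (span_proj (modes d) (X t \<omega>))) + norm (F (continuous_arg d t \<omega>)))"
    by (intro continuous_intros defect_path[OF assms])
  then have "compact ((\<lambda>t. norm (F (X t \<omega>) - F (span_proj (modes d) (X t \<omega>))) + norm (F (continuous_arg d t \<omega>))) ` {0..T})"
    by (intro compact_continuous_image) auto
  then have "bounded ((\<lambda>t. norm (F (X t \<omega>) - F (span_proj (modes d) (X t \<omega>))) + norm (F (continuous_arg d t \<omega>))) ` {0..T})"
    by (rule compact_imp_bounded)
  then obtain K where K: "\<forall>x\<in>(\<lambda>t. norm (F (X t \<omega>) - F (span_proj (modes d) (X t \<omega>))) + norm (F (continuous_arg d t \<omega>))) ` {0..T}. norm x \<le> K"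
    unfolding bounded_iff by (elim exE)
  obtain L where L: "\<forall>s\<in>{0..T}. norm (force (steps d) (modes d) \<omega> s) \<le> L" using force_path[OF discsD(1)[OF d]] by blast
  have "defect d t \<omega> \<le> K + L" if t: "t \<in> {0..T}" for t
  proof -
    have "norm (F (X t \<omega>) - F (span_proj (modes d) (X t \<omega>))) + norm (F (continuous_arg d t \<omega>)) \<le> K"
      using bspec[OF K imageI[OF t]] by simp
    moreover have "norm (F (continuous_arg d t \<omega>) - force (steps d) (modes d) \<omega> t)
        \<le> norm (F (continuous_arg d t \<omega>)) + norm (force (steps d) (modes d) \<omega> t)" by (rule norm_triangle_ineq4)
    ultimately show ?thesis using bspec[OF L t] unfolding defect_def by linarith
  qed
  then show ?thesis by blast
qed

abbreviation "clip s \<equiv> max 0 (min T s)"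

lemma clip: "clip s \<in> {0..T}" "s \<in> {0..T} \<Longrightarrow> clip s = s"
  using T_pos by auto

lemma defect_jointly_measurable:
  assumes d: "d \<in> discs"
  shows "(\<lambda>(s, \<omega>). defect d (clip s) \<omega>) \<in> borel_measurable (lborel \<Otimes>\<^sub>M P)"
proof -
  have clip_cont: "continuous_on UNIV clip" "range clip \<subseteq> {0..T}" using clip by (auto intro!: continuous_intros)
  note cont = measurable_continuous_process[OF clip_cont, of _ P]
  have [measurable]: "(\<lambda>(s, \<omega>). F (X (clip s) \<omega>)) \<in> borel_measurable (lborel \<Otimes>\<^sub>M P)"
    "(\<lambda>(s, \<omega>). F (span_proj (modes d) (X (clip s) \<omega>))) \<in> borel_measurable (lborel \<Otimes>\<^sub>M P)"
    "(\<lambda>(s, \<omega>). F (continuous_arg d (clip s) \<omega>)) \<in> borel_measurable (lborel \<Otimes>\<^sub>M P)"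
    by (rule cont[of "\<lambda>s \<omega>. F (X s \<omega>)"] cont[of "\<lambda>s \<omega>. F (span_proj (modes d) (X s \<omega>))"]
        cont[of "\<lambda>s \<omega>. F (continuous_arg d s \<omega>)"];
      use X_measurable(1)[OF F_continuous] args_F_measurable[OF d] defect_path[OF d] in blast)+
  have "(\<lambda>z. (clip (fst z), snd z)) \<in> lborel \<Otimes>\<^sub>M P \<rightarrow>\<^sub>M lborel \<Otimes>\<^sub>M P" by measurable
  from measurable_compose[OF this force_jointly_measurable[OF discsD(1,2)[OF d]]]
  have [measurable]: "(\<lambda>(s, \<omega>). force (steps d) (modes d) \<omega> (clip s)) \<in> borel_measurable (lborel \<Otimes>\<^sub>M P)"
    by (simp add: split_beta')
  show ?thesis unfolding defect_def by measurable
qed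

section \<open>The strong error estimate\<close>

text \<open>The pathwise estimate bounds the square of the error by the time integral of the squared defect,
  whose moments of order \<open>p / 2 \<ge> 1\<close> are bounded by Jensen's inequality. The defect is frozen outside
  of \<open>[0, T]\<close> because its joint measurability is deduced from the continuity of paths on that interval.\<close>

lemma drift_error_morder:
  "morder p rate (\<lambda>d t \<omega>. norm (span_proj (modes d) (X t \<omega>) - span_proj (modes d) (O\<^sub>0 t \<omega>) - drift (steps d) (modes d) t \<omega>))"
proof -
  define Y where "Y d s \<omega> = (defect d (clip s) \<omega>)\<^sup>2" for d s \<omega>
  define E where "E = exp ((2 * c + 1) * T)"
  define J where "J d \<omega> = (LINT s|lborel. indicator {0..T} s * Y d s \<omega>)" for d \<omega>
  have pow: "x powr 2 = x\<^sup>2" if "0 \<le> x" for x :: real using that by (cases "x = 0") simp_all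
  have "morder (p / 2) (\<lambda>d. rate d powr 2) (\<lambda>d t \<omega>. defect d t \<omega> powr 2)"
    by (rule morder_powr) (use defect_morder in simp)
  then have "morder (p / 2) (\<lambda>d. rate d powr 2) (\<lambda>d t \<omega>. (defect d t \<omega>)\<^sup>2)"
    by (simp only: pow[OF defect_nonneg])
  from morder_time_change[OF this clip(1)]
  have Y: "morder (p / 2) (\<lambda>d. rate d powr 2) Y" by (simp add: Y_def[abs_def])
  have Y_joint: "(\<lambda>(s, \<omega>). Y d s \<omega>) \<in> borel_measurable (lborel \<Otimes>\<^sub>M P)" if "d \<in> discs" for d
    using borel_measurable_power[OF defect_jointly_measurable[OF that], of 2] by (simp add: Y_def split_beta')
  have Y_bounded: "\<exists>K. \<forall>s\<in>{0..T}. Y d s \<omega> \<le> K" if "d \<in> discs" "\<omega> \<in> space P" for d \<omega>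
  proof -
    obtain K where "\<forall>t\<in>{0..T}. defect d t \<omega> \<le> K" using defect_bounded[OF \<open>d \<in> discs\<close> \<open>\<omega> \<in> space P\<close>] by blast
    then have "Y d s \<omega> \<le> K\<^sup>2" for s
      unfolding Y_def using clip(1) by (intro power_mono defect_nonneg) blast
    then show ?thesis by blast
  qed
  have "morder (p / 2) (\<lambda>d. rate d powr 2) (\<lambda>d t \<omega>. J d \<omega>)"
    unfolding J_def
    by (rule morder_kernel[OF Y, where \<kappa>=T]) (use p T_pos Y_joint Y_bounded in \<open>auto simp: Y_def\<close>)
  then have "morder (1 / 2 * p) (\<lambda>d. rate d powr 2) (\<lambda>d t \<omega>. E * J d \<omega>)"
    by (intro morder_cmult) (auto simp: E_def)
  then have "morder p (\<lambda>d. (rate d powr 2) powr (1/2)) (\<lambda>d t \<omega>. (E * J d \<omega>) powr (1/2))" by (rule morder_powr)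
  then have "morder p rate (\<lambda>d t \<omega>. (E * J d \<omega>) powr (1/2))"
    by (rule morder_weight) (use p rate_nonneg in \<open>auto simp: powr_powr\<close>)
  then show ?thesis
  proof (rule morder_mono)
    fix d t assume d: "d \<in> discs" "t \<in> {0..T}"
    note MI = discsD(1,2)[OF d(1)] and I = discs_modes[OF d(1)]
    have cP: "continuous_on UNIV (span_proj (modes d))"
      using bounded_linear_span_proj linear_continuous_on by blast
    show "(\<lambda>\<omega>. norm (span_proj (modes d) (X t \<omega>) - span_proj (modes d) (O\<^sub>0 t \<omega>) - drift (steps d) (modes d) t \<omega>)) \<in> borel_measurable P"
      by (intro borel_measurable_norm[THEN measurable_compose[rotated]] borel_measurable_diff
        continuous_section_measurable[OF cP] X_measurable(1,2)[OF continuous_map_V_inclusion] drift_measurable[OF MI])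
    show "AE \<omega> in P. norm (span_proj (modes d) (X t \<omega>) - span_proj (modes d) (O\<^sub>0 t \<omega>) - drift (steps d) (modes d) t \<omega>)
        \<le> (E * J d \<omega>) powr (1/2)"
      using AE_space mild_solution_coordinates scheme_path_AE[OF MI]
    proof eventually_elim
      case (elim \<omega>)
      let ?I = "modes d"
      let ?f = "truncated_force (T / real (steps d)) (\<lambda>t. \<X> (steps d) ?I t \<omega>) (\<lambda>t. \<O> (steps d) ?I t \<omega>)"
      let ?g = "\<lambda>s. norm (F (X s \<omega>) - F (span_proj ?I (X s \<omega>))) + norm (F (convolution ?I ?f s + span_proj ?I (O\<^sub>0 s \<omega>)) - ?f s)"
      have g: "?g s = defect d s \<omega>" for s
        using span_proj_drift[OF MI(2), of "steps d" s \<omega>]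
        by (simp add: defect_def continuous_arg_def span_proj_add drift_def force_def)
      have [measurable]: "(\<lambda>s. Y d s \<omega>) \<in> borel_measurable lborel"
        using measurable_compose[OF measurable_Pair2'[OF elim(1)] Y_joint[OF d(1)]] by simp
      obtain K where K: "\<And>s. s \<in> {0..T} \<Longrightarrow> Y d s \<omega> \<le> K" using Y_bounded[OF d(1) elim(1)] by blast
      have gY: "(?g s)\<^sup>2 = Y d s \<omega>" if "s \<in> {0..T}" for s unfolding g Y_def using clip(2)[OF that] by simp
      have "integrable lborel (\<lambda>s. indicator {0..T} s *\<^sub>R Y d s \<omega>)"
      proof (rule integrableI_bounded_set_indicator[where B=K])
        show "emeasure lborel {0..T} < \<infinity>" using T_pos by simp
        show "AE s in lborel. s \<in> {0..T} \<longrightarrow> norm (Y d s \<omega>) \<le> K" using K by (intro AE_I2) (auto simp: Y_def)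
      qed auto
      moreover have same: "indicator {0..T} s *\<^sub>R (?g s)\<^sup>2 = indicator {0..T} s *\<^sub>R Y d s \<omega>" for s
        using gY by (cases "s \<in> {0..T}") auto
      ultimately have int: "set_integrable lborel {0..T} (\<lambda>s. (?g s)\<^sup>2)" by (simp only: set_integrable_def same)
      have "(norm (span_proj ?I (X t \<omega>) - span_proj ?I (O\<^sub>0 t \<omega>) - drift (steps d) ?I t \<omega>))\<^sup>2
          \<le> E * (LINT s:{0..T}|lborel. (?g s)\<^sup>2)"
        unfolding E_def drift_def force_def
        by (rule pathwise_error[OF elim(3) defect_path(1)[OF d(1) elim(1)] _ int d(2)]) (use elim(2) in auto)
      also have "(LINT s:{0..T}|lborel. (?g s)\<^sup>2) = J d \<omega>"
        unfolding set_lebesgue_integral_def J_def by (simp only: same) simp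
      finally have "norm (span_proj ?I (X t \<omega>) - span_proj ?I (O\<^sub>0 t \<omega>) - drift (steps d) ?I t \<omega>) \<le> sqrt (E * J d \<omega>)"
        by (rule real_le_rsqrt)
      also have "\<dots> = (E * J d \<omega>) powr (1/2)"
      proof -
        have "0 \<le> J d \<omega>" unfolding J_def Y_def by (intro Bochner_Integration.integral_nonneg) auto
        then show ?thesis by (simp add: powr_half_sqrt E_def)
      qed
      finally show ?case .
    qed
  qed (use p in auto)
qed

lemma strong_error:
  "morder p rate (\<lambda>d t \<omega>. norm (X t \<omega> - \<X> (steps d) (modes d) t \<omega>))"
proof -
  have "morder p rate (\<lambda>d t \<omega>. cH * normV (X t \<omega> - span_proj (modes d) (X t \<omega>))
    + (norm (span_proj (modes d) (X t \<omega>) - span_proj (modes d) (O\<^sub>0 t \<omega>) - drift (steps d) (modes d) t \<omega>)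
      + cH * normV (span_proj (modes d) (O\<^sub>0 t \<omega>) - \<O> (steps d) (modes d) t \<omega>)))"
    by (intro morder_add morder_cmult drift_error_morder morder_half[OF complement_morder rate_nonneg]
        morder_half[OF discs_noise_moments(2) rate_nonneg])
      (use cH_pos p in auto)
  then show ?thesis
  proof (rule morder_mono)
    fix d t assume d: "d \<in> discs" "t \<in> {0..T}"
    note MI = discsD(1,2)[OF d(1)] and I = discs_modes[OF d(1)]
    show "(\<lambda>\<omega>. norm (X t \<omega> - \<X> (steps d) (modes d) t \<omega>)) \<in> borel_measurable P"
      by (intro borel_measurable_norm[THEN measurable_compose[rotated]] borel_measurable_diff
        X_measurable(1)[OF continuous_map_V_inclusion] args_measurable(2)[OF d(1)])
    show "AE \<omega> in P. norm (X t \<omega> - \<X> (steps d) (modes d) t \<omega>) \<le> cH * normV (X t \<omega> - span_proj (modes d) (X t \<omega>))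
    + (norm (span_proj (modes d) (X t \<omega>) - span_proj (modes d) (O\<^sub>0 t \<omega>) - drift (steps d) (modes d) t \<omega>)
      + cH * normV (span_proj (modes d) (O\<^sub>0 t \<omega>) - \<O> (steps d) (modes d) t \<omega>))"
      using AE_space scheme_drift[OF MI d(2)]
    proof eventually_elim
      case (elim \<omega>)
      let ?I = "modes d" and ?o = "\<O> (steps d) (modes d) t \<omega>"
      have "?o \<in> V" using V_span_proj[OF I, of ?o] noise_span[OF MI elim(1)] by simp
      then have V2: "X t \<omega> - span_proj ?I (X t \<omega>) \<in> V" "span_proj ?I (O\<^sub>0 t \<omega>) - ?o \<in> V"
        using I X_V[OF elim(1)] by (auto intro!: V_diff)
      have tri: "norm (a + (b + e)) \<le> norm a + (norm b + norm e)" for a b e :: 'h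
        using norm_triangle_ineq[of a "b + e"] norm_triangle_ineq[of b e] by linarith
      have eq: "X t \<omega> - \<X> (steps d) ?I t \<omega> = (X t \<omega> - span_proj ?I (X t \<omega>))
          + ((span_proj ?I (X t \<omega>) - span_proj ?I (O\<^sub>0 t \<omega>) - drift (steps d) ?I t \<omega>) + (span_proj ?I (O\<^sub>0 t \<omega>) - ?o))"
        using elim(2) by simp
      have "norm (X t \<omega> - \<X> (steps d) ?I t \<omega>) \<le> norm (X t \<omega> - span_proj ?I (X t \<omega>))
          + (norm (span_proj ?I (X t \<omega>) - span_proj ?I (O\<^sub>0 t \<omega>) - drift (steps d) ?I t \<omega>) + norm (span_proj ?I (O\<^sub>0 t \<omega>) - ?o))"
        unfolding eq by (rule tri)
      with norm_le_normV[OF V2(1)] norm_le_normV[OF V2(2)] show ?case by linarith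
    qed
  qed (use p in auto)
qed

end

lemma ennreal_powr_le:
  assumes "x \<le> ennreal k" "0 \<le> k" "0 \<le> a"
  shows "ennreal_powr x a \<le> ennreal (k powr a)"
proof (cases x)
  case (real y)
  then have "y \<le> k" using assms by (simp add: ennreal_le_iff)
  then have "y powr a \<le> k powr a" using real(1) assms(3) by (intro powr_mono2)
  then show ?thesis using real by (simp add: ennreal_powr_def ennreal_leI)
qed (use assms in \<open>simp add: top_unique\<close>)

lemma le_if_ennreal_powr_le:
  assumes "ennreal_powr x a \<le> ennreal s" "0 \<le> s" "0 < a"
  shows "x \<le> ennreal (s powr (1 / a))"
proof (cases x)
  case (real y)
  then have "y powr a \<le> s" using assms by (simp add: ennreal_powr_def ennreal_le_iff)
  then have "(y powr a) powr (1 / a) \<le> s powr (1 / a)" using assms(3) by (intro powr_mono2) auto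
  then have "y \<le> s powr (1 / a)" using real(1) assms(3) by (simp add: powr_powr)
  then show ?thesis unfolding real(2) by (rule ennreal_leI)
qed (use assms in \<open>simp add: ennreal_powr_def top_unique\<close>)

context spde_scheme
begin

lemma discsI:
  assumes M: "1 \<le> M" and I: "I \<in> \<D>" and e: "0 < e" "real M powr (- min (vartheta * chi) varrho) \<le> e"
    "\<And>i. i \<in> B \<Longrightarrow> i \<notin> I \<Longrightarrow> (- \<mu> i) powr (- varrho) \<le> e"
    and mom: "\<And>t. t \<in> {0..T} \<Longrightarrow> (\<integral>\<^sup>+ \<omega>. ennreal (normV (O\<^sub>0 t \<omega> - span_proj I (O\<^sub>0 t \<omega>)) powr (2 * p)
        + normV (span_proj I (O\<^sub>0 t \<omega>) - \<O> M I t \<omega>) powr (2 * p)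
        + normV (span_proj I (O\<^sub>0 t \<omega> - O\<^sub>0 (grid_floor (T / M) t) \<omega>)) powr (2 * p)) \<partial>P) \<le> ennreal (e powr (2 * p))"
  shows "(M, I, e) \<in> discs"
proof -
  note fI = D[OF I]
  have OV: "\<O> M I t \<omega> \<in> V" if "\<omega> \<in> space P" for t \<omega>
    using V_span_proj[OF fI, of "\<O> M I t \<omega>"] noise_span[OF M I that] by simp
  have le: "(\<integral>\<^sup>+\<omega>. ennreal (f \<omega>) \<partial>P) \<le> ennreal (e powr (2 * p))"
    if "t \<in> {0..T}" "\<And>\<omega>. f \<omega> \<le> normV (O\<^sub>0 t \<omega> - span_proj I (O\<^sub>0 t \<omega>)) powr (2 * p)
        + normV (span_proj I (O\<^sub>0 t \<omega>) - \<O> M I t \<omega>) powr (2 * p)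
        + normV (span_proj I (O\<^sub>0 t \<omega> - O\<^sub>0 (grid_floor (T / M) t) \<omega>)) powr (2 * p)" for t f
    by (rule order_trans[OF nn_integral_mono mom[OF that(1)]]) (intro ennreal_leI that(2))
  have meas: "(\<lambda>\<omega>. normV (span_proj I (O\<^sub>0 t \<omega>) - \<O> M I t \<omega>)) \<in> borel_measurable P" for t
  proof -
    have "(\<lambda>\<omega>. normV (span_proj I (O\<^sub>0 t \<omega> - \<O> M I t \<omega>))) \<in> borel_measurable P"
      by (intro continuous_section_measurable[OF continuous_on_normV_span_proj[OF fI]] borel_measurable_diff
          X_measurable(2)[OF continuous_map_V_inclusion] noise_measurable[OF M I])
    then show ?thesis
      by (rule measurable_cong[THEN iffD1, rotated]) (simp add: span_proj_diff noise_span[OF M I])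
  qed
  have meas3: "(\<lambda>\<omega>. normV (span_proj I (O\<^sub>0 t \<omega> - O\<^sub>0 u \<omega>))) \<in> borel_measurable P" for t u
    by (intro continuous_section_measurable[OF continuous_on_normV_span_proj[OF fI]] borel_measurable_diff
          X_measurable(2)[OF continuous_map_V_inclusion])
  have "moment_le P (2 * p) (\<lambda>\<omega>. normV (O\<^sub>0 t \<omega> - span_proj I (O\<^sub>0 t \<omega>))) (e powr (2 * p)) \<and>
      moment_le P (2 * p) (\<lambda>\<omega>. normV (span_proj I (O\<^sub>0 t \<omega>) - \<O> M I t \<omega>)) (e powr (2 * p)) \<and>
      moment_le P (2 * p) (\<lambda>\<omega>. normV (span_proj I (O\<^sub>0 t \<omega> - O\<^sub>0 (grid_floor (T / M) t) \<omega>))) (e powr (2 * p))"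
    if t: "t \<in> {0..T}" for t
    unfolding moment_le_def
    using X_measurable(2)[OF continuous_map_V_complement[OF fI]] meas meas3 fI O_V OV
    by (auto intro!: le[OF t] normV_nonneg V_diff)
  then show ?thesis using assms(1-4) e(3) by (auto simp: discs_def)
qed

text \<open>The number \<open>e\<close> is the sum on the right-hand side. If the noise makes this infinite, there is
  nothing to prove.\<close>

lemma error_estimate:
  "\<exists>C>0. \<forall>M::nat. 1 \<le> M \<longrightarrow> (\<forall>I\<in>\<D>.
    (SUP t\<in>{0..T}. ennreal_powr (\<integral>\<^sup>+\<omega>. ennreal (norm (X t \<omega> - \<X> M I t \<omega>) powr p) \<partial>P) (1 / p))
    \<le> ennreal C * (ennreal (M powr (- min (vartheta * chi) varrho))
       + ennreal (onorm (\<lambda>v. neg_power B \<mu> (- varrho) (v - span_proj I v)))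
       + (SUP t\<in>{0..T}. ennreal_powr (\<integral>\<^sup>+\<omega>. ennreal
            (normV (O\<^sub>0 t \<omega> - span_proj I (O\<^sub>0 t \<omega>)) powr (2 * p)
             + normV (span_proj I (O\<^sub>0 t \<omega>) - \<O> M I t \<omega>) powr (2 * p)
             + normV (span_proj I (O\<^sub>0 t \<omega> - O\<^sub>0 (grid_floor (T / M) t) \<omega>)) powr (2 * p)) \<partial>P) (1 / (2 * p)))))"
proof -
  obtain K where K: "0 \<le> K" "\<And>d t. d \<in> discs \<Longrightarrow> t \<in> {0..T} \<Longrightarrow>
      moment_le P p (\<lambda>\<omega>. norm (X t \<omega> - \<X> (steps d) (modes d) t \<omega>)) (K * rate d powr p)"
    using strong_error unfolding morder_def by blast
  have p0: "0 < p" using p by simp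
  define C where "C = K powr (1 / p) + 1"
  have C: "0 < C" "K powr (1 / p) \<le> C" by (simp_all add: C_def add_nonneg_pos)
  show ?thesis
  proof (intro exI[of _ C] conjI allI impI ballI C(1))
    fix M :: nat and I assume M: "1 \<le> M" and I: "I \<in> \<D>"
    define R where "R t = (\<integral>\<^sup>+\<omega>. ennreal
            (normV (O\<^sub>0 t \<omega> - span_proj I (O\<^sub>0 t \<omega>)) powr (2 * p)
             + normV (span_proj I (O\<^sub>0 t \<omega>) - \<O> M I t \<omega>) powr (2 * p)
             + normV (span_proj I (O\<^sub>0 t \<omega> - O\<^sub>0 (grid_floor (T / M) t) \<omega>)) powr (2 * p)) \<partial>P)" for t
    define S where "S = (SUP t\<in>{0..T}. ennreal_powr (R t) (1 / (2 * p)))"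
    define a where "a = real M powr (- min (vartheta * chi) varrho)"
    define k where "k = onorm (\<lambda>v. neg_power B \<mu> (- varrho) (v - span_proj I v))"
    have a: "0 < a" using M by (simp add: a_def)
    have k: "0 \<le> k" "\<And>i. i \<in> B \<Longrightarrow> i \<notin> I \<Longrightarrow> (- \<mu> i) powr (- varrho) \<le> k"
      unfolding k_def using onorm_complement[OF D[OF I] varrho(1)] by auto
    have "(SUP t\<in>{0..T}. ennreal_powr (\<integral>\<^sup>+\<omega>. ennreal (norm (X t \<omega> - \<X> M I t \<omega>) powr p) \<partial>P) (1 / p))
        \<le> ennreal C * (ennreal a + ennreal k + S)"
    proof (cases S)
      case top
      then show ?thesis using C(1) by (simp add: ennreal_mult_top)
    next
      case (real s)
      define e where "e = a + k + s"
      have e: "0 < e" "a \<le> e" "k \<le> e" "s \<le> e" using a k real by (auto simp: e_def)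
      have "R t \<le> ennreal (e powr (2 * p))" if "t \<in> {0..T}" for t
      proof -
        have "ennreal_powr (R t) (1 / (2 * p)) \<le> S" unfolding S_def using that by (rule SUP_upper)
        then have "R t \<le> ennreal (s powr (1 / (1 / (2 * p))))"
          using real p0 by (intro le_if_ennreal_powr_le) auto
        also have "\<dots> \<le> ennreal (e powr (2 * p))"
          using real(1) e p0 by (intro ennreal_leI) (auto intro!: powr_mono2)
        finally show ?thesis .
      qed
      then have d: "(M, I, e) \<in> discs"
        using M I e k(2) by (intro discsI) (auto simp: a_def R_def intro: order_trans)
      have "ennreal_powr (\<integral>\<^sup>+\<omega>. ennreal (norm (X t \<omega> - \<X> M I t \<omega>) powr p) \<partial>P) (1 / p) \<le> ennreal C * (ennreal a + ennreal k + S)"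
        if t: "t \<in> {0..T}" for t
      proof -
        have "(\<integral>\<^sup>+\<omega>. ennreal (norm (X t \<omega> - \<X> M I t \<omega>) powr p) \<partial>P) \<le> ennreal (K * e powr p)"
          using K(2)[OF d t] by (simp add: moment_le_def)
        then have "ennreal_powr (\<integral>\<^sup>+\<omega>. ennreal (norm (X t \<omega> - \<X> M I t \<omega>) powr p) \<partial>P) (1 / p) \<le> ennreal ((K * e powr p) powr (1 / p))"
          using K(1) p0 by (intro ennreal_powr_le) auto
        also have "(K * e powr p) powr (1 / p) = K powr (1 / p) * e"
          using K(1) e(1) p0 by (simp add: powr_mult powr_powr)
        also have "ennreal (K powr (1 / p) * e) \<le> ennreal (C * e)"
          using C(2) e(1) by (intro ennreal_leI mult_right_mono) auto
        also have "\<dots> = ennreal C * (ennreal a + ennreal k + S)"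
          using C(1) a k(1) real by (simp add: e_def ennreal_mult)
        finally show ?thesis .
      qed
      then show ?thesis by (rule SUP_least)
    qed
    then show "(SUP t\<in>{0..T}. ennreal_powr (\<integral>\<^sup>+\<omega>. ennreal (norm (X t \<omega> - \<X> M I t \<omega>) powr p) \<partial>P) (1 / p))
    \<le> ennreal C * (ennreal (M powr (- min (vartheta * chi) varrho))
       + ennreal (onorm (\<lambda>v. neg_power B \<mu> (- varrho) (v - span_proj I v)))
       + (SUP t\<in>{0..T}. ennreal_powr (\<integral>\<^sup>+\<omega>. ennreal
            (normV (O\<^sub>0 t \<omega> - span_proj I (O\<^sub>0 t \<omega>)) powr (2 * p)
             + normV (span_proj I (O\<^sub>0 t \<omega>) - \<O> M I t \<omega>) powr (2 * p)
             + normV (span_proj I (O\<^sub>0 t \<omega> - O\<^sub>0 (grid_floor (T / M) t) \<omega>)) powr (2 * p)) \<partial>P) (1 / (2 * p))))"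
      by (simp only: S_def R_def a_def k_def)
  qed
qed

lemma two_qN: "2 * qN = p * Max {4 * vartheta, 4 + 2 * varphi, varphi * (1 + varphi/2)}"
  by (simp add: qN_def max_def algebra_simps)

lemma scheme_moments_SUP:
  "(SUP M\<in>{1..}. SUP I\<in>\<D>. SUP t\<in>{0..T}. \<integral>\<^sup>+\<omega>. ennreal (interp_norm B \<mu> \<gamma> (\<X> M I t \<omega>)
     powr (p * Max {4 * vartheta, 4 + 2 * varphi, varphi * (1 + varphi/2)})) \<partial>P) < \<infinity>"
proof -
  obtain K where K: "\<forall>M\<ge>1. \<forall>I\<in>\<D>. \<forall>t\<in>{0..T}. moment_le P (2 * qN) (\<lambda>\<omega>. interp_norm B \<mu> \<gamma> (\<X> M I t \<omega>)) K"
    using scheme_moments by blast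
  have "(SUP M\<in>{1..}. SUP I\<in>\<D>. SUP t\<in>{0..T}. \<integral>\<^sup>+\<omega>. ennreal (interp_norm B \<mu> \<gamma> (\<X> M I t \<omega>)
     powr (p * Max {4 * vartheta, 4 + 2 * varphi, varphi * (1 + varphi/2)})) \<partial>P) \<le> ennreal K"
    using K unfolding two_qN by (intro SUP_least) (auto simp: moment_le_def)
  then show ?thesis by (auto simp: order_le_less_trans)
qed

end

lemma path_in_path_metric:
  assumes "continuous_map (top_of_set {0..T}) (mtopology_of m) x"
  shows "restrict x {0..T} \<in> mspace (path_metric T m)"
proof -
  have cont: "continuous_map (top_of_set {0..T}) (mtopology_of m) (restrict x {0..T})"
    by (rule continuous_map_eq[OF assms]) auto
  then have "x t \<in> mspace m" if "t \<in> {0..T}" for t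
    using continuous_map_image_subset_topspace[OF assms] that by auto
  moreover have "compactin (top_of_set {0..T}) {0..T}" by (simp add: compactin_subtopology)
  ultimately show ?thesis
    unfolding path_metric_def by (subst compactin_mspace_cfunspace) (use cont in auto)
qed

theorem theorem5p5:
  fixes B :: "'h::{real_inner, banach, second_countable_topology} set"
    and \<mu> :: "'h \<Rightarrow> real"
    and \<D> :: "'h set set"
    and T c varphi \<epsilon> \<rho> \<gamma> chi vartheta p varrho :: real
    and V :: "'h set" and normV :: "'h \<Rightarrow> real"
    and \<phi> \<Phi> :: "(real \<Rightarrow> 'h) \<Rightarrow> real"
    and F :: "'h \<Rightarrow> 'h"
    and P :: "'w measure"
    and X O\<^sub>0 :: "real \<Rightarrow> 'w \<Rightarrow> 'h"
    and \<O> \<X> :: "nat \<Rightarrow> 'h set \<Rightarrow> real \<Rightarrow> 'w \<Rightarrow> 'h"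
  assumes "B \<noteq> {}" and "orthonormal_basis B"
    and "T > 0" and "c > 0" and "varphi > 0"
    and "0 \<le> \<epsilon>" and "\<epsilon> < 1"
    and "0 \<le> \<rho>" and "\<rho> < 1/2"
    and "\<rho> < \<gamma>" and "\<gamma> \<le> 1/2"
    and "0 < chi" and "chi \<le> (\<gamma> - \<rho>) / (1 + varphi/2)" and "chi \<le> (1 - \<rho>) / (1 + varphi)"
    and "\<D> \<subseteq> Fpow B - {{}}"
    and "bdd_above (\<mu> ` B)" and "(SUP h\<in>B. \<mu> h) < 0"
    and "norm_on V normV" and "mcomplete_of (norm_metric V normV)"
    and "dense_continuous_embedding (interp_metric B \<mu> \<rho>) (norm_metric V normV)"
    and "dense_continuous_embedding (norm_metric V normV) (norm_metric UNIV norm)"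
    and "\<phi> \<in> metric_borel (path_metric T (interp_metric B \<mu> 1)) \<rightarrow>\<^sub>M borel"
    and "\<And>x. x \<in> mspace (path_metric T (interp_metric B \<mu> 1)) \<Longrightarrow> 0 \<le> \<phi> x"
    and "\<Phi> \<in> metric_borel (path_metric T (interp_metric B \<mu> 1)) \<rightarrow>\<^sub>M borel"
    and "\<And>x. x \<in> mspace (path_metric T (interp_metric B \<mu> 1)) \<Longrightarrow> 0 \<le> \<Phi> x"
    and "continuous_map (mtopology_of (norm_metric V normV)) euclidean F"
    and monotone: "\<And>I v w. I \<in> Fpow B \<Longrightarrow> v \<in> range (span_proj I) \<Longrightarrow> w \<in> range (span_proj I) \<Longrightarrow>
      (v - w) \<bullet> (diag_op B \<mu> v + F v - diag_op B \<mu> w - F w) \<le> c * (norm (v - w))\<^sup>2"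
    and coercive: "\<And>I v x. I \<in> Fpow B \<Longrightarrow> v \<in> range (span_proj I) \<Longrightarrow>
      x \<in> mspace (path_metric T (interp_metric B \<mu> 1)) \<Longrightarrow>
      (SUP t\<in>{0..T}. ereal (interp_inner B \<mu> (1/2) v (span_proj I (F (v + x t)))
                           + \<phi> x * (v \<bullet> F (v + x t))))
      \<le> ereal (\<epsilon> * (interp_norm B \<mu> 1 v)\<^sup>2 + (c + \<phi> x) * (interp_norm B \<mu> (1/2) v)\<^sup>2
               + c * \<phi> x * (norm v)\<^sup>2 + \<Phi> x)"
    and local_lipschitz: "\<And>I v w. I \<in> Fpow B \<Longrightarrow> v \<in> range (span_proj I) \<Longrightarrow> w \<in> range (span_proj I) \<Longrightarrow>
      (norm (F v - F w))\<^sup>2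
      \<le> c * (normV (v - w))\<^sup>2 * (1 + normV v powr varphi + normV w powr varphi)"
    and "prob_space P"
    and "continuous_process P T (norm_metric V normV) X"
    and "continuous_process P T (norm_metric V normV) O\<^sub>0"
    and "\<And>M I. M \<ge> 1 \<Longrightarrow> I \<in> \<D> \<Longrightarrow> continuous_process P T (interp_metric B \<mu> 1) (\<O> M I)"
    and "\<And>M I. M \<ge> 1 \<Longrightarrow> I \<in> \<D> \<Longrightarrow> process P T (interp_metric B \<mu> \<gamma>) (\<X> M I)"
    and "\<And>M I t \<omega>. M \<ge> 1 \<Longrightarrow> I \<in> \<D> \<Longrightarrow> t \<in> {0..T} \<Longrightarrow> \<omega> \<in> space P \<Longrightarrow>
      \<O> M I t \<omega> \<in> range (span_proj I)"
    and mild_solution: "\<And>t. t \<in> {0..T} \<Longrightarrow>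
      (AE \<omega> in P. X t \<omega> =
        (LINT s:{0..t}|lborel. diag_semigroup B \<mu> (t - s) (F (X s \<omega>))) + O\<^sub>0 t \<omega>)"
    and scheme: "\<And>M I t. M \<ge> 1 \<Longrightarrow> I \<in> \<D> \<Longrightarrow> t \<in> {0..T} \<Longrightarrow>
      (AE \<omega> in P. \<X> M I t \<omega> =
        (LINT s:{0..t}|lborel. span_proj I (diag_semigroup B \<mu> (t - s)
          (of_bool (interp_norm B \<mu> \<gamma> (\<X> M I (grid_floor (T / M) s) \<omega>)
                    + interp_norm B \<mu> \<gamma> (\<O> M I (grid_floor (T / M) s) \<omega>) \<le> (M / T) powr chi)
           *\<^sub>R F (\<X> M I (grid_floor (T / M) s) \<omega>)))) + \<O> M I t \<omega>)"
    and "vartheta > 0" and "max 2 (1 / varphi) \<le> p"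
    and "0 \<le> varrho" and "varrho < 1 - \<rho>"
    and moments:
      "(SUP t\<in>{0..T}. SUP I\<in>\<D>. \<integral>\<^sup>+\<omega>. ennreal
          (normV (X t \<omega>) powr (p * (1 + varphi/2) * max 2 varphi)
           + normV (span_proj I (O\<^sub>0 t \<omega>)) powr (p * varphi)) \<partial>P)
       + (SUP M\<in>{1..}. SUP I\<in>\<D>. SUP t\<in>{0..T}. \<integral>\<^sup>+\<omega>. ennreal
          (\<bar>(interp_norm B \<mu> \<gamma> (\<O> M I t \<omega>))\<^sup>2 + \<Phi> (sample_path T (\<O> M I) \<omega>)
            + \<phi> (sample_path T (\<O> M I) \<omega>)\<bar>
           powr (p * Max {2 * vartheta, 2 + varphi, (1 + varphi/2) * varphi / 2})) \<partial>P) < \<infinity>"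
  shows
    "(SUP M\<in>{1..}. SUP I\<in>\<D>. SUP t\<in>{0..T}. \<integral>\<^sup>+\<omega>. ennreal
        (interp_norm B \<mu> \<gamma> (\<X> M I t \<omega>)
         powr (p * Max {4 * vartheta, 4 + 2 * varphi, varphi * (1 + varphi/2)})) \<partial>P) < \<infinity>
     \<and>
     (\<exists>C::real. C > 0 \<and> (\<forall>M::nat. M \<ge> 1 \<longrightarrow> (\<forall>I\<in>\<D>.
        (SUP t\<in>{0..T}. ennreal_powr (\<integral>\<^sup>+\<omega>. ennreal (norm (X t \<omega> - \<X> M I t \<omega>) powr p) \<partial>P) (1 / p))
        \<le> ennreal C *
          (ennreal (M powr (- min (vartheta * chi) varrho))
           + ennreal (onorm (\<lambda>v. neg_power B \<mu> (- varrho) (v - span_proj I v)))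
           + (SUP t\<in>{0..T}. ennreal_powr (\<integral>\<^sup>+\<omega>. ennreal
                (normV (O\<^sub>0 t \<omega> - span_proj I (O\<^sub>0 t \<omega>)) powr (2 * p)
                 + normV (span_proj I (O\<^sub>0 t \<omega>) - \<O> M I t \<omega>) powr (2 * p)
                 + normV (span_proj I (O\<^sub>0 t \<omega> - O\<^sub>0 (grid_floor (T / M) t) \<omega>)) powr (2 * p)) \<partial>P)
              (1 / (2 * p)))))))"
proof (cases "\<D> = {}")
  case True
  \<comment> \<open>Suprema over the empty set vanish. This case is separate because the assumption on the moments of
    \<open>X\<close> is a supremum over \<open>\<D>\<close> and has content only if \<open>\<D>\<close> has an element \<open>I\<^sub>0\<close>.\<close>
  then show ?thesis by (auto intro!: exI[of _ 1] simp: bot_ennreal)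
next
  case False
  then obtain I\<^sub>0 where I\<^sub>0: "I\<^sub>0 \<in> \<D>" by blast
  have T: "0 < T" by (rule assms(3))
  interpret negative_diagonal B \<mu> "- (SUP h\<in>B. \<mu> h)"
  proof
    show "orthonormal_basis B" by (rule assms(2))
    show "0 < - (SUP h\<in>B. \<mu> h)" using assms(17) by simp
    show "- (SUP h\<in>B. \<mu> h) \<le> - \<mu> h" if "h \<in> B" for h
      using cSUP_upper[OF that assms(16)] by simp
  qed
  note V = assms(18)
  have emb: "dense_continuous_embedding (norm_metric (interp_space B \<mu> \<rho>) (interp_norm B \<mu> \<rho>)) (norm_metric V normV)"
    using assms(20) by (simp add: interp_metric_def)
  note emb\<rho> = dense_continuous_embedding_norm_metricD[OF norm_on_interp_space V emb]
  note embH = dense_continuous_embedding_norm_metricD[OF V norm_on_UNIV_norm assms(21)]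
  obtain cV where cV: "0 < cV" "\<forall>v\<in>interp_space B \<mu> \<rho>. normV v \<le> cV * interp_norm B \<mu> \<rho> v" using emb\<rho>(2) by blast
  obtain cH where cH: "0 < cH" "\<forall>v\<in>V. norm v \<le> cH * normV v" using embH(2) by blast
  have coeff: "spde_coefficients B \<mu> (- (SUP h\<in>B. \<mu> h)) T c varphi \<epsilon> \<rho> \<gamma> chi V normV cV cH \<phi> \<Phi> F"
  proof (intro spde_coefficients.intro spde_coefficients_axioms.intro)
    show "interp_space B \<mu> \<rho> \<subseteq> V" by (rule emb\<rho>(1))
    show "negative_diagonal B \<mu> (- (SUP h\<in>B. \<mu> h))" by (rule negative_diagonal_axioms)
    show "normV v \<le> cV * interp_norm B \<mu> \<rho> v" if "v \<in> interp_space B \<mu> \<rho>" for v using cV(2) that by (rule bspec)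
    show "norm v \<le> cH * normV v" if "v \<in> V" for v using cH(2) that by (rule bspec)
    show "\<exists>w\<in>interp_space B \<mu> \<rho>. normV (v - w) < e" if "v \<in> V" "0 < e" for v e by (rule emb\<rho>(3)[OF that])
  qed (rule assms cV cH; assumption)+

  \<comment> \<open>The processes are given on \<open>[0, T]\<close>; composition with \<open>cl\<close> freezes them outside.\<close>
  define cl where "cl t = max 0 (min T t)" for t :: real
  have cl: "cl t \<in> {0..T}" "t \<in> {0..T} \<Longrightarrow> cl t = t" for t using T by (auto simp: cl_def)
  have cl_cont: "continuous_map euclideanreal (top_of_set {0..T}) cl"
    using cl(1) by (auto simp: continuous_map_in_subtopology cl_def[abs_def] intro!: continuous_intros)
  have process: "Y (cl t) \<in> P \<rightarrow>\<^sub>M metric_borel m" if "process P T m Y" for Y :: "real \<Rightarrow> 'w \<Rightarrow> 'h" and m t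
    using that cl(1) unfolding process_def by blast
  have path: "continuous_map euclideanreal (mtopology_of m) (\<lambda>t. Y (cl t) \<omega>)"
    if "continuous_process P T m Y" "\<omega> \<in> space P" for Y :: "real \<Rightarrow> 'w \<Rightarrow> 'h" and m \<omega>
    using continuous_map_compose[OF cl_cont, of "mtopology_of m" "\<lambda>t. Y t \<omega>"] that
    by (auto simp: continuous_process_def o_def)
  have proc: "process P T m Y" if "continuous_process P T m Y" for Y :: "real \<Rightarrow> 'w \<Rightarrow> 'h" and m
    using that by (simp add: continuous_process_def)
  have step: "grid_floor (T / real M) s \<in> {0..T}" if "1 \<le> M" "s \<in> {0..T}" for M :: nat and s
    using grid_floor_bounds[of "T / real M" s] that T by auto
  have D: "finite I" "I \<subseteq> B" if "I \<in> \<D>" for I using assms(15) that by (auto simp: Fpow_def)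
  have space_V: "Y (cl t) \<omega> \<in> V" if "process P T (norm_metric V normV) Y" "\<omega> \<in> space P" for Y :: "real \<Rightarrow> 'w \<Rightarrow> 'h" and t \<omega>
    using process_mspace[OF that(1) cl(1) that(2)] by (simp add: mspace_norm_metric[OF V])

  have sum_finite: "S1 < \<infinity>" "S2 < \<infinity>" if "S1 + S2 < \<infinity>" for S1 S2 :: ennreal
    using that by (auto simp: less_top[symmetric])
  obtain K1 where K1: "(SUP t\<in>{0..T}. SUP I\<in>\<D>. \<integral>\<^sup>+\<omega>. ennreal
          (normV (X t \<omega>) powr (p * (1 + varphi/2) * max 2 varphi)
           + normV (span_proj I (O\<^sub>0 t \<omega>)) powr (p * varphi)) \<partial>P) = ennreal K1"
    using sum_finite(1)[OF moments] by (auto simp: less_top_ennreal)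
  obtain K2 where K2: "(SUP M\<in>{1..}. SUP I\<in>\<D>. SUP t\<in>{0..T}. \<integral>\<^sup>+\<omega>. ennreal
          (\<bar>(interp_norm B \<mu> \<gamma> (\<O> M I t \<omega>))\<^sup>2 + \<Phi> (sample_path T (\<O> M I) \<omega>)
            + \<phi> (sample_path T (\<O> M I) \<omega>)\<bar>
           powr (p * Max {2 * vartheta, 2 + varphi, (1 + varphi/2) * varphi / 2})) \<partial>P) = ennreal K2"
    using sum_finite(2)[OF moments] by (auto simp: less_top_ennreal)
  have K1_le: "(\<integral>\<^sup>+\<omega>. ennreal (f \<omega>) \<partial>P) \<le> ennreal K1"
    if "t \<in> {0..T}" "I \<in> \<D>" and le: "\<And>\<omega>. f \<omega> \<le> normV (X t \<omega>) powr (p * (1 + varphi/2) * max 2 varphi)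
           + normV (span_proj I (O\<^sub>0 t \<omega>)) powr (p * varphi)" for t I f
    unfolding K1[symmetric]
    by (rule SUP_upper2[OF that(1)], rule SUP_upper2[OF that(2)], rule nn_integral_mono) (intro ennreal_leI le)

  interpret S: spde_scheme B \<mu> "- (SUP h\<in>B. \<mu> h)" T c varphi \<epsilon> \<rho> \<gamma> chi V normV cV cH \<phi> \<Phi> F P \<D>
    "\<lambda>t. X (cl t)" "\<lambda>t. O\<^sub>0 (cl t)" "\<lambda>M I t. \<O> M I (cl t)" "\<lambda>M I t. \<X> M I (cl t)" vartheta p varrho
  proof (intro spde_scheme.intro spde_scheme_axioms.intro coeff)
    show "prob_space P" by (rule assms(30))
    show "finite I" "I \<subseteq> B" if "I \<in> \<D>" for I by (rule D[OF that])+
    show "X (cl t) \<in> P \<rightarrow>\<^sub>M metric_borel (norm_metric V normV)" for t by (rule process[OF proc[OF assms(31)]])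
    show "O\<^sub>0 (cl t) \<in> P \<rightarrow>\<^sub>M metric_borel (norm_metric V normV)" for t by (rule process[OF proc[OF assms(32)]])
    show "X (cl t) \<omega> \<in> V" if "\<omega> \<in> space P" for t \<omega> by (rule space_V[OF proc[OF assms(31)] that])
    show "O\<^sub>0 (cl t) \<omega> \<in> V" if "\<omega> \<in> space P" for t \<omega> by (rule space_V[OF proc[OF assms(32)] that])
    show "continuous_map euclideanreal (mtopology_of (norm_metric V normV)) (\<lambda>t. X (cl t) \<omega>)" if "\<omega> \<in> space P" for \<omega>
      by (rule path[OF assms(31) that])
    show "continuous_map euclideanreal (mtopology_of (norm_metric V normV)) (\<lambda>t. O\<^sub>0 (cl t) \<omega>)" if "\<omega> \<in> space P" for \<omega>
      by (rule path[OF assms(32) that])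
    fix M :: nat and I assume MI: "1 \<le> M" "I \<in> \<D>"
    show "\<O> M I (cl t) \<in> P \<rightarrow>\<^sub>M metric_borel (interp_metric B \<mu> 1)" for t by (rule process[OF proc[OF assms(33)[OF MI]]])
    show "\<X> M I (cl t) \<in> P \<rightarrow>\<^sub>M metric_borel (interp_metric B \<mu> \<gamma>)" for t by (rule process[OF assms(34)[OF MI]])
    show "span_proj I (\<O> M I (cl t) \<omega>) = \<O> M I (cl t) \<omega>" if "\<omega> \<in> space P" for t \<omega>
      using assms(35)[OF MI cl(1) that] D[OF MI(2)] by (simp add: range_span_proj_iff)
    show "\<X> M I (cl t) \<omega> \<in> interp_space B \<mu> \<gamma>" if "\<omega> \<in> space P" for t \<omega>
      using process_mspace[OF assms(34)[OF MI] cl(1) that] by (simp add: interp_metric_def mspace_norm_metric[OF norm_on_interp_space])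
    show "restrict (\<lambda>t. \<O> M I (cl t) \<omega>) {0..T} \<in> mspace (path_metric T (interp_metric B \<mu> 1))" if "\<omega> \<in> space P" for \<omega>
    proof -
      have "restrict (\<lambda>t. \<O> M I (cl t) \<omega>) {0..T} = restrict (\<lambda>t. \<O> M I t \<omega>) {0..T}"
        by (rule restrict_ext) (simp add: cl)
      then show ?thesis
        using assms(33)[OF MI] that by (simp add: continuous_process_def path_in_path_metric)
    qed
    fix t assume t: "t \<in> {0..T}"
    show "AE \<omega> in P. \<X> M I (cl t) \<omega> =
        (LINT s:{0..t}|lborel. span_proj I (diag_semigroup B \<mu> (t - s)
          (of_bool (interp_norm B \<mu> \<gamma> (\<X> M I (cl (grid_floor (T / M) s)) \<omega>)
                    + interp_norm B \<mu> \<gamma> (\<O> M I (cl (grid_floor (T / M) s)) \<omega>) \<le> (M / T) powr chi)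
           *\<^sub>R F (\<X> M I (cl (grid_floor (T / M) s)) \<omega>)))) + \<O> M I (cl t) \<omega>"
      using scheme[OF MI t]
    proof eventually_elim
      case (elim \<omega>)
      have same: "cl (grid_floor (T / M) s) = grid_floor (T / M) s" if "s \<in> {0..t}" for s
        using step[OF MI(1), of s] that t by (intro cl(2)) auto
      have "(LINT s:{0..t}|lborel. span_proj I (diag_semigroup B \<mu> (t - s)
          (of_bool (interp_norm B \<mu> \<gamma> (\<X> M I (cl (grid_floor (T / M) s)) \<omega>)
                    + interp_norm B \<mu> \<gamma> (\<O> M I (cl (grid_floor (T / M) s)) \<omega>) \<le> (M / T) powr chi)
           *\<^sub>R F (\<X> M I (cl (grid_floor (T / M) s)) \<omega>))))
        = (LINT s:{0..t}|lborel. span_proj I (diag_semigroup B \<mu> (t - s)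
          (of_bool (interp_norm B \<mu> \<gamma> (\<X> M I (grid_floor (T / M) s) \<omega>)
                    + interp_norm B \<mu> \<gamma> (\<O> M I (grid_floor (T / M) s) \<omega>) \<le> (M / T) powr chi)
           *\<^sub>R F (\<X> M I (grid_floor (T / M) s) \<omega>))))"
        by (rule set_lebesgue_integral_cong) (simp_all add: same)
      then show ?case using elim cl(2)[OF t] by simp
    qed
  next
    fix t assume t: "t \<in> {0..T}"
    show "AE \<omega> in P. X (cl t) \<omega> =
        (LINT s:{0..t}|lborel. diag_semigroup B \<mu> (t - s) (F (X (cl s) \<omega>))) + O\<^sub>0 (cl t) \<omega>"
      using mild_solution[OF t]
    proof eventually_elim
      case (elim \<omega>)
      have "(LINT s:{0..t}|lborel. diag_semigroup B \<mu> (t - s) (F (X (cl s) \<omega>)))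
          = (LINT s:{0..t}|lborel. diag_semigroup B \<mu> (t - s) (F (X s \<omega>)))"
        by (rule set_lebesgue_integral_cong) (use t in \<open>auto simp: cl(2)\<close>)
      then show ?case using elim cl(2)[OF t] by simp
    qed
  next
    show "2 \<le> p" using assms(39) by simp
    have "1 / varphi \<le> p" using assms(39) by simp
    then show "1 \<le> p * varphi" using assms(5) by (simp add: field_simps)
    show "\<exists>K. \<forall>t\<in>{0..T}. (\<integral>\<^sup>+\<omega>. ennreal (normV (X (cl t) \<omega>) powr (p * (1 + varphi/2) * max 2 varphi)) \<partial>P) \<le> ennreal K"
    proof (intro exI[of _ K1] ballI)
      show "(\<integral>\<^sup>+\<omega>. ennreal (normV (X (cl t) \<omega>) powr (p * (1 + varphi/2) * max 2 varphi)) \<partial>P) \<le> ennreal K1" for t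
        by (rule K1_le[OF cl(1)[of t] I\<^sub>0]) simp
    qed
    show "\<exists>K. \<forall>t\<in>{0..T}. \<forall>I\<in>\<D>. (\<integral>\<^sup>+\<omega>. ennreal (normV (span_proj I (O\<^sub>0 (cl t) \<omega>)) powr (p * varphi)) \<partial>P) \<le> ennreal K"
    proof (intro exI[of _ K1] ballI)
      show "(\<integral>\<^sup>+\<omega>. ennreal (normV (span_proj I (O\<^sub>0 (cl t) \<omega>)) powr (p * varphi)) \<partial>P) \<le> ennreal K1"
        if "I \<in> \<D>" for t I by (rule K1_le[OF cl(1)[of t] that]) simp
    qed
    show "\<exists>K. \<forall>M\<ge>1. \<forall>I\<in>\<D>. \<forall>t\<in>{0..T}. (\<integral>\<^sup>+\<omega>. ennreal
        (\<bar>(interp_norm B \<mu> \<gamma> (\<O> M I (cl t) \<omega>))\<^sup>2 + \<Phi> (restrict (\<lambda>t. \<O> M I (cl t) \<omega>) {0..T})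
            + \<phi> (restrict (\<lambda>t. \<O> M I (cl t) \<omega>) {0..T})\<bar>
           powr (p * Max {2 * vartheta, 2 + varphi, (1 + varphi/2) * varphi / 2})) \<partial>P) \<le> ennreal K"
    proof (intro exI[of _ K2] allI impI ballI)
      fix M :: nat and I t assume "1 \<le> M" "I \<in> \<D>" and t: "t \<in> {0..T}"
      have r: "restrict (\<lambda>t. \<O> M I (cl t) \<omega>) {0..T} = sample_path T (\<O> M I) \<omega>" for \<omega>
        unfolding sample_path_def by (rule restrict_ext) (simp add: cl)
      show "(\<integral>\<^sup>+\<omega>. ennreal
        (\<bar>(interp_norm B \<mu> \<gamma> (\<O> M I (cl t) \<omega>))\<^sup>2 + \<Phi> (restrict (\<lambda>t. \<O> M I (cl t) \<omega>) {0..T})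
            + \<phi> (restrict (\<lambda>t. \<O> M I (cl t) \<omega>) {0..T})\<bar>
           powr (p * Max {2 * vartheta, 2 + varphi, (1 + varphi/2) * varphi / 2})) \<partial>P) \<le> ennreal K2"
        unfolding r cl(2)[OF t] K2[symmetric]
        by (rule SUP_upper2[of M], use \<open>1 \<le> M\<close> in simp, rule SUP_upper2[OF \<open>I \<in> \<D>\<close>], rule SUP_upper2[OF t], rule order_refl)
    qed
  qed (rule assms)+

  have grid: "cl (grid_floor (T / real M) t) = grid_floor (T / real M) t" if "1 \<le> M" "t \<in> {0..T}" for M :: nat and t
    by (rule cl(2)[OF step[OF that]])
  show ?thesis
  proof
    show "(SUP M\<in>{1..}. SUP I\<in>\<D>. SUP t\<in>{0..T}. \<integral>\<^sup>+\<omega>. ennreal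
        (interp_norm B \<mu> \<gamma> (\<X> M I t \<omega>)
         powr (p * Max {4 * vartheta, 4 + 2 * varphi, varphi * (1 + varphi/2)})) \<partial>P) < \<infinity>"
      using S.scheme_moments_SUP by (simp add: cl(2) cong: SUP_cong_simp)
    show "\<exists>C>0. \<forall>M\<ge>1. \<forall>I\<in>\<D>.
        (SUP t\<in>{0..T}. ennreal_powr (\<integral>\<^sup>+\<omega>. ennreal (norm (X t \<omega> - \<X> M I t \<omega>) powr p) \<partial>P) (1 / p))
        \<le> ennreal C *
          (ennreal (M powr (- min (vartheta * chi) varrho))
           + ennreal (onorm (\<lambda>v. neg_power B \<mu> (- varrho) (v - span_proj I v)))
           + (SUP t\<in>{0..T}. ennreal_powr (\<integral>\<^sup>+\<omega>. ennreal
                (normV (O\<^sub>0 t \<omega> - span_proj I (O\<^sub>0 t \<omega>)) powr (2 * p)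
                 + normV (span_proj I (O\<^sub>0 t \<omega>) - \<O> M I t \<omega>) powr (2 * p)
                 + normV (span_proj I (O\<^sub>0 t \<omega> - O\<^sub>0 (grid_floor (T / M) t) \<omega>)) powr (2 * p)) \<partial>P)
              (1 / (2 * p))))"
      using S.error_estimate by (simp add: cl(2) grid cong: SUP_cong_simp imp_cong)
  qed
qed

end
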